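(* Let $n \geq 1$, $m, d \geq 0$ be integers and let $\lambda = (m+d, d, \ldots, d)$ be the partition with $n$ parts. Then \[ A_\lambda(n) = \frac{A(n)}{\binom{3n-2}{n-1}}\sum_{j=1}^n \binom{m+j-1}{m}\binom{n+j-2}{n-1}\binom{2n-1-j}{n-1} = A(n)\sum_{k=0}^{m}\binom{m}{k}\frac{(n+k-1)!\,(2n-1)!}{k!\,(n-k-1)!\,(2n+k-1)!}, \] and moreover there exist polynomials $P_m$ of degree $2m - \lfloor \frac{m+1}{2}\rfloor$ and $Q_m$ of degree $m - \lfloor \frac{m+1}{2}\rfloor$ (depending only on $m$) such that $A_\lambda(n) = A(n)\cdot \frac{P_m(n)}{Q_m(n)}$.
   Context: Six-vertex model: on an $r \times c$ grid there are $r$ horizontal lines and $c$ vertical lines meeting in $rc$ vertices. Each horizontal line consists of $c+1$ edges (the outermost ones are a left and a right boundary edge) and each vertical line of $r+1$ edges (the outermost ones are a top and a bottom boundary edge). A state assigns an orientation to every edge, agreeing with prescribed orientations on the boundary edges, such that at every vertex exactly two of the four adjacent edges point into the vertex and two point out. For a partition $\lambda = (\lambda_1, \ldots, \lambda_n)$ (integers $\lambda_1 \geq \cdots \geq \lambda_n \geq 0$), $A_\lambda(n)$ is the number of states on the grid with $n$ rows and $n + \lambda_1$ columns with boundary conditions: left boundary arrows point right, right boundary arrows point left, bottom boundary arrows point down, and, numbering columns $1, \ldots, n+\lambda_1$ from right to left, the top boundary arrow in column $i$ points up if $i \in \{\lambda_k + n + 1 - k : 1 \leq k \leq n\}$ and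 down otherwise. Also $A(n) = \prod_{j=0}^{n-1}\frac{(3j+1)!}{(n+j)!}$ (the number of $n\times n$ alternating sign matrices). In the second sum, $1/N! := 0$ for negative integers $N$ (so terms with $k \geq n$ vanish). *)

theory Defs
  imports Complex_Main "HOL-Computational_Algebra.Polynomial"
begin

(* Six-vertex model on a grid with r rows and c columns.
   Rows are numbered 1..r from top to bottom, columns 1..c from RIGHT to LEFT.
   Horizontal edges: hl i k for row i (1..r) and k = 0..c; edge k lies between
   column k and column k+1 (column 0 / c+1 meaning outside), so hl i 0 is the
   right boundary edge and hl i c the left boundary edge.
   hl i k = True  iff the edge points LEFT (towards the higher column index).
   Vertical edges: vu k j for column j (1..c) and k = 0..r; edge k lies between
   row k and row k+1, so vu 0 j is the top boundary edge and vu r j the bottom one.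
   vu k j = True iff the edge points UP.
   Both functions are required to be False outside their index ranges, so that
   states correspond one-to-one to orientations. *)

definition in_count :: "(nat \<Rightarrow> nat \<Rightarrow> bool) \<Rightarrow> (nat \<Rightarrow> nat \<Rightarrow> bool) \<Rightarrow> nat \<Rightarrow> nat \<Rightarrow> nat" where
  "in_count hl vu i j =
     (if \<not> hl i j then 1 else 0)            \<comment> \<open>left edge points right, into vertex\<close>
   + (if hl i (j - 1) then 1 else 0)         \<comment> \<open>right edge points left, into vertex\<close>
   + (if \<not> vu (i - 1) j then 1 else 0)      \<comment> \<open>top edge points down, into vertex\<close>
   + (if vu i j then 1 else 0)"              \<comment> \<open>bottom edge points up, into vertex\<close>

definition six_vertex_states ::
  "nat \<Rightarrow> nat \<Rightarrow> nat set \<Rightarrow> ((nat \<Rightarrow> nat \<Rightarrow> bool) \<times> (nat \<Rightarrow> nat \<Rightarrow> bool)) set" where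
  "six_vertex_states r c Up = {(hl, vu).
      (\<forall>i k. hl i k \<longrightarrow> 1 \<le> i \<and> i \<le> r \<and> k \<le> c) \<and>
      (\<forall>k j. vu k j \<longrightarrow> k \<le> r \<and> 1 \<le> j \<and> j \<le> c) \<and>
      (\<forall>i. 1 \<le> i \<and> i \<le> r \<longrightarrow> \<not> hl i c) \<and>                 \<comment> \<open>left boundary points right\<close>
      (\<forall>i. 1 \<le> i \<and> i \<le> r \<longrightarrow> hl i 0) \<and>                   \<comment> \<open>right boundary points left\<close>
      (\<forall>j. 1 \<le> j \<and> j \<le> c \<longrightarrow> \<not> vu r j) \<and>                 \<comment> \<open>bottom boundary points down\<close>
      (\<forall>j. 1 \<le> j \<and> j \<le> c \<longrightarrow> (vu 0 j \<longleftrightarrow> j \<in> Up)) \<and>       \<comment> \<open>top boundary prescribed\<close>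
      (\<forall>i j. 1 \<le> i \<and> i \<le> r \<and> 1 \<le> j \<and> j \<le> c \<longrightarrow> in_count hl vu i j = 2)}"

(* A partition lambda = (lambda_1,...,lambda_n) is given as a function
   lam :: nat => nat on indices 1..n. *)
definition A_lambda :: "(nat \<Rightarrow> nat) \<Rightarrow> nat \<Rightarrow> nat" where
  "A_lambda lam n = card (six_vertex_states n (n + lam 1)
       {lam k + n + 1 - k | k. 1 \<le> k \<and> k \<le> n})"

definition A_asm :: "nat \<Rightarrow> real" where
  "A_asm n = (\<Prod>j<n. fact (3*j+1) / fact (n+j))"

definition hook_partition :: "nat \<Rightarrow> nat \<Rightarrow> nat \<Rightarrow> nat" where
  "hook_partition m d k = (if k = 1 then m + d else d)"

(* the k-th summand of the second sum, with 1/N! := 0 for negative N *)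
definition second_term :: "nat \<Rightarrow> nat \<Rightarrow> nat \<Rightarrow> real" where
  "second_term n m k = (if k < n then
      real (m choose k) * (fact (n+k-1) * fact (2*n-1))
        / (fact k * fact (n-k-1) * fact (2*n+k-1))
    else 0)"

end

theory Submission
  imports Defs "HOL-Library.Poly_Mapping" "HOL-Library.Function_Algebras"
    "Jordan_Normal_Form.Determinant" "HOL-Computational_Algebra.Polynomial_FPS"
begin

text \<open>The rows of vertical up-arrows of a state form a monotone triangle, and Fischer's operator formula
  counts monotone triangles with a given bottom row \<open>k\<close> by a polynomial in \<open>k\<close>. The bottom row belonging to
  \<open>\<lambda>\<close> is, up to translation, \<open>1, \<dots>, n - 1, n + m\<close>. The formula shows that the count, as a polynomial in
  \<open>t = n + m\<close>, has the parity of \<open>n - 1\<close>. On the other hand the count equals \<open>\<Sum>i. ((m + i) choose i) * a i\<close>,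
  where the refined numbers \<open>a i\<close> of alternating sign matrices satisfy \<open>a (n - 1 - i) = a i\<close>. Parity and
  symmetry together determine \<open>a\<close> up to a scalar. An explicit product of two binomial coefficients is a
  solution, and the scalar follows by induction on \<open>n\<close>, since \<open>a 0\<close> is the total for \<open>n - 1\<close>.\<close>

section \<open>Shift operators\<close>

text \<open>The parity relates a last entry \<open>t\<close> to \<open>- t\<close>, far outside the
  range where \<open>mt_poly\<close> counts triangles. So its symmetries must be proved on the
  operator formula, for all integer vectors, and not on triangles. Two are combined: reversal with
  negation of \<open>k\<close>, and a cyclic rotation that costs a sign and a translation of one
  entry by the number of rows. Lattice functions under the group ring of shifts take the place of
  multivariate polynomials; polynomiality enters only as annihilation by powers of difference
  operators. The hard step is that parity and symmetry leave just one free scalar. With N = n - 1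
  and A the generating polynomial of a solution, parity becomes a congruence modulo w^(N+1) between
  polynomials of degree at most 3N+1. Symmetry of the solution carries the zero at 0 to 1 and to
  infinity, and the orders then exceed what the degree allows. The congruence thus becomes an
  identity between a polynomial with few terms and one with a zero of high order at 1, which forces
  A = 0 as soon as its constant term is 0.\<close>

type_synonym shift_op = "(nat \<Rightarrow> int) \<Rightarrow>\<^sub>0 real"
type_synonym lattice_fun = "(nat \<Rightarrow> int) \<Rightarrow> real"

text \<open>The keys form the group of integer vectors, so \<open>shift_op\<close> is its group ring
  over the reals and products of operators commute. Lattice functions become a module over this
  ring.\<close>

definition act :: "shift_op \<Rightarrow> lattice_fun \<Rightarrow> lattice_fun" where
  "act R F k = (\<Sum>c\<in>Poly_Mapping.keys R. Poly_Mapping.lookup R c * F (k + c))"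

lemma sum_fun_apply: "(\<Sum>i\<in>I. F i) x = (\<Sum>i\<in>I. F i x)"
  for F :: "'i \<Rightarrow> 'a \<Rightarrow> 'b :: comm_monoid_add"
  by (induction I rule: infinite_finite_induct) simp_all

lemma act_superset:
  assumes "finite A" "Poly_Mapping.keys R \<subseteq> A"
  shows "act R F k = (\<Sum>c\<in>A. Poly_Mapping.lookup R c * F (k + c))"
  unfolding act_def using assms
  by (intro sum.mono_neutral_left) (auto simp: in_keys_iff)

lemma act_single [simp]: "act (Poly_Mapping.single c w) F k = w * F (k + c)"
  by (subst act_superset[of "{c}"]) auto

lemma act_zero_op [simp]: "act 0 F = 0"
  by (rule ext) (simp add: act_def)

lemma act_add_op: "act (R + S) F = act R F + act S F"
proof
  fix k
  let ?A = "Poly_Mapping.keys R \<union> Poly_Mapping.keys S"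
  have "act (R + S) F k = (\<Sum>c\<in>?A. Poly_Mapping.lookup (R + S) c * F (k + c))"
    by (rule act_superset) (simp_all add: Poly_Mapping.keys_add)
  also have "\<dots> = act R F k + act S F k"
    by (simp add: act_superset[of ?A R] act_superset[of ?A S] lookup_add algebra_simps sum.distrib)
  finally show "act (R + S) F k = (act R F + act S F) k" by simp
qed

lemma act_sum_op: "act (\<Sum>i\<in>I. R i) F = (\<Sum>i\<in>I. act (R i) F)"
  by (induction I rule: infinite_finite_induct) (simp_all add: act_add_op)

lemma act_add: "act R (F + G) = act R F + act R G"
  by (rule ext) (simp add: act_def algebra_simps sum.distrib)

lemma act_zero [simp]: "act R 0 = 0"
  by (rule ext) (simp add: act_def)

lemma act_sum: "act R (\<Sum>i\<in>I. F i) = (\<Sum>i\<in>I. act R (F i))"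
  by (induction I rule: infinite_finite_induct)
    (simp_all only: sum.infinite sum.empty sum.insert act_add act_zero not_False_eq_True)

lemma op_as_sum: "R = (\<Sum>c\<in>Poly_Mapping.keys R. Poly_Mapping.single c (Poly_Mapping.lookup R c))" for R :: shift_op
  by (rule poly_mapping_eqI) (auto simp: lookup_sum lookup_single when_def in_keys_iff)

lemma act_mult: "act (R * S) F = act R (act S F)"
proof -
  have single: "act (Poly_Mapping.single c v * S) F = act (Poly_Mapping.single c v) (act S F)" for c v
  proof -
    have "act (Poly_Mapping.single c v * S) F
        = act (Poly_Mapping.single c v * (\<Sum>d\<in>Poly_Mapping.keys S. Poly_Mapping.single d (Poly_Mapping.lookup S d))) F"
      using op_as_sum[of S] by simp
    also have "\<dots> = act (Poly_Mapping.single c v) (act S F)"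
      by (rule ext) (simp add: sum_distrib_left mult_single act_sum_op act_def[of S] sum_fun_apply add.assoc mult.assoc)
    finally show ?thesis .
  qed
  have "act (R * S) F = act ((\<Sum>c\<in>Poly_Mapping.keys R. Poly_Mapping.single c (Poly_Mapping.lookup R c)) * S) F"
    using op_as_sum[of R] by simp
  also have "\<dots> = act (\<Sum>c\<in>Poly_Mapping.keys R. Poly_Mapping.single c (Poly_Mapping.lookup R c)) (act S F)"
    by (simp add: sum_distrib_right act_sum_op single)
  also have "\<dots> = act R (act S F)"
    using op_as_sum[of R] by simp
  finally show ?thesis .
qed

lemma act_one [simp]: "act 1 F = F"
proof
  fix k
  have "act (Poly_Mapping.single 0 1) F k = F k" by (simp only: act_single add_0_right mult_1)
  then show "act 1 F k = F k" by simp
qed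

lemma act_uminus_op: "act (- R) F = - act R F"
  by (rule ext) (simp add: act_def sum_negf)

lemma act_diff_op: "act (R - S) F = act R F - act S F"
  using act_add_op[of R "- S" F] by (simp add: act_uminus_op)

lemma act_uminus: "act R (- F) = - act R F"
  by (rule ext) (simp add: act_def sum_negf)

lemma act_diff: "act R (F - G) = act R F - act R G"
  using act_add[of R F "- G"] by (simp add: act_uminus)

definition scale :: "real \<Rightarrow> lattice_fun \<Rightarrow> lattice_fun" where "scale r F k = r * F k"

lemma scale_apply [simp]: "scale r F k = r * F k" by (simp add: scale_def)

lemma act_scale: "act R (scale r F) = scale r (act R F)"
  by (rule ext) (simp add: act_def sum_distrib_left mult_ac)

definition const_op :: "real \<Rightarrow> shift_op" where "const_op r = Poly_Mapping.single 0 r"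

lemma act_const_op [simp]: "act (const_op r) F = scale r F"
  by (rule ext) (simp add: const_op_def)

definition unit_vec :: "nat \<Rightarrow> nat \<Rightarrow> int" where "unit_vec p i = (if i = p then 1 else 0)"

definition shift :: "nat \<Rightarrow> shift_op" where "shift p = Poly_Mapping.single (unit_vec p) 1"

lemma add_unit_vec: "k + unit_vec p = k(p := k p + 1)"
  by (auto simp: unit_vec_def fun_eq_iff)

lemma act_shift: "act (shift p) F k = F (k(p := k p + 1))"
  by (simp add: shift_def add_unit_vec)

text \<open>In terms of differences this is \<open>1 + shift p * (shift q - 1)\<close>, the factor
  of a pair in Fischer's operator product.\<close>

definition step_op :: "nat \<Rightarrow> nat \<Rightarrow> shift_op" where "step_op p q = 1 - shift p + shift p * shift q"

lemma act_step_op: "act (step_op p q) F = F - act (shift p) F + act (shift p) (act (shift q) F)"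
  by (simp add: step_op_def act_add_op act_diff_op act_mult)

lemma act_prod_intertwine:
  assumes "finite A" "\<And>x F. x \<in> A \<Longrightarrow> s (act (R x) F) = act (R' x) (s F)"
  shows "s (act (\<Prod>x\<in>A. R x) F) = act (\<Prod>x\<in>A. R' x) (s F)"
  using assms
  by (induction A arbitrary: F rule: finite_induct) (simp_all add: act_mult)

lemma act_prod_fixed:
  assumes "finite A" "\<And>x. x \<in> A \<Longrightarrow> act (R x) F = F"
  shows "act (\<Prod>x\<in>A. R x) F = F"
  using assms by (induction A rule: finite_induct) (simp_all add: act_mult)

lemma prod_affine_expand:
  "(\<Prod>q<n. a + b * D q) = (\<Sum>j\<le>n. a ^ (n - j) * b ^ j * (\<Sum>S | S \<subseteq> {..<n} \<and> card S = j. \<Prod>q\<in>S. D q))"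
  for a b :: "'a :: comm_ring_1"
proof -
  have "(\<Prod>q<n. a + b * D q) = (\<Prod>q<n. b * D q + a)" by (simp add: add.commute)
  also have "\<dots> = (\<Sum>S\<in>Pow {..<n}. (\<Prod>q\<in>S. b * D q) * (\<Prod>q\<in>{..<n} - S. a))"
    by (rule prod_add) simp
  also have "\<dots> = (\<Sum>S\<in>Pow {..<n}. a ^ (n - card S) * b ^ card S * (\<Prod>q\<in>S. D q))"
  proof (rule sum.cong[OF refl])
    fix S assume "S \<in> Pow {..<n}"
    then have "S \<subseteq> {..<n}" by auto
    then show "(\<Prod>q\<in>S. b * D q) * (\<Prod>q\<in>{..<n} - S. a) = a ^ (n - card S) * b ^ card S * (\<Prod>q\<in>S. D q)"
      by (simp add: prod.distrib card_Diff_subset finite_subset[of S])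
  qed
  also have "\<dots> = (\<Sum>j\<le>n. \<Sum>S | S \<in> Pow {..<n} \<and> card S = j. a ^ (n - card S) * b ^ card S * (\<Prod>q\<in>S. D q))"
    by (rule sum.group[symmetric]) (auto simp: card_mono[of "{..<n}", simplified])
  also have "\<dots> = (\<Sum>j\<le>n. a ^ (n - j) * b ^ j * (\<Sum>S | S \<subseteq> {..<n} \<and> card S = j. \<Prod>q\<in>S. D q))"
    by (intro sum.cong refl) (simp add: sum_distrib_left)
  finally show ?thesis .
qed

section \<open>The binomial determinant\<close>

definition binc :: "int \<Rightarrow> nat \<Rightarrow> real" where "binc x j = (of_int x gchoose j)"

lemma binc_0 [simp]: "binc x 0 = 1" by (simp add: binc_def)

lemma binc_Suc: "binc (x + 1) (Suc j) = binc x (Suc j) + binc x j"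
  by (simp add: binc_def gbinomial_Suc_Suc)

text \<open>Row \<open>i\<close> sees only the variable \<open>k i\<close>, so an operator in one
  variable changes a single row; hence the row functions may differ from row to row.\<close>

definition rowdet :: "nat \<Rightarrow> (nat \<Rightarrow> int \<Rightarrow> nat \<Rightarrow> real) \<Rightarrow> lattice_fun" where
  "rowdet n G k = det (mat n n (\<lambda>(i, j). G i (k i) j))"

lemma rowdet_leibniz:
  "rowdet n G k = (\<Sum>p | p permutes {0..<n}. signof p * (\<Prod>i\<in>{0..<n}. G i (k i) (p i)))"
  unfolding rowdet_def
  by (subst det_def'[of _ n]) (auto intro!: sum.cong prod.cong simp: permutes_in_image)

lemma rowdet_cong:
  assumes "\<And>i. i < n \<Longrightarrow> k i = k' i" "\<And>i x j. i < n \<Longrightarrow> j < n \<Longrightarrow> G i x j = G' i x j"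
  shows "rowdet n G k = rowdet n G' k'"
  unfolding rowdet_def using assms by (intro arg_cong[of _ _ det] eq_matI) auto

lemma rowdet_row_linear:
  assumes "q < n"
  shows "rowdet n (G(q := \<lambda>x j. a * g x j + b * h x j)) k
       = a * rowdet n (G(q := g)) k + b * rowdet n (G(q := h)) k"
proof -
  have split: "(\<Prod>i\<in>{0..<n}. (G(q := f)) i (k i) (p i)) = f (k q) (p q) * (\<Prod>i\<in>{0..<n} - {q}. G i (k i) (p i))" for f p
    using assms by (subst prod.remove[of _ q]) auto
  show ?thesis
    unfolding rowdet_leibniz split sum_distrib_left sum.distrib[symmetric]
    by (intro sum.cong refl) (simp add: algebra_simps)
qed

lemma act_affine_rowdet:
  assumes "q < n"
  shows "act (const_op a + const_op b * shift q) (rowdet n G)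
       = rowdet n (G(q := \<lambda>x j. a * G q x j + b * G q (x + 1) j))"
proof
  fix k
  have shift: "rowdet n G (k(q := k q + 1)) = rowdet n (G(q := \<lambda>x. G q (x + 1))) k"
    unfolding rowdet_def by (intro arg_cong[of _ _ det] eq_matI) auto
  show "act (const_op a + const_op b * shift q) (rowdet n G) k
       = rowdet n (G(q := \<lambda>x j. a * G q x j + b * G q (x + 1) j)) k"
    unfolding rowdet_row_linear[OF assms]
    by (simp add: act_add_op act_mult act_shift shift)
qed

lemma act_affine_prod_rowdet:
  assumes "m \<le> n"
  shows "act (\<Prod>q<m. const_op a + const_op b * shift q) (rowdet n G)
       = rowdet n (\<lambda>i. if i < m then (\<lambda>x j. a * G i x j + b * G i (x + 1) j) else G i)"
  using assms
proof (induction m)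
  case (Suc m)
  have "act (\<Prod>q<Suc m. const_op a + const_op b * shift q) (rowdet n G)
     = act (const_op a + const_op b * shift m) (act (\<Prod>q<m. const_op a + const_op b * shift q) (rowdet n G))"
    by (simp add: mult.commute act_mult)
  also have "\<dots> = rowdet n (\<lambda>i. if i < Suc m then (\<lambda>x j. a * G i x j + b * G i (x + 1) j) else G i)"
    using Suc by (simp add: act_affine_rowdet) (rule arg_cong[of _ _ "rowdet n"], auto simp: fun_eq_iff)
  finally show ?case .
qed simp

lemma const_op_simps:
  "const_op 1 = 1" "const_op 0 = 0" "const_op (a + b) = const_op a + const_op b"
  "const_op (- a) = - const_op a" "const_op (a - b) = const_op a - const_op b"
  "const_op (a ^ j) = const_op a ^ j"
proof -
  show 1: "const_op 1 = 1" "const_op 0 = 0" "const_op (a + b) = const_op a + const_op b"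
    "const_op (- a) = - const_op a" "const_op (a - b) = const_op a - const_op b"
    by (simp_all add: const_op_def single_add single_uminus single_diff)
  show "const_op (a ^ j) = const_op a ^ j"
  proof (induction j)
    case (Suc j)
    have "const_op (a ^ Suc j) = const_op a * const_op (a ^ j)"
      by (simp add: const_op_def mult_single)
    then show ?case using Suc by simp
  qed (use 1 in simp)
qed

text \<open>This is the product of \<open>(k j - k i) / (j - i)\<close> over \<open>i < j\<close>,
  written in the binomial basis so that differences lower column indices.\<close>

definition vand :: "nat \<Rightarrow> lattice_fun" where "vand n = rowdet n (\<lambda>_. binc)"

text \<open>An antidifference of \<open>vand\<close> in all variables at once. The same determinants
  are the minors of \<open>vand (Suc n)\<close> along its column of ones.\<close>

definition vand_up :: "nat \<Rightarrow> lattice_fun" where "vand_up n = rowdet n (\<lambda>_ x j. binc x (Suc j))"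

lemma det_mult_triangular:
  fixes G :: "nat \<Rightarrow> nat \<Rightarrow> 'a :: comm_ring_1"
  assumes "\<And>i j. i < n \<Longrightarrow> j < n \<Longrightarrow> H i j = (\<Sum>l<n. G i l * U l j)"
    and "\<And>l j. j < l \<Longrightarrow> l < n \<Longrightarrow> U l j = 0"
  shows "det (mat n n (\<lambda>(i, j). H i j)) = det (mat n n (\<lambda>(i, j). G i j)) * (\<Prod>j<n. U j j)"
proof -
  let ?U = "mat n n (\<lambda>(l, j). U l j)"
  have "mat n n (\<lambda>(i, j). H i j) = mat n n (\<lambda>(i, j). G i j) * ?U"
    by (rule eq_matI) (auto simp: assms(1) scalar_prod_def atLeast0LessThan)
  moreover have "det ?U = (\<Prod>j<n. U j j)"
    by (subst det_upper_triangular[of _ n])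
       (auto simp: assms(2) diag_mat_def interv_sum_list_conv_sum_set_nat prod.list_conv_set_nth
          atLeast0LessThan intro!: prod.cong)
  ultimately show ?thesis by (simp add: det_mult[of _ n])
qed

lemma act_one_plus_vand: "act (\<Prod>q<n. 1 + const_op y * (shift q - 1)) (vand n) = vand n"
proof
  fix k
  have eq: "1 + const_op y * (shift q - 1) = const_op (1 - y) + const_op y * shift q" for q
    by (simp add: const_op_simps algebra_simps)
  have "act (\<Prod>q<n. 1 + const_op y * (shift q - 1)) (vand n) k
      = rowdet n (\<lambda>_ x j. (1 - y) * binc x j + y * binc (x + 1) j) k"
    unfolding eq vand_def act_affine_prod_rowdet[OF order.refl] by (rule rowdet_cong) auto
  also have "\<dots> = vand n k * (\<Prod>j<n. (\<lambda>l j. if l = j then 1 else if Suc l = j then y else 0) j j)"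
    unfolding vand_def rowdet_def
  proof (rule det_mult_triangular[where U = "\<lambda>l j. if l = j then 1 else if Suc l = j then y else 0"
        and G = "\<lambda>i. binc (k i)"])
    fix i j assume "j < n"
    then show "(1 - y) * binc (k i) j + y * binc (k i + 1) j
       = (\<Sum>l<n. binc (k i) l * (if l = j then 1 else if Suc l = j then y else 0))"
    proof (cases j)
      case (Suc j')
      have "(\<Sum>l<n. binc (k i) l * (if l = j then 1 else if Suc l = j then y else 0))
          = (\<Sum>l\<in>{j', j}. binc (k i) l * (if l = j then 1 else if Suc l = j then y else 0))"
        using \<open>j < n\<close> Suc by (intro sum.mono_neutral_right) auto
      then show ?thesis using Suc binc_Suc[of "k i" j'] by (simp add: algebra_simps)
    qed (simp add: if_distrib[of "\<lambda>c. _ * c"] cong: if_cong)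
  qed auto
  finally show "act (\<Prod>q<n. 1 + const_op y * (shift q - 1)) (vand n) k = vand n k" by simp
qed

text \<open>For a scalar \<open>y\<close> the operator \<open>\<Prod>q<n. 1 + y * (shift q - 1)\<close> acts by unitriangular column
  operations, so it fixes the determinant; now compare coefficients in \<open>y\<close>.\<close>

lemma elem_sym_kills_vand:
  assumes "1 \<le> j" "j \<le> n"
  shows "act (\<Sum>S | S \<subseteq> {..<n} \<and> card S = j. \<Prod>q\<in>S. shift q - 1) (vand n) = 0"
proof
  fix k
  define e where "e j = (\<Sum>S | S \<subseteq> {..<n} \<and> card S = j. \<Prod>q\<in>S. shift q - 1)" for j
  define p where "p = (\<Sum>j\<le>n. monom (act (e j) (vand n) k) j)"
  have "poly p y = vand n k" for y
  proof -
    have "vand n k = act (\<Sum>j\<le>n. const_op (y ^ j) * e j) (vand n) k"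
      using act_one_plus_vand[where n = n and y = y] by (simp add: prod_affine_expand e_def const_op_simps)
    also have "\<dots> = poly p y"
      by (simp add: act_sum_op act_mult act_scale p_def poly_sum poly_monom sum_fun_apply mult.commute)
    finally show ?thesis ..
  qed
  then have "p = [:vand n k:]"
    by (simp add: poly_eq_poly_eq_iff[symmetric] fun_eq_iff)
  moreover have "coeff p j = act (e j) (vand n) k"
    using assms by (simp add: p_def coeff_sum)
  ultimately show "act (e j) (vand n) k = 0 k"
    using assms by (simp add: coeff_pCons split: nat.splits)
qed

text \<open>Only the term without differences survives \<open>elem_sym_kills_vand\<close>. Since
  \<open>a\<close> and \<open>b\<close> may themselves be operators, this evaluates products whose
  factors all share one variable.\<close>

lemma act_affine_vand: "act (\<Prod>q<n. a + b * (shift q - 1)) (vand n) = act (a ^ n) (vand n)"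
proof -
  let ?e = "\<lambda>j. \<Sum>S | S \<subseteq> {..<n} \<and> card S = j. \<Prod>q\<in>S. shift q - 1"
  have "act (\<Prod>q<n. a + b * (shift q - 1)) (vand n) = (\<Sum>j\<le>n. act (a ^ (n - j) * b ^ j * ?e j) (vand n))"
    unfolding prod_affine_expand act_sum_op ..
  also have "\<dots> = (\<Sum>j\<le>n. if j = 0 then act (a ^ n) (vand n) else 0)"
  proof (rule sum.cong[OF refl])
    fix j assume "j \<in> {..n}"
    have "{S. S \<subseteq> {..<n} \<and> card S = 0} = {{}}" by (auto dest: finite_subset)
    then show "act (a ^ (n - j) * b ^ j * ?e j) (vand n) = (if j = 0 then act (a ^ n) (vand n) else 0)"
      using \<open>j \<in> {..n}\<close> by (cases "j = 0") (simp_all add: act_mult elem_sym_kills_vand del: sum_fun_apply)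
  qed
  also have "\<dots> = act (a ^ n) (vand n)" by simp
  finally show ?thesis .
qed

lemma prod_shift_V: "act (\<Prod>q<n. shift q) (vand n) = vand n"
  using act_affine_vand[where n = n and a = 1 and b = 1] by simp

text \<open>The determinant is a polynomial of degree below \<open>n\<close> in each variable;
  concretely, \<open>n\<close> differences turn row \<open>q\<close> into zeros.\<close>

lemma diff_power_kills_vand:
  assumes "q < n"
  shows "act ((shift q - 1) ^ n) (vand n) = 0"
proof -
  have step: "act ((shift q - 1) ^ m) (vand n)
     = rowdet n (\<lambda>i x j. if i = q then if j < m then 0 else binc x (j - m) else binc x j)" for m
  proof (induction m)
    case 0
    then show ?case by (simp add: vand_def cong: if_cong)
  next
    case (Suc m)
    have "shift q - 1 = const_op (-1) + const_op 1 * shift q" by (simp add: const_op_simps)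
    then have "act ((shift q - 1) ^ Suc m) (vand n)
       = act (const_op (-1) + const_op 1 * shift q) (act ((shift q - 1) ^ m) (vand n))" by (simp add: act_mult)
    also have "\<dots> = rowdet n (\<lambda>i x j. if i = q then if j < Suc m then 0 else binc x (j - Suc m) else binc x j)"
      unfolding Suc act_affine_rowdet[OF assms]
    proof (rule arg_cong[of _ _ "rowdet n"], intro ext)
      fix i x j
      have "binc (x + 1) (j - m) = binc x (j - m) + binc x (j - Suc m)" if "m < j"
        using that binc_Suc[of x "j - Suc m"] by (simp add: Suc_diff_Suc)
      then show "((\<lambda>i x j. if i = q then if j < m then 0 else binc x (j - m) else binc x j)
          (q := \<lambda>x j. (-1) * (if q = q then if j < m then 0 else binc x (j - m) else binc x j)
             + 1 * (if q = q then if j < m then 0 else binc (x + 1) (j - m) else binc (x + 1) j))) i x j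
         = (if i = q then if j < Suc m then 0 else binc x (j - Suc m) else binc x j)"
        by (auto simp: not_less less_Suc_eq)
    qed
    finally show ?case .
  qed
  show ?thesis
  proof
    fix k
    have Z: "(\<Prod>i\<in>{0..<n}. (if i = q then if p i < n then 0 else binc (k i) (p i - n) else binc (k i) (p i))) = 0"
      if "p permutes {0..<n}" for p
      using permutes_in_image[OF that, of q] assms by (intro prod_zero bexI[of _ q]) auto
    show "act ((shift q - 1) ^ n) (vand n) k = 0 k"
      unfolding step rowdet_leibniz zero_fun_apply
      by (intro sum.neutral ballI) (simp only: mem_Collect_eq Z mult_zero_right)
  qed
qed

lemma prod_diff_vand_up: "act (\<Prod>q<n. shift q - 1) (vand_up n) = vand n"
proof -
  have "shift q - 1 = const_op (-1) + const_op 1 * shift q" for q by (simp add: const_op_simps)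
  then show ?thesis
    unfolding vand_up_def vand_def by (simp only: act_affine_prod_rowdet[OF order.refl])
      (intro ext rowdet_cong, simp_all add: binc_Suc)
qed

lemma rowdet_swap:
  assumes "i < n" "j < n" "i \<noteq> j"
  shows "rowdet n (\<lambda>_. g) (k \<circ> transpose i j) = - rowdet n (\<lambda>_. g) k"
proof -
  have "mat n n (\<lambda>(i', j'). g ((k \<circ> transpose i j) i') j') = swaprows i j (mat n n (\<lambda>(i', j'). g (k i') j'))"
    using assms by (intro eq_matI) (auto simp: transpose_def)
  then show ?thesis
    unfolding rowdet_def by (simp add: det_swaprows[of i n j] assms)
qed

lemma laplace_vand:
  "vand (Suc n) k = (\<Sum>r\<le>n. (-1) ^ r * vand_up n (\<lambda>i. if i < r then k i else k (Suc i)))"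
proof -
  let ?A = "mat (Suc n) (Suc n) (\<lambda>(i, j). binc (k i) j)"
  have "vand (Suc n) k = (\<Sum>r<Suc n. ?A $$ (r, 0) * cofactor ?A r 0)"
    unfolding vand_def rowdet_def by (rule laplace_expansion_column) auto
  also have "\<dots> = (\<Sum>r\<le>n. (-1) ^ r * vand_up n (\<lambda>i. if i < r then k i else k (Suc i)))"
    unfolding lessThan_Suc_atMost
  proof (rule sum.cong[OF refl])
    fix r assume "r \<in> {..n}"
    have "mat_delete ?A r 0 = mat n n (\<lambda>(i, j). binc (if i < r then k i else k (Suc i)) (Suc j))"
      by (rule eq_matI) (auto simp: mat_delete_def)
    then show "?A $$ (r, 0) * cofactor ?A r 0 = (-1) ^ r * vand_up n (\<lambda>i. if i < r then k i else k (Suc i))"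
      using \<open>r \<in> {..n}\<close> by (simp add: cofactor_def vand_up_def rowdet_def)
  qed
  finally show ?thesis .
qed

text \<open>Negating the upper entry of a binomial and expanding by Vandermonde's convolution is an
  upper triangular change of columns with diagonal \<open>(-1) ^ j\<close>.\<close>

lemma vand_uminus: "vand n (\<lambda>i. - k i) = vand n k * (\<Prod>j<n. (-1) ^ j)"
proof -
  let ?U = "\<lambda>l j. if l \<le> j then (-1) ^ j * ((of_nat j - 1 :: real) gchoose (j - l)) else 0"
  have "det (mat n n (\<lambda>(i, j). binc (- k i) j)) = det (mat n n (\<lambda>(i, j). binc (k i) j)) * (\<Prod>j<n. ?U j j)"
  proof (rule det_mult_triangular[where U = ?U and G = "\<lambda>i. binc (k i)"])
    fix i j assume "j < n"
    have "binc (- k i) j = (-1) ^ j * ((of_int (k i) + (of_nat j - 1) :: real) gchoose j)"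
      by (simp add: binc_def gbinomial_minus algebra_simps)
    also have "\<dots> = (\<Sum>l\<le>j. binc (k i) l * ?U l j)"
      by (simp add: gbinomial_Vandermonde[symmetric] sum_distrib_left atLeast0AtMost binc_def mult_ac)
    also have "\<dots> = (\<Sum>l<n. binc (k i) l * ?U l j)"
      using \<open>j < n\<close> by (intro sum.mono_neutral_left) auto
    finally show "binc (- k i) j = (\<Sum>l<n. binc (k i) l * ?U l j)" .
  qed auto
  then show ?thesis
    by (simp add: vand_def rowdet_def)
qed

lemma vand_permute:
  assumes "p permutes {0..<n}"
  shows "vand n (\<lambda>i. k (p i)) = signof p * vand n k"
proof -
  have "mat n n (\<lambda>(i, j). binc (k (p i)) j) = mat n n (\<lambda>(i, j). mat n n (\<lambda>(i, j). binc (k i) j) $$ (p i, j))"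
    using permutes_in_image[OF assms] by (intro eq_matI) auto
  then show ?thesis
    unfolding vand_def rowdet_def by (simp add: det_permute_rows[of _ n, OF _ assms])
qed

lemma vand_iota: "vand n int = 1"
  unfolding vand_def rowdet_def
  by (subst det_lower_triangular[of n])
     (auto simp: diag_mat_def binc_def binomial_gbinomial[symmetric] prod.list_conv_set_nth)

lemma act_prod_shift:
  assumes "finite A"
  shows "act (\<Prod>q\<in>A. shift q) F k = F (\<lambda>i. if i \<in> A then k i + 1 else k i)"
  using assms
proof (induction A arbitrary: k rule: finite_induct)
  case (insert q A)
  have "act (\<Prod>q\<in>insert q A. shift q) F k = F (\<lambda>i. if i \<in> A then (k(q := k q + 1)) i + 1 else (k(q := k q + 1)) i)"
    using insert by (simp add: act_mult act_shift)
  also have "(\<lambda>i. if i \<in> A then (k(q := k q + 1)) i + 1 else (k(q := k q + 1)) i)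
      = (\<lambda>i. if i \<in> insert q A then k i + 1 else k i)"
    using insert by (auto simp: fun_eq_iff)
  finally show ?case .
qed simp

lemma vand_cong: "(\<And>i. i < n \<Longrightarrow> k i = k' i) \<Longrightarrow> vand n k = vand n k'"
  unfolding vand_def by (rule rowdet_cong) auto

lemma vand_translate: "vand n (\<lambda>i. k i + c) = vand n k"
proof -
  have up: "vand n (\<lambda>i. k i + 1) = vand n k" for k
    using fun_cong[OF prod_shift_V, of n k] unfolding act_prod_shift[OF finite_lessThan]
    by (subst vand_cong[of n _ "\<lambda>i. if i \<in> {..<n} then k i + 1 else k i"]) auto
  show ?thesis
  proof (induction c rule: int_induct[of _ 0])
    case (step1 c)
    then show ?case using up[of "\<lambda>i. k i + c"] by (simp add: add.assoc)
  next
    case (step2 c)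
    then show ?case using up[of "\<lambda>i. k i + (c - 1)"] by (simp add: add.assoc)
  qed simp
qed

text \<open>Negation and reversal each give a sign that depends only on \<open>n\<close>. The
  product of the two signs is read off at \<open>k = int\<close>, where the determinant is 1 and the
  reflected vector is a translate; the sign of the reversal is never computed.\<close>

lemma vand_reflect: "vand n (\<lambda>i. - k (n - 1 - i)) = vand n k"
proof -
  define p where "p i = (if i < n then n - 1 - i else i)" for i
  have p: "p permutes {0..<n}"
    by (rule bij_imp_permutes) (auto simp: p_def intro!: bij_betw_byWitness[of _ p])
  have eq: "vand n (\<lambda>i. - k (n - 1 - i)) = (\<Prod>j<n. (-1) ^ j) * signof p * vand n k" for k
  proof -
    have "vand n (\<lambda>i. - k (n - 1 - i)) = vand n (\<lambda>i. - k (p i))"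
      by (rule vand_cong) (simp add: p_def)
    then show ?thesis by (simp add: vand_uminus vand_permute[OF p])
  qed
  have "vand n (\<lambda>i. - int (n - 1 - i)) = vand n (\<lambda>i. int i + (- (int n - 1)))"
    by (rule vand_cong) auto
  then have "(\<Prod>j<n. (-1) ^ j) * signof p = (1 :: real)"
    using eq[of int] by (simp add: vand_translate vand_iota)
  then show ?thesis using eq[of k] by simp
qed

section \<open>The operator formula for monotone triangles\<close>

definition pairs :: "nat \<Rightarrow> (nat \<times> nat) set" where "pairs n = {(p, q). p < q \<and> q < n}"

lemma finite_pairs [simp]: "finite (pairs n)"
  by (rule finite_subset[of _ "{..<n} \<times> {..<n}"]) (auto simp: pairs_def)

definition step_prod :: "nat \<Rightarrow> shift_op" where "step_prod n = (\<Prod>(p, q)\<in>pairs n. step_op p q)"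

text \<open>Fischer's operator formula: for strictly increasing \<open>k\<close>, the number of monotone triangles with
  bottom row \<open>k 0 < \<dots> < k (n - 1)\<close> is \<open>mt_poly n k\<close>. The function \<open>mt_potential n\<close> is a common discrete
  antiderivative of \<open>mt_poly n\<close> in all \<open>n\<close> variables.\<close>

definition mt_poly :: "nat \<Rightarrow> lattice_fun" where "mt_poly n = act (step_prod n) (vand n)"

definition mt_potential :: "nat \<Rightarrow> lattice_fun" where "mt_potential n = act (step_prod n) (vand_up n)"

text \<open>Vectors are functions on all of \<open>nat\<close>, so an identity in \<open>n\<close>
  variables must be free to change the entries from \<open>n\<close> on.\<close>

definition depends_below :: "nat \<Rightarrow> lattice_fun \<Rightarrow> bool" where
  "depends_below n F \<longleftrightarrow> (\<forall>k k'. (\<forall>i<n. k i = k' i) \<longrightarrow> F k = F k')"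

lemma depends_belowD: "depends_below n F \<Longrightarrow> (\<And>i. i < n \<Longrightarrow> k i = k' i) \<Longrightarrow> F k = F k'"
  by (auto simp: depends_below_def)

lemma depends_below_act: "depends_below n F \<Longrightarrow> depends_below n (act R F)"
  unfolding depends_below_def act_def by (intro allI impI sum.cong refl arg_cong2[of _ _ _ _ "(*)"]) auto

lemma depends_below_mt_poly: "depends_below n (mt_poly n)" and depends_below_mt_potential: "depends_below n (mt_potential n)"
  unfolding mt_poly_def mt_potential_def
  by (intro depends_below_act; unfold depends_below_def vand_def vand_up_def; intro allI impI rowdet_cong; simp)+

lemma act_shift_comp:
  assumes "inj c"
  shows "(\<lambda>k. act (shift p) F (k \<circ> c)) = act (shift (c p)) (\<lambda>k. F (k \<circ> c))"
proof
  fix k :: "nat \<Rightarrow> int"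
  have "(k \<circ> c)(p := (k \<circ> c) p + 1) = k(c p := k (c p) + 1) \<circ> c"
    using assms by (auto simp: fun_eq_iff inj_eq)
  then show "act (shift p) F (k \<circ> c) = act (shift (c p)) (\<lambda>k. F (k \<circ> c)) k"
    by (simp add: act_shift)
qed

lemma act_step_op_comp:
  assumes "inj c"
  shows "(\<lambda>k. act (step_op p q) F (k \<circ> c)) = act (step_op (c p) (c q)) (\<lambda>k. F (k \<circ> c))"
  unfolding act_step_op act_shift_comp[OF assms, symmetric] by (simp add: fun_eq_iff)

lemma act_prod_step_op_comp:
  assumes "inj c" "finite A"
  shows "(\<lambda>k. act (\<Prod>(p, q)\<in>A. step_op p q) F (k \<circ> c)) = act (\<Prod>(p, q)\<in>A. step_op (c p) (c q)) (\<lambda>k. F (k \<circ> c))"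
proof -
  have "(\<lambda>F k. F (k \<circ> c)) (act (\<Prod>x\<in>A. case x of (p, q) \<Rightarrow> step_op p q) F)
      = act (\<Prod>x\<in>A. case x of (p, q) \<Rightarrow> step_op (c p) (c q)) ((\<lambda>F k. F (k \<circ> c)) F)"
    by (rule act_prod_intertwine[OF assms(2), of "\<lambda>F k. F (k \<circ> c)"]) (auto simp: act_step_op_comp[OF assms(1)])
  then show ?thesis by simp
qed

lemma act_commute: "act R (act S F) = act S (act R F)"
  by (metis act_mult mult.commute)

text \<open>This relation on the diagonals \<open>k i = k (Suc i)\<close> cancels all boundary terms when the strict
  interlacing conditions are summed out one variable at a time.\<close>

definition bethe :: "nat \<Rightarrow> lattice_fun \<Rightarrow> bool" where
  "bethe n F \<longleftrightarrow> (\<forall>i k. Suc i < n \<longrightarrow> k i = k (Suc i) \<longrightarrow>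
     F k - F (k(Suc i := k i + 1)) + F (k(i := k i + 1, Suc i := k i + 1)) = 0)"

text \<open>The expression in \<open>bethe\<close> is \<open>step_op (Suc i) i\<close> applied to
  the function. This extra factor makes the product symmetric in the two neighbouring variables, so
  it sends the antisymmetric \<open>A\<close> to an antisymmetric function, which vanishes where the
  two entries agree.\<close>

lemma bethe_step_prod:
  assumes "\<And>i k. Suc i < n \<Longrightarrow> A (k \<circ> transpose i (Suc i)) = - A k"
  shows "bethe n (act (step_prod n) A)"
  unfolding bethe_def
proof (intro allI impI)
  fix i k assume i: "Suc i < n" and ki: "k i = (k (Suc i) :: int)"
  let ?t = "transpose i (Suc i)"
  let ?F = "act (step_op (Suc i) i) (act (step_prod n) A)"
  let ?P = "pairs n - {(i, Suc i)}"
  have mem: "(i, Suc i) \<in> pairs n" using i by (simp add: pairs_def)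
  have step_prod: "step_prod n = step_op i (Suc i) * (\<Prod>(p, q)\<in>?P. step_op p q)"
    unfolding step_prod_def using prod.remove[OF finite_pairs mem, of "\<lambda>(p, q). step_op p q"] by simp
  have "bij_betw (map_prod ?t ?t) ?P ?P"
    by (rule bij_betw_byWitness[where f' = "map_prod ?t ?t"])
       (use i in \<open>auto simp: pairs_def transpose_def split: if_splits\<close>)
  from prod.reindex_bij_betw[OF this, of "\<lambda>(p, q). step_op p q"]
  have perm: "(\<Prod>(p, q)\<in>?P. step_op (?t p) (?t q)) = (\<Prod>(p, q)\<in>?P. step_op p q)"
    by (simp add: case_prod_unfold)
  let ?s = "\<lambda>F k. F (k \<circ> ?t)"
  have A: "?s A = - A" using assms[OF i] by (simp add: fun_eq_iff)
  have "?s ?F = ?s (act (step_op (Suc i) i) (act (step_op i (Suc i)) (act (\<Prod>(p, q)\<in>?P. step_op p q) A)))"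
    by (simp add: step_prod act_mult)
  also have "\<dots> = act (step_op i (Suc i)) (act (step_op (Suc i) i) (act (\<Prod>(p, q)\<in>?P. step_op p q) (?s A)))"
    by (simp add: act_step_op_comp act_prod_step_op_comp perm)
  also have "\<dots> = - ?F"
    unfolding A by (simp add: step_prod act_mult act_uminus act_commute[of "step_op i (Suc i)" "step_op (Suc i) i"])
  finally have "?F (k \<circ> ?t) = - ?F k" by (simp add: fun_eq_iff)
  moreover have "k \<circ> ?t = k" using ki by (auto simp: fun_eq_iff transpose_def)
  ultimately have "?F k = 0" by simp
  then show "act (step_prod n) A k - act (step_prod n) A (k(Suc i := k i + 1)) + act (step_prod n) A (k(i := k i + 1, Suc i := k i + 1)) = 0"
    using ki by (simp add: act_step_op act_shift fun_upd_twist)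
qed

lemma bethe_mt_potential: "bethe n (mt_potential n)"
  unfolding mt_potential_def by (rule bethe_step_prod) (simp add: vand_up_def rowdet_swap)

section \<open>The recursion read off the Laplace expansion\<close>

definition skip :: "nat \<Rightarrow> nat \<Rightarrow> nat" where "skip r i = (if i < r then i else Suc i)"

lemma inj_skip: "inj (skip r)" by (auto simp: inj_def skip_def split: if_splits)

lemma step_prod_Suc_split:
  assumes "r \<le> n"
  shows "step_prod (Suc n) = (\<Prod>(p, q)\<in>pairs n. step_op (skip r p) (skip r q)) * ((\<Prod>p<r. step_op p r) * (\<Prod>q\<in>{r<..n}. step_op r q))"
proof -
  have inj: "inj_on (map_prod (skip r) (skip r)) (pairs n)"
    using inj_skip by (auto simp: inj_on_def inj_def)
  have "pairs (Suc n) \<subseteq> map_prod (skip r) (skip r) ` pairs n \<union> ((\<lambda>p. (p, r)) ` {..<r} \<union> Pair r ` {r<..n})"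
  proof
    fix x assume "x \<in> pairs (Suc n)"
    then obtain p q where x: "x = (p, q)" "p < q" "q \<le> n" by (auto simp: pairs_def)
    define u where "u i = (if i < r then i else i - 1)" for i
    consider "p = r" | "q = r" | "p \<noteq> r" "q \<noteq> r" by blast
    then show "x \<in> map_prod (skip r) (skip r) ` pairs n \<union> ((\<lambda>p. (p, r)) ` {..<r} \<union> Pair r ` {r<..n})"
    proof cases
      case 3
      then have "(u p, u q) \<in> pairs n" "x = map_prod (skip r) (skip r) (u p, u q)"
        using x assms by (auto simp: pairs_def u_def skip_def)
      then show ?thesis by blast
    qed (use x in auto)
  qed
  then have eq: "pairs (Suc n) = map_prod (skip r) (skip r) ` pairs n \<union> ((\<lambda>p. (p, r)) ` {..<r} \<union> Pair r ` {r<..n})"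
    using assms by (auto simp: pairs_def skip_def)
  have disj: "map_prod (skip r) (skip r) ` pairs n \<inter> ((\<lambda>p. (p, r)) ` {..<r} \<union> Pair r ` {r<..n}) = {}"
    by (auto simp: skip_def split: if_splits)
  show ?thesis
    unfolding step_prod_def eq
    by (subst prod.union_disjoint[OF _ _ disj], simp, simp, subst prod.union_disjoint)
       (auto simp: prod.reindex[OF inj] prod.reindex inj_on_def case_prod_unfold)
qed

text \<open>The minor without row \<open>r\<close> does not involve \<open>k r\<close>, so
  \<open>shift r\<close> fixes it. Then \<open>step_op p r\<close> acts as 1 and
  \<open>step_op r q\<close> as \<open>shift q\<close>, which is the origin of the
  \<open>+ 1\<close> in the later entries.\<close>

lemma mt_poly_Suc:
  "mt_poly (Suc n) k = (\<Sum>r\<le>n. (-1) ^ r * mt_potential n (\<lambda>i. if i < r then k i else k (Suc i) + 1))"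
proof -
  let ?del = "\<lambda>r k. vand_up n (k \<circ> skip r)"
  have vand: "vand (Suc n) = (\<Sum>r\<le>n. scale ((-1) ^ r) (?del r))"
    by (rule ext) (simp add: laplace_vand sum_fun_apply comp_def skip_def if_distrib[of "\<lambda>i. _ i"] cong: if_cong)
  have main: "act (step_prod (Suc n)) (?del r) k = mt_potential n (\<lambda>i. if i < r then k i else k (Suc i) + 1)" if r: "r \<le> n" for r
  proof -
    let ?G = "?del r"
    have Xr: "act (shift r) ?G = ?G"
    proof
      fix k :: "nat \<Rightarrow> int"
      have "k(r := k r + 1) \<circ> skip r = k \<circ> skip r" by (auto simp: fun_eq_iff skip_def)
      then show "act (shift r) ?G k = ?G k" by (simp add: act_shift)
    qed
    have XrR: "act (shift r) (act R ?G) = act R ?G" for R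
      by (subst act_commute) (simp add: Xr)
    have C: "act (\<Prod>q\<in>Q. step_op r q) ?G = act (\<Prod>q\<in>Q. shift q) ?G" if "finite Q" for Q
      using that
    proof (induction Q rule: finite_induct)
      case (insert q Q)
      let ?H = "act (\<Prod>q\<in>Q. shift q) ?G"
      have "act (\<Prod>q\<in>insert q Q. step_op r q) ?G = act (step_op r q) (act (\<Prod>q\<in>Q. step_op r q) ?G)"
        using insert.hyps by (simp only: prod.insert act_mult not_False_eq_True)
      also have "\<dots> = act (step_op r q) ?H" unfolding insert.IH ..
      also have "\<dots> = act (shift r) (act (shift q) ?H)"
        unfolding act_step_op by (simp add: XrR)
      also have "\<dots> = act (\<Prod>q\<in>insert q Q. shift q) ?G"
        using insert XrR[of "shift q * (\<Prod>q\<in>Q. shift q)"] by (simp add: act_mult)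
      finally show ?case .
    qed simp
    have B: "act (\<Prod>p<r. step_op p r) (act R ?G) = act R ?G" for R
      by (rule act_prod_fixed) (simp_all add: act_step_op XrR)
    have "act (step_prod (Suc n)) ?G
       = act (\<Prod>(p, q)\<in>pairs n. step_op (skip r p) (skip r q)) (act (\<Prod>q\<in>{r<..n}. shift q) ?G)"
      by (simp only: step_prod_Suc_split[OF r] act_mult C finite_greaterThanAtMost B)
    also have "\<dots> = act (\<Prod>q\<in>{r<..n}. shift q) (\<lambda>k. mt_potential n (k \<circ> skip r))"
      unfolding mt_potential_def step_prod_def act_prod_step_op_comp[OF inj_skip finite_pairs] by (rule act_commute)
    finally have "act (step_prod (Suc n)) ?G k = mt_potential n ((\<lambda>i. if i \<in> {r<..n} then k i + 1 else k i) \<circ> skip r)"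
      by (simp only: act_prod_shift[OF finite_greaterThanAtMost])
    also have "\<dots> = mt_potential n (\<lambda>i. if i < r then k i else k (Suc i) + 1)"
      by (rule depends_belowD[OF depends_below_mt_potential]) (auto simp: skip_def)
    finally show ?thesis .
  qed
  show ?thesis
    unfolding mt_poly_def vand act_sum act_scale by (simp add: sum_fun_apply main)
qed

text \<open>The last entry \<open>l m\<close> is either greater than \<open>k m\<close>, and then the other entries are unaffected by it,
  or equal to \<open>k m\<close>, and then strictness lowers the upper bound of the next entry to \<open>k m - 1\<close>.\<close>

fun interlace_sum :: "nat \<Rightarrow> (nat \<Rightarrow> int) \<Rightarrow> lattice_fun \<Rightarrow> real" where
  "interlace_sum 0 k F = F (\<lambda>_. 0)"
| "interlace_sum (Suc m) k F = interlace_sum m k (\<lambda>l. \<Sum>s\<in>{k m<..k (Suc m)}. F (l(m := s)))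
     + interlace_sum m (k(m := k m - 1)) (\<lambda>l. F (l(m := k m)))"

lemma sum_diff_telescope_int:
  "a \<le> b \<Longrightarrow> (\<Sum>s\<in>{a<..b}. f (s + 1) - f s) = f (b + 1) - (f (a + 1) :: real)" for a b :: int
proof (induction b rule: int_ge_induct)
  case (step b)
  have "{a<..b + 1} = insert (b + 1) {a<..b}" using step by auto
  then show ?case using step by simp
qed simp

text \<open>Only the last comparison may be an equality: the second branch of
  \<open>interlace_sum\<close> lowers the last bound by one, and it may then meet its
  predecessor.\<close>

definition upto_row :: "nat \<Rightarrow> (nat \<Rightarrow> int) \<Rightarrow> bool" where
  "upto_row m k \<longleftrightarrow> (\<forall>i. Suc i < m \<longrightarrow> k i < k (Suc i)) \<and> (\<forall>i. Suc i = m \<longrightarrow> k i \<le> k m)"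

lemma upto_row_Suc:
  assumes "upto_row (Suc m) k"
  shows "upto_row m k" "upto_row m (k(m := k m - 1))" "k m \<le> k (Suc m)"
  using assms by (auto simp: upto_row_def)

lemma act_prod_fix_coord:
  assumes "m \<notin> A" "finite A"
  shows "(\<lambda>l. act (\<Prod>q\<in>A. shift q - 1) F (l(m := s))) = act (\<Prod>q\<in>A. shift q - 1) (\<lambda>l. F (l(m := s)))"
proof (rule act_prod_intertwine[OF assms(2), of "\<lambda>F l. F (l(m := s))"])
  fix q F assume "q \<in> A"
  then have "q \<noteq> m" using assms by auto
  then show "(\<lambda>l. act (shift q - 1) F (l(m := s))) = act (shift q - 1) (\<lambda>l. F (l(m := s)))"
    by (simp add: act_diff_op act_shift fun_eq_iff fun_upd_twist)
qed

text \<open>Summing out one variable at a time telescopes the differences. At each stage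
  \<open>bethe\<close> cancels the mixed boundary terms, and the \<open>m + 1\<close> survivors have
  the pattern of the Laplace expansion.\<close>

lemma interlace_sum_telescope:
  assumes "bethe m N" "upto_row m k"
  shows "interlace_sum m k (act (\<Prod>q<m. shift q - 1) N)
       = (\<Sum>r\<le>m. (-1) ^ r * N (\<lambda>i. if i < m then if i < r then k i else k (Suc i) + 1 else 0))"
  using assms
proof (induction m arbitrary: k N)
  case (Suc m)
  let ?D = "\<Prod>q<m. shift q - 1"
  let ?k' = "k(m := k m - 1)"
  \<comment> \<open>\<open>N1\<close> is the telescoped sum over a last entry greater than
    \<open>k m\<close>; \<open>N2\<close> is the single difference at a last entry equal to
    \<open>k m\<close>.\<close>
  define N1 where "N1 = (\<lambda>l. N (l(m := k (Suc m) + 1)) - N (l(m := k m + 1)))"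
  define N2 where "N2 = (\<lambda>l. N (l(m := k m + 1)) - N (l(m := k m)))"
  note k = upto_row_Suc[OF Suc.prems(2)]
  have fixm: "(\<lambda>l. act (\<Prod>q<Suc m. shift q - 1) N (l(m := s))) = act ?D (\<lambda>l. N (l(m := s + 1)) - N (l(m := s)))" for s
  proof -
    have "act (\<Prod>q<Suc m. shift q - 1) N = act ?D (act (shift m - 1) N)" by (simp add: act_mult)
    then show ?thesis
      using act_prod_fix_coord[of m "{..<m}" "act (shift m - 1) N" s]
      by (simp add: act_diff_op act_shift)
  qed
  have sum1: "(\<lambda>l. \<Sum>s\<in>{k m<..k (Suc m)}. act (\<Prod>q<Suc m. shift q - 1) N (l(m := s))) = act ?D N1"
  proof -
    have "(\<lambda>l. \<Sum>s\<in>{k m<..k (Suc m)}. act (\<Prod>q<Suc m. shift q - 1) N (l(m := s)))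
       = (\<Sum>s\<in>{k m<..k (Suc m)}. (\<lambda>l. act (\<Prod>q<Suc m. shift q - 1) N (l(m := s))))"
      by (rule ext) (simp add: sum_fun_apply)
    also have "\<dots> = act ?D (\<Sum>s\<in>{k m<..k (Suc m)}. (\<lambda>l. N (l(m := s + 1)) - N (l(m := s))))"
      unfolding fixm act_sum ..
    also have "(\<Sum>s\<in>{k m<..k (Suc m)}. (\<lambda>l. N (l(m := s + 1)) - N (l(m := s)))) = N1"
      by (rule ext) (simp add: sum_fun_apply N1_def sum_diff_telescope_int[OF k(3), of "\<lambda>s. N (_(m := s))"])
    finally show ?thesis .
  qed
  have bN: "bethe m N1" "bethe m N2"
    unfolding bethe_def
  proof (safe)
    fix i l assume i: "Suc i < m" "l i = (l (Suc i) :: int)"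
    have b: "N (l(m := s)) - N (l(Suc i := l i + 1, m := s)) + N (l(i := l i + 1, Suc i := l i + 1, m := s)) = 0" for s
      using Suc.prems(1)[unfolded bethe_def, rule_format, of i "l(m := s)"] i
      by (simp add: fun_upd_twist)
    show "N1 l - N1 (l(Suc i := l i + 1)) + N1 (l(i := l i + 1, Suc i := l i + 1)) = 0"
      "N2 l - N2 (l(Suc i := l i + 1)) + N2 (l(i := l i + 1, Suc i := l i + 1)) = 0"
      using b[of "k m"] b[of "k m + 1"] b[of "k (Suc m) + 1"] by (simp_all add: N1_def N2_def)
  qed
  define v where "v r = (\<lambda>i. if i < m then if i < r then k i else k (Suc i) + 1 else 0)" for r
  define v' where "v' r = (\<lambda>i. if i < m then if i < r then ?k' i else ?k' (Suc i) + 1 else 0)" for r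
  define u where "u r = (\<lambda>i. if i < Suc m then if i < r then k i else k (Suc i) + 1 else 0)" for r
  have "interlace_sum (Suc m) k (act (\<Prod>q<Suc m. shift q - 1) N) = interlace_sum m k (act ?D N1) + interlace_sum m ?k' (act ?D N2)"
    unfolding interlace_sum.simps sum1 fixm N2_def ..
  also have "\<dots> = (\<Sum>r\<le>m. (-1) ^ r * (N1 (v r) + N2 (v' r)))"
    unfolding Suc.IH[OF bN(1) k(1)] Suc.IH[OF bN(2) k(2)] v_def v'_def
    by (simp add: algebra_simps sum.distrib)
  also have "\<dots> = (\<Sum>r\<le>m. (-1) ^ r * (N (u r) - (if r = m then N (u (Suc m)) else 0)))"
  proof (rule sum.cong[OF refl], rule arg_cong2[of _ _ _ _ "(*)", OF refl])
    fix r assume "r \<in> {..m}"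
    then have "r \<le> m" by simp
    have u: "(v r)(m := k (Suc m) + 1) = u r"
      using \<open>r \<le> m\<close> by (auto simp: v_def u_def fun_eq_iff)
    show "N1 (v r) + N2 (v' r) = N (u r) - (if r = m then N (u (Suc m)) else 0)"
    proof (cases "r = m")
      case True
      have "v' r = v r" using True by (auto simp: v_def v'_def fun_eq_iff)
      moreover have "(v r)(m := k m) = u (Suc m)" using True by (auto simp: v_def u_def fun_eq_iff)
      ultimately show ?thesis using True u by (simp add: N1_def N2_def)
    next
      case False
      then obtain m' where m: "m = Suc m'" "r \<le> m'" using \<open>r \<le> m\<close> by (cases m) auto
      \<comment> \<open>\<open>?w\<close> has \<open>k m\<close> at the positions \<open>m'\<close>
        and \<open>m\<close>, so \<open>bethe\<close> applies there. Its three terms are the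
        boundary terms that \<open>N1 (v r)\<close> and \<open>N2 (v' r)\<close> leave besides
        \<open>N (u r)\<close>.\<close>
      let ?w = "(v' r)(m := k m)"
      have w: "?w m' = k m" "?w m = k m" using m by (auto simp: v'_def)
      have "(v r)(m := k m + 1) = ?w(m' := k m + 1, m := k m + 1)"
        using m by (auto simp: v_def v'_def fun_eq_iff)
      moreover have "N ?w - N (?w(m := k m + 1)) + N (?w(m' := k m + 1, m := k m + 1)) = 0"
        using Suc.prems(1)[unfolded bethe_def, rule_format, of m' ?w] w m by simp
      ultimately show ?thesis using False u by (simp add: N1_def N2_def)
    qed
  qed
  also have "\<dots> = (\<Sum>r\<le>m. (-1) ^ r * N (u r)) - (-1) ^ m * N (u (Suc m))"
    by (simp add: right_diff_distrib sum_subtractf if_distrib[of "\<lambda>x. _ * x"] cong: if_cong)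
  also have "\<dots> = (\<Sum>r\<le>Suc m. (-1) ^ r * N (u r))" by simp
  finally show ?case unfolding u_def .
qed (simp add: upto_row_def)

text \<open>All differences together turn \<open>mt_potential\<close> back into
  \<open>mt_poly\<close>, and the telescoped sum has the same alternating terms as
  \<open>mt_poly_Suc\<close>.\<close>

lemma mt_poly_eq_interlace_sum:
  assumes "upto_row n k"
  shows "mt_poly (Suc n) k = interlace_sum n k (mt_poly n)"
proof -
  have "act (\<Prod>q<n. shift q - 1) (mt_potential n) = mt_poly n"
    unfolding mt_potential_def mt_poly_def by (subst act_commute) (simp add: prod_diff_vand_up)
  then have "interlace_sum n k (mt_poly n) = (\<Sum>r\<le>n. (-1) ^ r * mt_potential n (\<lambda>i. if i < n then if i < r then k i else k (Suc i) + 1 else 0))"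
    using interlace_sum_telescope[OF bethe_mt_potential assms] by simp
  also have "\<dots> = mt_poly (Suc n) k"
    unfolding mt_poly_Suc
    by (intro sum.cong refl arg_cong2[of _ _ _ _ "(*)"] depends_belowD[OF depends_below_mt_potential]) auto
  finally show ?thesis ..
qed

text \<open>The zero tail makes each sequence of length \<open>m\<close> appear exactly
  once.\<close>

definition interlacing :: "nat \<Rightarrow> (nat \<Rightarrow> int) \<Rightarrow> (nat \<Rightarrow> int) set" where
  "interlacing m k = {l. (\<forall>i<m. k i \<le> l i \<and> l i \<le> k (Suc i)) \<and> (\<forall>i. Suc i < m \<longrightarrow> l i < l (Suc i)) \<and> (\<forall>i\<ge>m. l i = 0)}"

lemma interlacing_Suc:
  assumes "upto_row (Suc m) k"
  shows "interlacing (Suc m) k = (\<lambda>(l, s). l(m := s)) ` (interlacing m k \<times> {k m<..k (Suc m)})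
     \<union> (\<lambda>l. l(m := k m)) ` interlacing m (k(m := k m - 1))"
    (is "?L = ?A \<union> ?B")
proof (intro equalityI subsetI)
  fix l assume l: "l \<in> ?L"
  let ?l = "l(m := 0)"
  have eq: "l = ?l(m := l m)" by auto
  show "l \<in> ?A \<union> ?B"
  proof (cases "l m = k m")
    case True
    have "?l \<in> interlacing m (k(m := k m - 1))"
      using l True unfolding interlacing_def
      by clarsimp (metis Suc_leI le_less_trans less_Suc_eq less_or_eq_imp_le not_less_eq zle_diff1_eq Suc_lessI lessI less_antisym)
    then have "l \<in> ?B" using eq True by (metis imageI)
    then show ?thesis by blast
  next
    case False
    have "?l \<in> interlacing m k" "l m \<in> {k m<..k (Suc m)}"
      using l False unfolding interlacing_def by (auto simp: order.strict_iff_order)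
    then have "l \<in> ?A" using eq by (metis (mono_tags, lifting) SigmaI image_eqI case_prod_conv)
    then show ?thesis by blast
  qed
next
  fix l assume "l \<in> ?A \<union> ?B"
  then show "l \<in> ?L"
  proof
    assume "l \<in> ?A"
    then obtain l' s where l: "l = l'(m := s)" "l' \<in> interlacing m k" "k m < s" "s \<le> k (Suc m)" by auto
    have "l' i < s" if "Suc i = m" for i
      using l that unfolding interlacing_def by force
    then show ?thesis using l unfolding interlacing_def by (auto simp: less_Suc_eq)
  next
    assume "l \<in> ?B"
    then obtain l' where l: "l = l'(m := k m)" "l' \<in> interlacing m (k(m := k m - 1))" by auto
    have a: "l' i < k m" if "Suc i = m" for i
      using l that unfolding interlacing_def by force
    have b: "k i \<le> l' i \<and> l' i \<le> k (Suc i)" if "i < m" for i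
      using l(2) that a[of i] unfolding interlacing_def by (auto dest!: spec[of _ i] split: if_splits)
    show ?thesis using l a b upto_row_Suc(3)[OF assms] unfolding interlacing_def by (auto simp: less_Suc_eq)
  qed
qed

lemma interlace_sum_eq_sum:
  assumes "upto_row m k"
  shows "finite (interlacing m k) \<and> interlace_sum m k F = (\<Sum>l\<in>interlacing m k. F l)"
  using assms
proof (induction m arbitrary: k F)
  case 0
  have "interlacing 0 k = {\<lambda>_. 0}" by (auto simp: interlacing_def)
  then show ?case by simp
next
  case (Suc m)
  let ?k' = "k(m := k m - 1)"
  note k = upto_row_Suc[OF Suc.prems]
  let ?A = "(\<lambda>(l, s). l(m := s)) ` (interlacing m k \<times> {k m<..k (Suc m)})"
  let ?B = "(\<lambda>l. l(m := k m)) ` interlacing m ?k'"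
  have zero: "l m = 0" if "l \<in> interlacing m k" for l k
    using that by (simp add: interlacing_def)
  have injA: "inj_on (\<lambda>(l, s). l(m := s)) (interlacing m k \<times> {k m<..k (Suc m)})"
    by (rule inj_on_inverseI[where g = "\<lambda>l. (l(m := 0), l m)"]) (auto simp: zero fun_upd_idem)
  have injB: "inj_on (\<lambda>l. l(m := k m)) (interlacing m ?k')"
    by (rule inj_on_inverseI[where g = "\<lambda>l. l(m := 0)"]) (auto simp: zero fun_upd_idem)
  have fin: "finite (interlacing m k)" "finite (interlacing m ?k')"
    using Suc.IH k by blast+
  have disj: "?A \<inter> ?B = {}" by (auto dest: fun_cong[of _ _ m])
  have "interlace_sum (Suc m) k F = (\<Sum>l\<in>?A. F l) + (\<Sum>l\<in>?B. F l)"
    unfolding interlace_sum.simps conjunct2[OF Suc.IH[OF k(1)]] conjunct2[OF Suc.IH[OF k(2)]]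
    by (simp add: sum.reindex[OF injA[unfolded case_prod_unfold]] sum.reindex[OF injB] sum.cartesian_product case_prod_unfold)
  also have "\<dots> = (\<Sum>l\<in>?A \<union> ?B. F l)"
    using fin disj by (intro sum.union_disjoint[symmetric]) auto
  finally show ?case unfolding interlacing_Suc[OF Suc.prems] using fin by simp
qed

lemma mt_poly_recursion:
  assumes "\<And>i. i < n \<Longrightarrow> k i < k (Suc i)"
  shows "finite (interlacing n k)" "mt_poly (Suc n) k = (\<Sum>l\<in>interlacing n k. mt_poly n l)"
proof -
  have "upto_row n k" using assms unfolding upto_row_def by (auto intro: less_imp_le)
  then show "finite (interlacing n k)" "mt_poly (Suc n) k = (\<Sum>l\<in>interlacing n k. mt_poly n l)"
    using interlace_sum_eq_sum mt_poly_eq_interlace_sum by auto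
qed

section \<open>Symmetries of the operator formula\<close>

lemma prod_pairs_Suc:
  "(\<Prod>(p, q)\<in>pairs (Suc n). g p q) = (\<Prod>(p, q)\<in>pairs n. g p q) * (\<Prod>p<n. g p n)"
  for g :: "nat \<Rightarrow> nat \<Rightarrow> 'a :: comm_monoid_mult"
proof -
  have "pairs (Suc n) = pairs n \<union> (\<lambda>p. (p, n)) ` {..<n}" by (auto simp: pairs_def)
  moreover have "pairs n \<inter> (\<lambda>p. (p, n)) ` {..<n} = {}" by (auto simp: pairs_def)
  ultimately show ?thesis
    by (simp add: prod.union_disjoint prod.reindex inj_on_def)
qed

text \<open>The cycle is a product of \<open>m\<close> adjacent transpositions.\<close>

lemma vand_rotate:
  assumes "m \<le> n"
  shows "vand (Suc n) (k \<circ> (\<lambda>i. if i < m then Suc i else if i = m then 0 else i)) = (-1) ^ m * vand (Suc n) k"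
  using assms
proof (induction m)
  case 0
  have "(\<lambda>i. if i < 0 then Suc i else if i = 0 then 0 else i) = id" by auto
  then show ?case by simp
next
  case (Suc m)
  have "(\<lambda>i. if i < Suc m then Suc i else if i = Suc m then 0 else i)
      = (\<lambda>i. if i < m then Suc i else if i = m then 0 else i) \<circ> transpose m (Suc m)"
    by (auto simp: fun_eq_iff transpose_def)
  then have "vand (Suc n) (k \<circ> (\<lambda>i. if i < Suc m then Suc i else if i = Suc m then 0 else i))
     = vand (Suc n) ((k \<circ> (\<lambda>i. if i < m then Suc i else if i = m then 0 else i)) \<circ> transpose m (Suc m))"
    by (simp add: comp_assoc)
  also have "\<dots> = - vand (Suc n) (k \<circ> (\<lambda>i. if i < m then Suc i else if i = m then 0 else i))"
    using Suc.prems unfolding vand_def by (intro rowdet_swap) auto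
  also have "\<dots> = - ((-1) ^ m * vand (Suc n) k)"
    using Suc.prems by (simp only: Suc.IH Suc_leD)
  also have "\<dots> = (-1) ^ Suc m * vand (Suc n) k" by simp
  finally show ?case .
qed

text \<open>With \<open>D = shift p - 1\<close> the operator is \<open>1 + D + D ^ 2\<close>, a
  factor of \<open>1 - D ^ 3\<close>; hence it is injective where \<open>D\<close> is
  nilpotent.\<close>

lemma step_op_diag_inj:
  assumes "act ((shift p - 1) ^ n) H = 0" "act (step_op p p) H = 0"
  shows "H = 0"
proof -
  let ?D = "shift p - 1"
  have "(2 - shift p) * step_op p p = 1 - ?D ^ 3"
    by (simp add: step_op_def power3_eq_cube algebra_simps)
  then have "act (1 - ?D ^ 3) H = 0"
    by (metis act_mult act_zero assms(2))
  then have D3: "act (?D ^ 3) H = H"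
    by (simp add: act_diff_op)
  have "act ((?D ^ 3) ^ j) H = H" for j
    by (induction j) (simp_all add: act_mult D3)
  then have "H = act ((?D ^ 3) ^ n) H" by simp
  also have "(?D ^ 3) ^ n = (?D ^ n) ^ 2 * ?D ^ n"
    by (simp flip: power_mult power_add add: mult.commute)
  also have "act \<dots> H = 0" unfolding act_mult assms(1) by simp
  finally show ?thesis .
qed

lemma act_shift_power: "act (shift p ^ m) F k = F (k(p := k p + int m))"
  by (induction m arbitrary: k) (simp_all add: act_mult act_shift power_Suc2 algebra_simps del: power_Suc)

lemma diff_power_kills_mt_poly: "q < n \<Longrightarrow> act ((shift q - 1) ^ n) (mt_poly n) = 0"
  unfolding mt_poly_def by (subst act_commute) (simp add: diff_power_kills_vand)

text \<open>Write the operator product as \<open>R\<close> times the factors that involve the rotated variable. Multiplied by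
  \<open>step_op 0 0\<close> these become full products over all variables, which are symmetric in the others, so
  \<open>act_affine_vand\<close> evaluates them; finally \<open>step_op 0 0\<close> is cancelled.\<close>

lemma mt_poly_rotate:
  "mt_poly (Suc n) (\<lambda>i. if i < n then k (Suc i) else k 0) = (-1) ^ n * mt_poly (Suc n) (k(0 := k 0 + int (Suc n)))"
proof -
  define c where "c i = (if i < n then Suc i else if i = n then 0 else i)" for i
  have inj: "inj c" by (auto simp: inj_def c_def split: if_splits)
  define R where "R = (\<Prod>(p, q)\<in>pairs n. step_op (Suc p) (Suc q))"
  have Wc: "(\<Prod>(p, q)\<in>pairs (Suc n). step_op (c p) (c q)) = R * (\<Prod>q<n. step_op (Suc q) 0)"
  proof -
    have "(\<Prod>(p, q)\<in>pairs n. step_op (c p) (c q)) = R"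
      unfolding R_def by (rule prod.cong) (auto simp: c_def pairs_def)
    moreover have "(\<Prod>q<n. step_op (c q) (c n)) = (\<Prod>q<n. step_op (Suc q) 0)"
      by (rule prod.cong) (auto simp: c_def)
    ultimately show ?thesis by (simp add: prod_pairs_Suc)
  qed
  have WW0: "step_prod (Suc n) = R * (\<Prod>q<n. step_op 0 (Suc q))"
  proof -
    have "(\<Prod>q\<in>{0<..n}. step_op 0 q) = (\<Prod>q<n. step_op 0 (Suc q))"
      by (rule prod.reindex_bij_witness[of _ Suc "\<lambda>q. q - 1"]) auto
    then show ?thesis
      using step_prod_Suc_split[of 0 n] by (simp add: R_def skip_def)
  qed
  let ?s = "\<lambda>F k. F (k \<circ> c)"
  let ?vand = "vand (Suc n)"
  have sV: "?s ?vand = scale ((-1) ^ n) ?vand"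
    using vand_rotate[of n n] by (simp add: fun_eq_iff c_def[abs_def])
  have 1: "act (step_op 0 0) (act (\<Prod>q<n. step_op 0 (Suc q)) ?vand) = ?vand"
  proof -
    have "step_op 0 0 * (\<Prod>q<n. step_op 0 (Suc q)) = (\<Prod>q<Suc n. step_op 0 q)"
      by (simp only: prod.lessThan_Suc_shift)
    also have "\<dots> = (\<Prod>q<Suc n. 1 + shift 0 * (shift q - 1))"
      by (simp only: step_op_def) (simp add: algebra_simps)
    finally have "act (step_op 0 0 * (\<Prod>q<n. step_op 0 (Suc q))) ?vand = act (1 ^ Suc n) ?vand"
      by (simp only: act_affine_vand)
    then show ?thesis by (simp add: act_mult)
  qed
  \<comment> \<open>Written in terms of \<open>shift q - 1\<close>, the factor has constant part
    \<open>shift 0\<close>. Its power \<open>Suc n\<close> is all that survives, and it is the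
    translation of \<open>k 0\<close> in the claim.\<close>
  have 2: "act (step_op 0 0) (act (\<Prod>q<n. step_op (Suc q) 0) ?vand) = act (shift 0 ^ Suc n) ?vand"
  proof -
    have "step_op 0 0 * (\<Prod>q<n. step_op (Suc q) 0) = (\<Prod>q<Suc n. step_op q 0)"
      by (simp only: prod.lessThan_Suc_shift)
    also have "\<dots> = (\<Prod>q<Suc n. shift 0 + (shift 0 - 1) * (shift q - 1))"
      by (simp only: step_op_def) (simp add: algebra_simps)
    finally have "act (step_op 0 0 * (\<Prod>q<n. step_op (Suc q) 0)) ?vand = act (shift 0 ^ Suc n) ?vand"
      by (simp only: act_affine_vand)
    then show ?thesis by (simp add: act_mult)
  qed
  have sM: "?s (mt_poly (Suc n)) = scale ((-1) ^ n) (act R (act (\<Prod>q<n. step_op (Suc q) 0) ?vand))"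
    unfolding mt_poly_def step_prod_def act_prod_step_op_comp[OF inj finite_pairs] Wc sV act_scale act_mult ..
  define H where "H = act R (act (\<Prod>q<n. step_op (Suc q) 0) ?vand) - act (shift 0 ^ Suc n) (mt_poly (Suc n))"
  have "act (step_op 0 0) H = act R (act (shift 0 ^ Suc n) ?vand) - act R (act (shift 0 ^ Suc n) ?vand)"
    unfolding H_def act_diff mt_poly_def WW0 act_mult
    by (simp only: act_commute[of "step_op 0 0" R] act_commute[of "step_op 0 0" "shift 0 ^ Suc n"] 1 2
        act_commute[of "shift 0 ^ Suc n" R])
  then have "act (step_op 0 0) H = 0" by simp
  moreover have "act ((shift 0 - 1) ^ Suc n) H = 0"
  proof -
    have V0: "act ((shift 0 - 1) ^ Suc n) ?vand = 0" by (rule diff_power_kills_vand) simp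
    have comm: "act ((shift 0 - 1) ^ Suc n) (act S F) = act S (act ((shift 0 - 1) ^ Suc n) F)" for S F
      by (rule act_commute)
    show ?thesis unfolding H_def act_diff mt_poly_def comm V0 by simp
  qed
  ultimately have "H = 0" by (rule step_op_diag_inj[rotated])
  then have "act R (act (\<Prod>q<n. step_op (Suc q) 0) ?vand) = act (shift 0 ^ Suc n) (mt_poly (Suc n))"
    by (simp only: H_def right_minus_eq)
  from fun_cong[OF sM[unfolded this], of k]
  have "?s (mt_poly (Suc n)) k = (-1) ^ n * act (shift 0 ^ Suc n) (mt_poly (Suc n)) k"
    by (simp only: scale_apply)
  moreover have "mt_poly (Suc n) (\<lambda>i. if i < n then k (Suc i) else k 0) = ?s (mt_poly (Suc n)) k"
    by (rule depends_belowD[OF depends_below_mt_poly]) (auto simp: c_def less_Suc_eq)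
  ultimately show ?thesis by (simp only: act_shift_power)
qed

lemma mt_poly_translate: "mt_poly n (\<lambda>i. k i + c) = mt_poly n k"
proof -
  have comm: "(\<lambda>k. act R F (k + (\<lambda>_. c))) = act R (\<lambda>k. F (k + (\<lambda>_. c)))" for R F
    by (rule ext) (simp add: act_def ac_simps)
  have "(\<lambda>k. vand n (k + (\<lambda>_. c))) = vand n"
    using vand_translate by (simp add: plus_fun_def fun_eq_iff)
  then have "(\<lambda>k. mt_poly n (k + (\<lambda>_. c))) = mt_poly n"
    unfolding mt_poly_def comm by simp
  then show ?thesis by (simp add: fun_eq_iff plus_fun_def)
qed

text \<open>Each index below \<open>n\<close> occurs in exactly \<open>n - 1\<close> pairs.\<close>

lemma prod_shift_pairs: "(\<Prod>(p, q)\<in>pairs n. shift p * shift q) = (\<Prod>p<n. shift p) ^ (n - 1)"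
proof (induction n)
  case (Suc n)
  show ?case
    unfolding prod_pairs_Suc Suc prod.distrib
    by (cases n) (simp_all add: power_mult_distrib mult_ac)
qed (simp add: pairs_def)

text \<open>Reversal with negation turns \<open>shift p\<close> into the inverse of
  \<open>shift (r p)\<close>. Multiplying each factor by its two shifts clears the inverses and
  gives the factor of the reflected pair. The shifts used for this form a power of the total shift,
  which acts trivially by \<open>mt_poly_translate\<close>.\<close>

lemma mt_poly_reflect: "mt_poly n (\<lambda>i. - k (n - 1 - i)) = mt_poly n k"
proof -
  define r where "r i = (if i < n then n - 1 - i else i)" for i
  have rr: "r (r i) = i" for i by (auto simp: r_def)
  let ?s = "\<lambda>F k. F (\<lambda>i. - k (r i))"
  have sX: "act (shift (r p)) (?s (act (shift p) F)) = ?s F" for p F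
  proof
    fix k :: "nat \<Rightarrow> int"
    have "(\<lambda>i. - (k(r p := k (r p) + 1)) (r i))(p := - (k(r p := k (r p) + 1)) (r p) + 1) = (\<lambda>i. - k (r i))"
      using rr by (auto simp: fun_eq_iff) metis
    then show "act (shift (r p)) (?s (act (shift p) F)) k = ?s F k"
      by (simp add: act_shift)
  qed
  have s_lin: "?s (F - G + H) = ?s F - ?s G + ?s H" for F G H :: lattice_fun by (simp add: fun_eq_iff)
  have sW: "act (shift (r p) * shift (r q)) (?s (act (step_op p q) F)) = act (step_op (r q) (r p)) (?s F)" for p q F
    unfolding act_step_op s_lin act_add act_diff
    by (simp only: act_mult sX act_commute[of "shift (r p)" "shift (r q)"] act_step_op) (simp add: fun_eq_iff)
  have step: "act (\<Prod>(p, q)\<in>A. shift (r p) * shift (r q)) (?s (act (\<Prod>(p, q)\<in>A. step_op p q) F))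
       = act (\<Prod>(p, q)\<in>A. step_op (r q) (r p)) (?s F)" if "finite A" for A F
    using that
  proof (induction A arbitrary: F rule: finite_induct)
    case (insert x A)
    obtain p q where x: "x = (p, q)" by force
    let ?B = "\<Prod>(p, q)\<in>A. shift (r p) * shift (r q)" and ?C = "\<Prod>(p, q)\<in>A. step_op p q"
    have "act (\<Prod>(p, q)\<in>insert x A. shift (r p) * shift (r q)) (?s (act (\<Prod>(p, q)\<in>insert x A. step_op p q) F))
        = act ?B (act (shift (r p) * shift (r q)) (?s (act (step_op p q) (act ?C F))))"
      using insert.hyps x
      by (simp only: prod.insert not_False_eq_True case_prod_conv act_mult act_commute[of ?B])
    also have "\<dots> = act (step_op (r q) (r p)) (act (\<Prod>(p, q)\<in>A. step_op (r q) (r p)) (?s F))"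
      unfolding sW act_commute[of ?B] insert.IH ..
    also have "\<dots> = act (\<Prod>(p, q)\<in>insert x A. step_op (r q) (r p)) (?s F)"
      using insert.hyps x by (simp add: act_mult)
    finally show ?case .
  qed simp
  have bij: "bij_betw (\<lambda>(p, q). (r q, r p)) (pairs n) (pairs n)"
    by (rule bij_betw_byWitness[where f' = "\<lambda>(p, q). (r q, r p)"]) (auto simp: rr, auto simp: pairs_def r_def)
  have "(\<Prod>(p, q)\<in>pairs n. step_op (r q) (r p)) = step_prod n"
    unfolding step_prod_def using prod.reindex_bij_betw[OF bij, of "\<lambda>(p, q). step_op p q"] by (simp add: case_prod_unfold)
  moreover have "(\<Prod>(p, q)\<in>pairs n. shift (r p) * shift (r q)) = (\<Prod>p<n. shift p) ^ (n - 1)"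
    unfolding prod_shift_pairs[symmetric]
    using prod.reindex_bij_betw[OF bij, of "\<lambda>(p, q). shift p * shift q"] by (simp add: case_prod_unfold mult.commute)
  moreover have "?s (vand n) = vand n"
  proof
    fix k
    have "vand n (\<lambda>i. - k (r i)) = vand n (\<lambda>i. - k (n - 1 - i))"
      by (rule vand_cong) (simp add: r_def)
    then show "?s (vand n) k = vand n k" using vand_reflect[of n k] by simp
  qed
  ultimately have "act ((\<Prod>p<n. shift p) ^ (n - 1)) (?s (mt_poly n)) = mt_poly n"
    using step[of "pairs n" "vand n"] by (simp add: mt_poly_def step_prod_def)
  moreover have "act (\<Prod>p<n. shift p) (?s (mt_poly n)) = ?s (mt_poly n)"
  proof
    fix k
    have "act (\<Prod>p<n. shift p) (?s (mt_poly n)) k = mt_poly n (\<lambda>i. - k (r i) + (-1))"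
      unfolding act_prod_shift[OF finite_lessThan]
      by (rule depends_belowD[OF depends_below_mt_poly]) (auto simp: r_def)
    then show "act (\<Prod>p<n. shift p) (?s (mt_poly n)) k = ?s (mt_poly n) k"
      by (simp only: mt_poly_translate)
  qed
  then have "act ((\<Prod>p<n. shift p) ^ m) (?s (mt_poly n)) = ?s (mt_poly n)" for m
    by (induction m) (simp_all add: act_mult)
  ultimately have "?s (mt_poly n) = mt_poly n" by simp
  moreover have "mt_poly n (\<lambda>i. - k (n - 1 - i)) = ?s (mt_poly n) k"
    by (rule depends_belowD[OF depends_below_mt_poly]) (simp add: r_def)
  ultimately show ?thesis by metis
qed

section \<open>The count as a function of its last entry\<close>

definition last_count :: "nat \<Rightarrow> int \<Rightarrow> real" where
  "last_count N t = mt_poly (Suc N) (\<lambda>i. if i < N then int i + 1 else t)"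

text \<open>Rotation brings \<open>t\<close> to the front as \<open>t + N + 1\<close>. Reflection
  followed by translation by \<open>N + 1\<close> then restores \<open>1, ..., N\<close> and puts
  \<open>- t\<close> at the end.\<close>

lemma last_count_parity: "last_count N (- t) = (-1) ^ N * last_count N t"
proof -
  define k where "k i = (if i = 0 then t else int i)" for i
  have "last_count N t = mt_poly (Suc N) (\<lambda>i. if i < N then k (Suc i) else k 0)"
    unfolding last_count_def by (rule depends_belowD[OF depends_below_mt_poly]) (auto simp: k_def)
  also have "\<dots> = (-1) ^ N * mt_poly (Suc N) (k(0 := t + int (Suc N)))"
    using mt_poly_rotate[of N k] by (simp add: k_def)
  also have "mt_poly (Suc N) (k(0 := t + int (Suc N))) = mt_poly (Suc N) (\<lambda>i. - (k(0 := t + int (Suc N))) (Suc N - 1 - i) + int (Suc N))"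
    using mt_poly_translate[of "Suc N" "\<lambda>i. - (k(0 := t + int (Suc N))) (Suc N - 1 - i)" "int (Suc N)"]
      mt_poly_reflect[of "Suc N" "k(0 := t + int (Suc N))"] by (simp only:)
  also have "\<dots> = last_count N (- t)"
    unfolding last_count_def by (rule depends_belowD[OF depends_below_mt_poly]) (auto simp: k_def)
  finally show ?thesis by simp
qed

definition fdiff :: "(int \<Rightarrow> real) \<Rightarrow> int \<Rightarrow> real" where "fdiff g t = g (t + 1) - g t"

lemma act_diff_power_fdiff:
  "act ((shift q - 1) ^ m) F (k(q := t)) = (fdiff ^^ m) (\<lambda>s. F (k(q := s))) t"
proof (induction m arbitrary: t)
  case (Suc m)
  have "act ((shift q - 1) ^ Suc m) F (k(q := t)) = act (shift q - 1) (act ((shift q - 1) ^ m) F) (k(q := t))"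
    by (simp add: act_mult)
  also have "\<dots> = act ((shift q - 1) ^ m) F (k(q := t + 1)) - act ((shift q - 1) ^ m) F (k(q := t))"
    by (simp add: act_diff_op act_shift)
  finally show ?case unfolding Suc.IH by (simp only: funpow.simps comp_apply fdiff_def[of "(fdiff ^^ m) _"])
qed simp

lemma fdiff_last_count: "(fdiff ^^ Suc N) (last_count N) t = 0"
proof -
  have "last_count N = (\<lambda>s. mt_poly (Suc N) ((\<lambda>i. int i + 1)(N := s)))"
    unfolding last_count_def by (intro ext depends_belowD[OF depends_below_mt_poly]) auto
  then have "(fdiff ^^ Suc N) (last_count N) t = act ((shift N - 1) ^ Suc N) (mt_poly (Suc N)) ((\<lambda>i. int i + 1)(N := t))"
    by (simp only: act_diff_power_fdiff)
  then show ?thesis by (simp only: diff_power_kills_mt_poly lessI zero_fun_apply)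
qed

text \<open>The discrete form of the fact that a polynomial with infinitely many zeros is 0: by
  induction the difference vanishes, so \<open>g\<close> is constant.\<close>

lemma fdiff_power_unique:
  assumes "\<And>t. (fdiff ^^ m) g t = 0" "\<And>t. t \<ge> t0 \<Longrightarrow> g t = 0"
  shows "g t = 0"
  using assms
proof (induction m arbitrary: g t)
  case (Suc m)
  have "(fdiff ^^ m) (fdiff g) t = 0" for t
    using Suc.prems(1)[of t] by (simp only: funpow_Suc_right comp_apply)
  moreover have "fdiff g t = 0" if "t \<ge> t0" for t
    using that Suc.prems(2) by (simp add: fdiff_def)
  ultimately have "fdiff g t = 0" for t by (rule Suc.IH)
  then have up: "g (t + 1) = g t" for t by (simp add: fdiff_def)
  show ?case
  proof (cases "t \<le> t0")
    case True
    then show ?thesis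
    proof (induction t rule: int_le_induct)
      case (step t)
      then show ?case using up[of "t - 1"] by simp
    qed (use Suc.prems in simp)
  qed (use Suc.prems in simp)
qed simp

section \<open>Rows as sets of columns\<close>

definition count_upto :: "nat set \<Rightarrow> nat \<Rightarrow> nat" where "count_upto S j = card {x \<in> S. x \<le> j}"

text \<open>Interlacing through counting functions: the two counts differ by 0 or 1 everywhere, and
  this bit is what a horizontal edge records. Sizes are left open, so rows of equal size can be
  compared as well.\<close>

definition rowrel :: "nat set \<Rightarrow> nat set \<Rightarrow> bool" where
  "rowrel S T \<longleftrightarrow> (\<forall>j. count_upto T j \<le> count_upto S j \<and> count_upto S j \<le> count_upto T j + 1)"

definition enum_set :: "nat set \<Rightarrow> nat \<Rightarrow> int" where
  "enum_set S i = (if i < card S then int (sorted_list_of_set S ! i) else 0)"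

lemma count_upto_le_card: "finite S \<Longrightarrow> count_upto S j \<le> card S"
  unfolding count_upto_def by (rule card_mono) auto

lemma count_upto_Suc: "count_upto S (Suc j) = count_upto S j + of_bool (Suc j \<in> S)"
proof -
  have "{x \<in> S. x \<le> Suc j} = {x \<in> S. x \<le> j} \<union> (if Suc j \<in> S then {Suc j} else {})"
    by (auto simp: le_Suc_eq)
  then show ?thesis by (simp add: count_upto_def card_insert_if)
qed

lemma enum_set_less:
  assumes "finite S" "Suc i < card S"
  shows "enum_set S i < enum_set S (Suc i)"
proof -
  have "sorted_wrt (<) (sorted_list_of_set S)" by (rule strict_sorted_list_of_set)
  then show ?thesis
    using assms by (simp add: enum_set_def sorted_wrt_nth_less)
qed

lemma nth_le_iff_less_card:
  assumes "sorted xs" "distinct xs" "i < length xs"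
  shows "xs ! i \<le> (j :: nat) \<longleftrightarrow> i < card {x \<in> set xs. x \<le> (j :: nat)}"
proof -
  let ?I = "{i. i < length xs \<and> xs ! i \<le> j}"
  have "{x \<in> set xs. x \<le> j} = (\<lambda>i. xs ! i) ` ?I"
    by (auto simp: set_conv_nth)
  moreover have "inj_on (\<lambda>i. xs ! i) ?I"
    using assms by (auto simp: inj_on_def nth_eq_iff_index_eq)
  ultimately have card: "card {x \<in> set xs. x \<le> j} = card ?I" by (simp add: card_image)
  show ?thesis
  proof (cases "xs ! i \<le> j")
    case True
    have "xs ! i' \<le> j" if "i' \<le> i" for i'
      using sorted_nth_mono[OF assms(1) that assms(3)] True by simp
    then have "{..i} \<subseteq> ?I" using assms(3) by auto
    then have "card {..i} \<le> card ?I" by (intro card_mono) auto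
    then show ?thesis using True card by simp
  next
    case False
    have "i' < i" if "i' < length xs" "xs ! i' \<le> j" for i'
      using sorted_nth_mono[OF assms(1), of i i'] that False by (cases "i' < i") auto
    then have "?I \<subseteq> {..<i}" by auto
    then have "card ?I \<le> card {..<i}" by (intro card_mono) auto
    then show ?thesis using False card by simp
  qed
qed

lemma enum_set_le_iff:
  assumes "finite S" "i < card S"
  shows "enum_set S i \<le> int j \<longleftrightarrow> i < count_upto S j"
  using nth_le_iff_less_card[of "sorted_list_of_set S" i j] assms by (simp add: enum_set_def count_upto_def)

lemma enum_set_image:
  assumes "\<And>i. Suc i < n \<Longrightarrow> l i < l (Suc i)" "\<And>i. i < n \<Longrightarrow> 0 \<le> l i"
  shows "card (nat ` l ` {..<n}) = n" "i < n \<Longrightarrow> enum_set (nat ` l ` {..<n}) i = l i"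
proof -
  have mono: "l i < l j" if "i < j" "j < n" for i j
    using that
  proof (induction j)
    case (Suc j)
    then show ?case using assms(1)[of j] by (cases "i = j") auto
  qed simp
  let ?xs = "map (\<lambda>i. nat (l i)) [0..<n]"
  have sorted: "sorted_wrt (<) ?xs"
    unfolding sorted_wrt_iff_nth_less
  proof (intro allI impI)
    fix i j assume ij: "i < j" "j < length ?xs"
    then have "l i < l j" "0 \<le> l i" using mono[of i j] assms(2)[of i] by auto
    then show "?xs ! i < ?xs ! j" using ij by simp
  qed
  then have "sorted ?xs" "distinct ?xs" by (simp_all add: strict_sorted_iff)
  moreover have set: "nat ` l ` {..<n} = set ?xs" by auto
  ultimately have sl: "sorted_list_of_set (nat ` l ` {..<n}) = ?xs"
    by (simp add: sorted_list_of_set.idem_if_sorted_distinct del: set_map)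
  show c: "card (nat ` l ` {..<n}) = n"
    unfolding set using \<open>distinct ?xs\<close> by (simp only: distinct_card length_map length_upt)
  show "enum_set (nat ` l ` {..<n}) i = l i" if "i < n"
    unfolding enum_set_def c sl using that assms(2) by simp
qed

lemma image_enum_set:
  assumes "finite T" shows "nat ` enum_set T ` {..<card T} = T"
proof -
  have "nat ` enum_set T ` {..<card T} = (\<lambda>i. sorted_list_of_set T ! i) ` {..<length (sorted_list_of_set T)}"
    unfolding image_image by (rule image_cong) (auto simp: enum_set_def)
  also have "\<dots> = set (sorted_list_of_set T)" by (auto simp: in_set_conv_nth)
  finally show ?thesis using assms by simp
qed

text \<open>By \<open>enum_set_le_iff\<close> an inequality between elements is one between counts,
  evaluated at the element itself.\<close>

lemma rowrel_iff_enum_set: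
  assumes "finite S" "finite T" "card S = Suc (card T)"
  shows "rowrel S T \<longleftrightarrow> (\<forall>i<card T. enum_set S i \<le> enum_set T i \<and> enum_set T i \<le> enum_set S (Suc i))"
proof
  assume rel: "rowrel S T"
  show "\<forall>i<card T. enum_set S i \<le> enum_set T i \<and> enum_set T i \<le> enum_set S (Suc i)"
  proof (intro allI impI conjI)
    fix i assume i: "i < card T"
    obtain j where j: "enum_set T i = int j" using i by (auto simp: enum_set_def)
    then have "i < count_upto T j" using enum_set_le_iff[OF assms(2) i, of j] by simp
    then have "i < count_upto S j" using rel unfolding rowrel_def by (meson less_le_trans)
    then show "enum_set S i \<le> enum_set T i" using enum_set_le_iff[OF assms(1), of i j] i assms(3) j by simp
    obtain j' where j': "enum_set S (Suc i) = int j'" using i assms by (auto simp: enum_set_def)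
    then have "Suc i < count_upto S j'" using enum_set_le_iff[OF assms(1), of "Suc i" j'] i assms by simp
    also have "count_upto S j' \<le> count_upto T j' + 1" using rel unfolding rowrel_def by blast
    finally show "enum_set T i \<le> enum_set S (Suc i)" using enum_set_le_iff[OF assms(2) i, of j'] j' by simp
  qed
next
  assume enum_set: "\<forall>i<card T. enum_set S i \<le> enum_set T i \<and> enum_set T i \<le> enum_set S (Suc i)"
  show "rowrel S T"
    unfolding rowrel_def
  proof (intro allI conjI)
    fix j
    show "count_upto T j \<le> count_upto S j"
    proof (cases "count_upto T j")
      case (Suc i)
      then have i: "i < card T" using count_upto_le_card[OF assms(2), of j] by simp
      then have "enum_set T i \<le> int j" using enum_set_le_iff[OF assms(2), of i j] Suc by simp
      then have "enum_set S i \<le> int j" using enum_set i by force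
      then show ?thesis using enum_set_le_iff[OF assms(1), of i j] i assms(3) Suc by simp
    qed simp
    show "count_upto S j \<le> count_upto T j + 1"
    proof (cases "count_upto S j - 1")
      case (Suc i)
      then have i: "i < card T" "Suc i < count_upto S j" using count_upto_le_card[OF assms(1), of j] assms(3) by simp_all
      then have "enum_set S (Suc i) \<le> int j" using enum_set_le_iff[OF assms(1), of "Suc i" j] assms(3) by simp
      then have "enum_set T i \<le> int j" using enum_set i by force
      then show ?thesis using enum_set_le_iff[OF assms(2), of i j] i Suc by simp
    qed simp
  qed
qed

lemma bij_betw_enum_set:
  assumes "finite S" "card S = Suc n"
  shows "bij_betw enum_set {T. finite T \<and> card T = n \<and> rowrel S T} (interlacing n (enum_set S))"
  unfolding bij_betw_def
proof
  show "inj_on enum_set {T. finite T \<and> card T = n \<and> rowrel S T}"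
    by (rule inj_on_inverseI[where g = "\<lambda>l. nat ` l ` {..<n}"]) (clarify, rule image_enum_set)
  show "enum_set ` {T. finite T \<and> card T = n \<and> rowrel S T} = interlacing n (enum_set S)"
  proof (intro equalityI subsetI)
    fix l assume "l \<in> enum_set ` {T. finite T \<and> card T = n \<and> rowrel S T}"
    then obtain T where T: "l = enum_set T" "finite T" "card T = n" "rowrel S T" by auto
    then have "\<forall>i<n. enum_set S i \<le> enum_set T i \<and> enum_set T i \<le> enum_set S (Suc i)"
      using rowrel_iff_enum_set[of S T] assms by simp
    moreover have "enum_set T i = 0" if "n \<le> i" for i using that T by (simp add: enum_set_def)
    ultimately show "l \<in> interlacing n (enum_set S)"
      using T enum_set_less[of T] by (simp add: interlacing_def)
  next
    fix l assume l: "l \<in> interlacing n (enum_set S)"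
    let ?T = "nat ` l ` {..<n}"
    have nonneg: "0 \<le> l i" if "i < n" for i
    proof -
      have "0 \<le> enum_set S i" by (simp add: enum_set_def)
      then show ?thesis using l that unfolding interlacing_def by force
    qed
    have T: "card ?T = n" "\<And>i. i < n \<Longrightarrow> enum_set ?T i = l i"
      using l enum_set_image[of n l] nonneg unfolding interlacing_def by auto
    have "enum_set ?T = l"
    proof
      fix i show "enum_set ?T i = l i"
        using T l by (cases "i < n") (auto simp: interlacing_def enum_set_def)
    qed
    moreover have "rowrel S ?T"
      using l assms T by (subst rowrel_iff_enum_set) (auto simp: interlacing_def)
    ultimately show "l \<in> enum_set ` {T. finite T \<and> card T = n \<and> rowrel S T}"
      using T by (intro image_eqI[of _ _ ?T]) auto
  qed
qed

definition mt_count :: "nat set \<Rightarrow> real" where "mt_count S = mt_poly (card S) (enum_set S)"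

lemma mt_count_empty: "mt_count {} = 1"
  by (simp add: mt_count_def mt_poly_def step_prod_def pairs_def vand_def rowdet_def)

lemma mt_count_recursion:
  assumes "finite S" "card S = Suc n"
  shows "mt_count S = (\<Sum>T | finite T \<and> card T = n \<and> rowrel S T. mt_count T)"
    "finite {T. finite T \<and> card T = n \<and> rowrel S T}"
proof -
  have strict: "enum_set S i < enum_set S (Suc i)" if "i < n" for i
    using that assms by (intro enum_set_less) auto
  show "finite {T. finite T \<and> card T = n \<and> rowrel S T}"
    using bij_betw_finite[OF bij_betw_enum_set[OF assms]] mt_poly_recursion(1)[of n "enum_set S"] strict by blast
  have "mt_count S = (\<Sum>l\<in>interlacing n (enum_set S). mt_poly n l)"
    unfolding mt_count_def assms(2) using strict by (rule mt_poly_recursion)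
  also have "\<dots> = (\<Sum>T | finite T \<and> card T = n \<and> rowrel S T. mt_poly n (enum_set T))"
    by (rule sum.reindex_bij_betw[OF bij_betw_enum_set[OF assms], symmetric])
  also have "\<dots> = (\<Sum>T | finite T \<and> card T = n \<and> rowrel S T. mt_count T)"
    by (rule sum.cong) (auto simp: mt_count_def)
  finally show "mt_count S = (\<Sum>T | finite T \<and> card T = n \<and> rowrel S T. mt_count T)" .
qed

lemma mt_count_eq_last_count: "mt_count (insert (d + N + 1 + m) {d + 1..d + N}) = last_count N (int (N + 1 + m))"
proof -
  let ?l = "\<lambda>i. (if i < N then int i + 1 else int (N + 1 + m)) + int d"
  have "insert (d + N + 1 + m) {d + 1..d + N} = nat ` ?l ` {..<Suc N}"
  proof -
    have "nat ` ?l ` {..<Suc N} = insert (nat (?l N)) (nat ` ?l ` {..<N})"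
      by (simp add: lessThan_Suc)
    also have "nat ` ?l ` {..<N} = (\<lambda>i. i + (d + 1)) ` {0..<N}"
      unfolding image_image by (rule image_cong) (auto simp: nat_add_distrib)
    also have "\<dots> = {d + 1..d + N}"
      unfolding image_add_atLeastLessThan' by auto
    also have "nat (?l N) = d + N + 1 + m" by simp
    finally show ?thesis ..
  qed
  moreover have "card (nat ` ?l ` {..<Suc N}) = Suc N" "\<And>i. i < Suc N \<Longrightarrow> enum_set (nat ` ?l ` {..<Suc N}) i = ?l i"
    by (rule enum_set_image; auto)+
  ultimately have "mt_count (insert (d + N + 1 + m) {d + 1..d + N}) = mt_poly (Suc N) ?l"
    unfolding mt_count_def by (auto intro!: depends_belowD[OF depends_below_mt_poly])
  then show ?thesis by (simp only: mt_poly_translate last_count_def)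
qed

text \<open>Read from the right, the ice rule forces every horizontal edge: the edge at
  \<open>k\<close> records the difference of the two counts up to \<open>k\<close>. The constant 1
  stems from \<open>h 0\<close>, the right boundary edge pointing left.\<close>

lemma ice_row_iff:
  assumes "0 \<notin> S" "0 \<notin> T" "h 0"
  shows "(\<forall>j. 1 \<le> j \<and> j \<le> c \<longrightarrow>
        (if \<not> h j then 1 else 0) + (if h (j - 1) then 1 else 0)
          + (if j \<notin> S then 1 else 0) + (if j \<in> T then 1 else 0) = (2 :: nat))
     \<longleftrightarrow> (\<forall>k\<le>c. count_upto S k + of_bool (h k) = count_upto T k + 1)"
proof -
  have cnt0: "count_upto S 0 = 0" "count_upto T 0 = 0"
    using assms by (auto simp: count_upto_def)
  show ?thesis
  proof (intro iffI allI impI)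
    fix k assume ice: "\<forall>j. 1 \<le> j \<and> j \<le> c \<longrightarrow>
        (if \<not> h j then 1 else 0) + (if h (j - 1) then 1 else 0)
          + (if j \<notin> S then 1 else 0) + (if j \<in> T then 1 else 0) = (2 :: nat)" and "k \<le> c"
    from \<open>k \<le> c\<close> show "count_upto S k + of_bool (h k) = count_upto T k + 1"
    proof (induction k)
      case (Suc k)
      then show ?case using ice[rule_format, of "Suc k"] by (auto simp: count_upto_Suc split: if_splits)
    qed (use assms cnt0 in simp)
  next
    fix j assume c: "\<forall>k\<le>c. count_upto S k + of_bool (h k) = count_upto T k + 1" and j: "1 \<le> j \<and> j \<le> c"
    obtain k where k: "j = Suc k" using j by (cases j) auto
    show "(if \<not> h j then 1 else 0) + (if h (j - 1) then 1 else 0)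
          + (if j \<notin> S then 1 else 0) + (if j \<in> T then 1 else 0) = (2 :: nat)"
      using c[rule_format, of j] c[rule_format, of k] j k by (auto simp: count_upto_Suc of_bool_def split: if_splits)
  qed
qed

lemma count_upto_bound: "S \<subseteq> {1..c} \<Longrightarrow> count_upto S (max c j) = card S"
  unfolding count_upto_def by (rule arg_cong[of _ _ card]) (auto simp: le_max_iff_disj)

lemma count_upto_beyond: "S \<subseteq> {1..c} \<Longrightarrow> c \<le> j \<Longrightarrow> count_upto S j = card S"
  using count_upto_bound[of S c j] by (simp add: max_def)

text \<open>The counts at 0 and at \<open>c\<close> leave no room for elements of \<open>T\<close>
  outside. Hence a column bound on the next row is automatic.\<close>

lemma rowrel_subset:
  assumes "S \<subseteq> {1..c}" "finite T" "card S = Suc (card T)" "rowrel S T"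
  shows "T \<subseteq> {1..c}"
proof -
  have "count_upto T 0 \<le> count_upto S 0" using assms(4) by (auto simp: rowrel_def)
  also have "count_upto S 0 = 0" using assms(1) by (auto simp: count_upto_def)
  finally have "0 \<notin> T" using assms(2) by (auto simp: count_upto_def)
  have "card S \<le> count_upto T c + 1"
    using assms(4)[unfolded rowrel_def, rule_format, of c] count_upto_beyond[OF assms(1) order.refl] by simp
  then have "count_upto T c = card T"
    using assms(3) count_upto_le_card[OF assms(2), of c] by simp
  then have "{x \<in> T. x \<le> c} = T"
    unfolding count_upto_def by (rule card_subset_eq[OF assms(2), rotated]) auto
  show ?thesis
  proof
    fix x assume x: "x \<in> T"
    then have "x \<in> {x \<in> T. x \<le> c}" by (simp only: \<open>{x \<in> T. x \<le> c} = T\<close>)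
    moreover have "x \<noteq> 0" using x \<open>0 \<notin> T\<close> by metis
    ultimately show "x \<in> {1..c}" by simp
  qed
qed

section \<open>States of the six-vertex model\<close>

lemma in_statesI:
  assumes "\<And>i k. hl i k \<Longrightarrow> 1 \<le> i \<and> i \<le> r \<and> k \<le> c" "\<And>k j. vu k j \<Longrightarrow> k \<le> r \<and> 1 \<le> j \<and> j \<le> c"
    "\<And>i. 1 \<le> i \<Longrightarrow> i \<le> r \<Longrightarrow> \<not> hl i c" "\<And>i. 1 \<le> i \<Longrightarrow> i \<le> r \<Longrightarrow> hl i 0"
    "\<And>j. 1 \<le> j \<Longrightarrow> j \<le> c \<Longrightarrow> \<not> vu r j" "\<And>j. 1 \<le> j \<Longrightarrow> j \<le> c \<Longrightarrow> vu 0 j \<longleftrightarrow> j \<in> Up"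
    "\<And>i j. 1 \<le> i \<Longrightarrow> i \<le> r \<Longrightarrow> 1 \<le> j \<Longrightarrow> j \<le> c \<Longrightarrow> in_count hl vu i j = 2"
  shows "(hl, vu) \<in> six_vertex_states r c Up"
  unfolding six_vertex_states_def using assms by blast

lemma in_statesD:
  assumes "(hl, vu) \<in> six_vertex_states r c Up"
  shows "hl i k \<Longrightarrow> 1 \<le> i \<and> i \<le> r \<and> k \<le> c" "vu k j \<Longrightarrow> k \<le> r \<and> 1 \<le> j \<and> j \<le> c"
    "1 \<le> i \<Longrightarrow> i \<le> r \<Longrightarrow> \<not> hl i c" "1 \<le> i \<Longrightarrow> i \<le> r \<Longrightarrow> hl i 0"
    "1 \<le> j \<Longrightarrow> j \<le> c \<Longrightarrow> \<not> vu r j" "1 \<le> j \<Longrightarrow> j \<le> c \<Longrightarrow> vu 0 j \<longleftrightarrow> j \<in> Up"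
    "1 \<le> i \<Longrightarrow> i \<le> r \<Longrightarrow> 1 \<le> j \<Longrightarrow> j \<le> c \<Longrightarrow> in_count hl vu i j = 2"
  using assms unfolding six_vertex_states_def by blast+

definition next_rows :: "nat \<Rightarrow> nat set \<Rightarrow> nat set set" where
  "next_rows c S = {T. T \<subseteq> {1..c} \<and> card S = Suc (card T) \<and> rowrel S T}"

text \<open>By \<open>ice_row_iff\<close> the horizontal edges of the new top row are determined by
  the vertical edges above and below it, so only \<open>T\<close> and the smaller state are needed.
  The default \<open>False\<close> outside the grid keeps the encoding of states unique.\<close>

definition add_row where
  "add_row c Up = (\<lambda>(T, hl, vu).
     (\<lambda>i k. if i = 0 then False else if i = 1 then k \<le> c \<and> count_upto Up k = count_upto T k else hl (i - 1) k,
      \<lambda>k j. if k = 0 then j \<in> Up else vu (k - 1) j))"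

definition remove_row where
  "remove_row = (\<lambda>(hl, vu). ({j. vu 1 j}, (\<lambda>i k. 1 \<le> i \<and> hl (Suc i) k), (\<lambda>k j. vu (Suc k) j)))"
  for hl vu :: "nat \<Rightarrow> nat \<Rightarrow> bool"

lemma top_row:
  assumes "(hl, vu) \<in> six_vertex_states (Suc r) c Up" "Up \<subseteq> {1..c}"
  shows "{j. vu 1 j} \<in> next_rows c Up"
    "hl 1 k \<longleftrightarrow> k \<le> c \<and> count_upto Up k = count_upto {j. vu 1 j} k"
proof -
  note st = in_statesD[OF assms(1)]
  let ?T = "{j. vu 1 j}"
  have T: "?T \<subseteq> {1..c}" using st(2) by auto
  have "\<forall>k\<le>c. count_upto Up k + of_bool (hl 1 k) = count_upto ?T k + 1"
  proof (subst ice_row_iff[symmetric])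
    show "\<forall>j. 1 \<le> j \<and> j \<le> c \<longrightarrow>
        (if \<not> hl 1 j then 1 else 0) + (if hl 1 (j - 1) then 1 else 0)
          + (if j \<notin> Up then 1 else 0) + (if j \<in> ?T then 1 else 0) = (2 :: nat)"
    proof (intro allI impI)
      fix j assume j: "1 \<le> j \<and> j \<le> c"
      then show "(if \<not> hl 1 j then 1 else 0) + (if hl 1 (j - 1) then 1 else 0)
          + (if j \<notin> Up then 1 else 0) + (if j \<in> ?T then 1 else 0) = (2 :: nat)"
        using st(7)[of 1 j] st(6)[of j] by (simp add: in_count_def)
    qed
    show "0 \<notin> Up" "0 \<notin> ?T" "hl 1 0" using assms(2) T st(4)[of 1] by auto
  qed
  then have row: "count_upto Up k + of_bool (hl 1 k) = count_upto ?T k + 1" if "k \<le> c" for k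
    using that by blast
  have card: "card Up = Suc (card ?T)"
    using row[of c] st(3)[of 1] count_upto_beyond[OF assms(2) order.refl] count_upto_beyond[OF T order.refl] by simp
  have "count_upto ?T j \<le> count_upto Up j \<and> count_upto Up j \<le> count_upto ?T j + 1" for j
  proof (cases "j \<le> c")
    case True
    then show ?thesis using row[of j] by (cases "hl 1 j") auto
  next
    case False
    then show ?thesis
      using count_upto_beyond[OF assms(2), of j] count_upto_beyond[OF T, of j] card by simp
  qed
  then show "?T \<in> next_rows c Up"
    using T card unfolding next_rows_def rowrel_def by blast
  show "hl 1 k \<longleftrightarrow> k \<le> c \<and> count_upto Up k = count_upto ?T k"
    using row[of k] st(1)[of 1 k] by (cases "hl 1 k") auto
qed

lemma remove_row_state:
  assumes "(hl, vu) \<in> six_vertex_states (Suc r) c Up"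
  shows "(\<lambda>i k. 1 \<le> i \<and> hl (Suc i) k, \<lambda>k j. vu (Suc k) j) \<in> six_vertex_states r c {j. vu 1 j}"
proof -
  note st = in_statesD[OF assms]
  show ?thesis
  proof (rule in_statesI)
    fix i j assume "1 \<le> i" "i \<le> r" "1 \<le> j" "j \<le> c"
    then show "in_count (\<lambda>i k. 1 \<le> i \<and> hl (Suc i) k) (\<lambda>k j. vu (Suc k) j) i j = 2"
      using st(7)[of "Suc i" j] by (simp add: in_count_def)
  qed (use st(1)[of "Suc _"] st(2)[of "Suc _"] st(3-5) in auto)
qed

lemma add_row_state:
  assumes "Up \<subseteq> {1..c}" "T \<in> next_rows c Up" "(hl, vu) \<in> six_vertex_states r c T"
  shows "add_row c Up (T, hl, vu) \<in> six_vertex_states (Suc r) c Up"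
proof -
  note st = in_statesD[OF assms(3)]
  have T: "T \<subseteq> {1..c}" "card Up = Suc (card T)" and rel: "rowrel Up T"
    using assms(2) by (auto simp: next_rows_def)
  let ?h = "\<lambda>k. k \<le> c \<and> count_upto Up k = count_upto T k"
  let ?hl = "\<lambda>i k. if i = 0 then False else if i = 1 then ?h k else hl (i - 1) k"
  let ?vu = "\<lambda>k j. if k = 0 then j \<in> Up else vu (k - 1) j"
  have vu0: "vu 0 j \<longleftrightarrow> j \<in> T" for j
    using st(2)[of 0 j] st(6)[of j] T(1) by (cases "1 \<le> j \<and> j \<le> c") auto
  have row: "\<forall>k\<le>c. count_upto Up k + of_bool (?h k) = count_upto T k + 1"
  proof (intro allI impI)
    fix k assume "k \<le> c"
    then show "count_upto Up k + of_bool (?h k) = count_upto T k + 1"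
      using rel[unfolded rowrel_def, rule_format, of k] by auto
  qed
  have h0: "?h 0" using assms(1) T(1) by (auto simp: count_upto_def intro!: arg_cong[of _ _ card])
  have "(?hl, ?vu) \<in> six_vertex_states (Suc r) c Up"
  proof (rule in_statesI)
    fix i k assume "?hl i k" then show "1 \<le> i \<and> i \<le> Suc r \<and> k \<le> c"
      using st(1)[of "i - 1" k] by (auto split: if_splits)
  next
    fix k j assume "?vu k j" then show "k \<le> Suc r \<and> 1 \<le> j \<and> j \<le> c"
      using st(2)[of "k - 1" j] assms(1) by (auto split: if_splits)
  next
    fix i assume "1 \<le> i" "i \<le> Suc r" then show "\<not> ?hl i c"
      using st(3)[of "i - 1"] count_upto_beyond[OF assms(1) order.refl] count_upto_beyond[OF T(1) order.refl] T(2) by auto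
  next
    fix i assume "1 \<le> i" "i \<le> Suc r" then show "?hl i 0"
      using st(4)[of "i - 1"] h0 by auto
  next
    fix j assume "1 \<le> j" "j \<le> c" then show "\<not> ?vu (Suc r) j" using st(5)[of j] by simp
  next
    fix j show "?vu 0 j \<longleftrightarrow> j \<in> Up" by simp
  next
    fix i j assume i: "1 \<le> i" "i \<le> Suc r" and j: "1 \<le> j" "j \<le> c"
    show "in_count ?hl ?vu i j = 2"
    proof (cases "i = 1")
      case True
      have "0 \<notin> Up" "0 \<notin> T" using assms(1) T(1) by auto
      from ice_row_iff[of Up T ?h c, OF this h0] row j True show ?thesis
        by (auto simp: in_count_def vu0)
    next
      case False
      then obtain i' where "i = Suc (Suc i')" using i by (cases i; cases "i - 1") auto
      then show ?thesis using st(7)[of "Suc i'" j] i j by (simp add: in_count_def)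
    qed
  qed
  then show ?thesis by (simp add: add_row_def)
qed

lemma bij_betw_add_row:
  assumes "Up \<subseteq> {1..c}"
  shows "bij_betw (add_row c Up) (Sigma (next_rows c Up) (\<lambda>T. six_vertex_states r c T)) (six_vertex_states (Suc r) c Up)"
proof (rule bij_betw_byWitness[where f' = remove_row])
  show "\<forall>a\<in>Sigma (next_rows c Up) (\<lambda>T. six_vertex_states r c T). remove_row (add_row c Up a) = a"
  proof
    fix a assume "a \<in> Sigma (next_rows c Up) (\<lambda>T. six_vertex_states r c T)"
    then obtain T hl vu where a: "a = (T, hl, vu)" "T \<subseteq> {1..c}" "(hl, vu) \<in> six_vertex_states r c T"
      by (cases a) (auto simp: next_rows_def)
    note st = in_statesD[OF a(3)]
    have "vu 0 j \<longleftrightarrow> j \<in> T" for j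
      using st(2)[of 0 j] st(6)[of j] a(2) by (cases "1 \<le> j \<and> j \<le> c") auto
    then have T: "{j. vu 0 j} = T" by simp
    have hl: "(\<lambda>i k. 1 \<le> i \<and> hl i k) = hl" using st(1) by (auto simp: fun_eq_iff)
    have "remove_row (add_row c Up a) = ({j. vu 0 j}, (\<lambda>i k. 1 \<le> i \<and> hl i k), vu)"
      by (auto simp: a(1) remove_row_def add_row_def fun_eq_iff)
    then show "remove_row (add_row c Up a) = a" by (simp only: T hl a(1))
  qed
  show "\<forall>b\<in>six_vertex_states (Suc r) c Up. add_row c Up (remove_row b) = b"
  proof
    fix b assume b: "b \<in> six_vertex_states (Suc r) c Up"
    obtain hl vu where bb: "b = (hl, vu)" by force
    note st = in_statesD[OF b[unfolded bb]]
    have "vu 0 j \<longleftrightarrow> j \<in> Up" for j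
      using assms st(2)[of 0 j] st(6)[of j] by (cases "1 \<le> j \<and> j \<le> c") auto
    moreover have "\<not> hl 0 k" for k using st(1)[of 0 k] by auto
    ultimately show "add_row c Up (remove_row b) = b"
      using top_row(2)[OF b[unfolded bb] assms]
      by (auto simp: bb add_row_def remove_row_def fun_eq_iff)
  qed
  show "add_row c Up ` Sigma (next_rows c Up) (six_vertex_states r c) \<subseteq> six_vertex_states (Suc r) c Up"
    using add_row_state[OF assms] by auto
  show "remove_row ` six_vertex_states (Suc r) c Up \<subseteq> Sigma (next_rows c Up) (six_vertex_states r c)"
    using top_row(1)[OF _ assms] remove_row_state unfolding remove_row_def by fastforce
qed

text \<open>Both sides satisfy the same recursion over the next row and start at 1 for the empty
  row. The number of columns drops out.\<close>

lemma states_eq_mt_count: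
  assumes "Up \<subseteq> {1..c}" "card Up = r"
  shows "finite (six_vertex_states r c Up) \<and> real (card (six_vertex_states r c Up)) = mt_count Up"
  using assms
proof (induction r arbitrary: Up)
  case 0
  then have Up: "Up = {}" using finite_subset[OF _ finite_atLeastAtMost[of 1 c]] by auto
  have "six_vertex_states 0 c {} = {(\<lambda>_ _. False, \<lambda>_ _. False)}"
  proof (intro equalityI subsetI)
    fix s assume s: "s \<in> six_vertex_states 0 c {}"
    obtain hl vu where hv: "s = (hl, vu)" by force
    note st = in_statesD[OF s[unfolded hv]]
    have "\<not> hl i k" "\<not> vu k j" for i j k
      using st(1)[of i k] st(2)[of k j] st(5)[of j] by auto
    then show "s \<in> {(\<lambda>_ _. False, \<lambda>_ _. False)}" by (simp add: hv fun_eq_iff)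
  qed (simp add: six_vertex_states_def)
  then show ?case by (simp add: Up mt_count_empty)
next
  case (Suc r)
  have fin: "finite Up" using Suc.prems(1) finite_subset by blast
  have next_rows: "next_rows c Up = {T. finite T \<and> card T = r \<and> rowrel Up T}"
    using rowrel_subset[OF Suc.prems(1)] Suc.prems(2) finite_subset[OF _ finite_atLeastAtMost[of 1 c]]
    unfolding next_rows_def by (intro Collect_cong) auto
  have fin_rows: "finite (next_rows c Up)"
    unfolding next_rows by (rule mt_count_recursion(2)[OF fin Suc.prems(2)])
  have IH: "finite (six_vertex_states r c T)" "real (card (six_vertex_states r c T)) = mt_count T"
    if "T \<in> next_rows c Up" for T
    using Suc.IH[of T] that Suc.prems(2) by (auto simp: next_rows_def)
  have "finite (six_vertex_states (Suc r) c Up)"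
    using bij_betw_finite[OF bij_betw_add_row[OF Suc.prems(1), of r]] fin_rows IH(1) by blast
  moreover have "card (six_vertex_states (Suc r) c Up) = (\<Sum>T\<in>next_rows c Up. card (six_vertex_states r c T))"
    using bij_betw_same_card[OF bij_betw_add_row[OF Suc.prems(1), of r]] fin_rows IH(1)
    by simp
  then have "real (card (six_vertex_states (Suc r) c Up)) = (\<Sum>T\<in>next_rows c Up. mt_count T)"
    using IH(2) by (simp cong: sum.cong)
  ultimately show ?case
    using mt_count_recursion(1)[OF fin Suc.prems(2)] next_rows by simp
qed

lemma A_lambda_eq_last_count: "real (A_lambda (hook_partition m d) (Suc N)) = last_count N (int (N + 1 + m))"
proof -
  let ?lam = "hook_partition m d"
  have set: "{?lam k + Suc N + 1 - k | k. 1 \<le> k \<and> k \<le> Suc N} = insert (d + N + 1 + m) {d + 1..d + N}"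
  proof (intro equalityI subsetI)
    fix x assume "x \<in> {?lam k + Suc N + 1 - k | k. 1 \<le> k \<and> k \<le> Suc N}"
    then obtain k where "x = ?lam k + Suc N + 1 - k" "1 \<le> k" "k \<le> Suc N" by blast
    then show "x \<in> insert (d + N + 1 + m) {d + 1..d + N}"
      by (cases "k = 1") (auto simp: hook_partition_def)
  next
    fix x assume x: "x \<in> insert (d + N + 1 + m) {d + 1..d + N}"
    show "x \<in> {?lam k + Suc N + 1 - k | k. 1 \<le> k \<and> k \<le> Suc N}"
    proof (cases "x = d + N + 1 + m")
      case True
      then have "x = ?lam 1 + Suc N + 1 - 1" by (simp add: hook_partition_def)
      then show ?thesis by (intro CollectI exI[of _ 1]) simp
    next
      case False
      \<comment> \<open>The witness inverts \<open>x = d + N + 2 - k\<close>, the column contributed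
        by part \<open>k\<close> for \<open>k \<ge> 2\<close>.\<close>
      then have "x = ?lam (d + N + 2 - x) + Suc N + 1 - (d + N + 2 - x)"
        "1 \<le> d + N + 2 - x" "d + N + 2 - x \<le> Suc N"
        using x by (auto simp: hook_partition_def)
      then show ?thesis by blast
    qed
  qed
  have sub: "insert (d + N + 1 + m) {d + 1..d + N} \<subseteq> {1..Suc N + ?lam 1}"
    by (auto simp: hook_partition_def)
  have card: "card (insert (d + N + 1 + m) {d + 1..d + N}) = Suc N" by simp
  show ?thesis
    unfolding A_lambda_def set mt_count_eq_last_count[of d, symmetric]
    using states_eq_mt_count[OF sub card] by (rule conjunct2)
qed

section \<open>The refined enumeration\<close>

text \<open>For \<open>d = 1\<close> this sums over the rows above \<open>S\<close>. For \<open>d = 0\<close> it sums over the rows above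
  \<open>insert t S\<close> with \<open>t > N\<close> that stay within the first \<open>N\<close> columns.\<close>

definition transfer :: "nat \<Rightarrow> nat \<Rightarrow> (nat set \<Rightarrow> real) \<Rightarrow> nat set \<Rightarrow> real" where
  "transfer d N \<phi> S = (\<Sum>T | T \<subseteq> {1..N} \<and> card S = card T + d \<and> rowrel S T. \<phi> T)"

lemma count_upto_insert:
  assumes "finite S" "u \<notin> S"
  shows "count_upto (insert u S) j = count_upto S j + of_bool (u \<le> j)"
proof -
  have "{x \<in> insert u S. x \<le> j} = (if u \<le> j then insert u {x \<in> S. x \<le> j} else {x \<in> S. x \<le> j})" by auto
  then show ?thesis using assms by (simp add: count_upto_def)
qed

lemma rowrelD: "rowrel S T \<Longrightarrow> count_upto T j \<le> count_upto S j" "rowrel S T \<Longrightarrow> count_upto S j \<le> count_upto T j + 1"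
  by (auto simp: rowrel_def)

text \<open>Only the last entry of the given row lies beyond \<open>N\<close>, so the next row has
  at most one entry there, and it is at most \<open>N + 1 + m\<close>. The rest of the next row has
  as many elements as \<open>S\<close> if there is no such entry, and one fewer otherwise.\<close>

lemma next_rows_insert:
  assumes S: "S \<subseteq> {1..N}"
  shows "next_rows (N + 1 + m) (insert (N + 1 + m) S)
     = {T. T \<subseteq> {1..N} \<and> card S = card T + 0 \<and> rowrel S T}
       \<union> (\<lambda>(s, T). insert (N + 1 + s) T) ` ({..m} \<times> {T. T \<subseteq> {1..N} \<and> card S = card T + 1 \<and> rowrel S T})"
    (is "?L = ?A \<union> ?B")
proof -
  let ?t = "N + 1 + m"
  have fin: "finite S" and tS: "?t \<notin> S" using S finite_subset[OF S] by auto
  have cS: "count_upto (insert ?t S) j = count_upto S j + of_bool (?t \<le> j)" for j by (rule count_upto_insert[OF fin tS])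
  have card_S: "card (insert ?t S) = Suc (card S)" using fin tS by simp
  have beyond: "count_upto S j = card S" if "N \<le> j" for j using count_upto_beyond[OF S that] .
  show ?thesis
  proof (intro equalityI subsetI)
    fix T assume "T \<in> ?L"
    then have T: "T \<subseteq> {1..?t}" "card T = card S" and rel: "rowrel (insert ?t S) T"
      using card_S by (auto simp: next_rows_def)
    have finT: "finite T" using T(1) finite_subset by blast
    let ?T = "T \<inter> {..N}"
    have T': "?T \<subseteq> {1..N}" using T(1) by auto
    have cT: "count_upto ?T j = count_upto T j" if "j \<le> N" for j
      unfolding count_upto_def using that by (intro arg_cong[of _ _ card]) auto
    have cTN: "count_upto T N = card ?T" unfolding count_upto_def by (intro arg_cong[of _ _ card]) auto
    have rel': "rowrel S ?T" if "card S \<le> card ?T + 1"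
      unfolding rowrel_def
    proof (intro allI)
      fix j
      show "count_upto ?T j \<le> count_upto S j \<and> count_upto S j \<le> count_upto ?T j + 1"
      proof (cases "j \<le> N")
        case True
        then show ?thesis using rowrelD[OF rel, of j] cS[of j] cT[of j] by simp
      next
        case False
        have "card ?T \<le> card S" using card_mono[OF finT, of ?T] T(2) by simp
        then show ?thesis using False that beyond[of j] count_upto_beyond[OF T', of j] by simp
      qed
    qed
    have le: "card S \<le> card ?T + 1"
      using rowrelD(2)[OF rel, of N] cS[of N] beyond[of N] cTN by simp
    show "T \<in> ?A \<union> ?B"
    proof (cases "T \<subseteq> {..N}")
      case True
      then have "?T = T" by auto
      then have "T \<in> ?A" using T' T(2) rel'[OF le] by simp
      then show ?thesis by blast
    next
      case False
      have cardT: "card T = card ?T + card (T - {..N})"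
        using card_Un_disjoint[of ?T "T - {..N}"] finT by (simp add: Int_Diff_Un Int_Diff_disjoint)
      have "T - {..N} \<noteq> {}" using False by auto
      then have "card (T - {..N}) \<noteq> 0" using finT by simp
      then have "card (T - {..N}) = 1" using cardT le T(2) by simp
      then obtain u where u: "T - {..N} = {u}" by (auto simp: card_1_singleton_iff)
      then have "u \<in> T - {..N}" by simp
      then have uT: "u \<in> T" "N < u" by auto
      then have "u = N + 1 + (u - N - 1)" "u - N - 1 \<in> {..m}" using uT T(1) by auto
      moreover have "?T \<in> {T. T \<subseteq> {1..N} \<and> card S = card T + 1 \<and> rowrel S T}"
        using T' rel'[OF le] cardT \<open>card (T - {..N}) = 1\<close> T(2) by simp
      moreover have "T = ?T \<union> (T - {..N})" by (simp add: Int_Diff_Un)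
      then have "T = insert u ?T" unfolding u by simp
      ultimately have "T \<in> ?B"
        by (intro image_eqI[of _ _ "(u - N - 1, ?T)"]) (simp_all only: case_prod_conv mem_Times_iff fst_conv snd_conv simp_thms)
      then show ?thesis by blast
    qed
  next
    fix T assume "T \<in> ?A \<union> ?B"
    then show "T \<in> ?L"
    proof
      assume T: "T \<in> ?A"
      have "count_upto T j \<le> count_upto S j + of_bool (?t \<le> j) \<and> count_upto S j + of_bool (?t \<le> j) \<le> count_upto T j + 1" for j
        using T beyond[of j] count_upto_beyond[of T N j] rowrelD[of S T j] by (cases "?t \<le> j") auto
      then have "rowrel (insert ?t S) T" unfolding rowrel_def cS by blast
      moreover have "T \<subseteq> {1..?t}" using T by auto
      ultimately show ?thesis using T card_S by (simp add: next_rows_def)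
    next
      assume "T \<in> ?B"
      then obtain s T' where T: "T = insert (N + 1 + s) T'" "s \<le> m" and T': "T' \<subseteq> {1..N}" "card S = card T' + 1"
        and rel: "rowrel S T'" by auto
      have finT': "finite T'" and n: "N + 1 + s \<notin> T'" using T' finite_subset[OF T'(1)] by auto
      have cT: "count_upto T j = count_upto T' j + of_bool (N + 1 + s \<le> j)" for j
        unfolding T(1) by (rule count_upto_insert[OF finT' n])
      have "count_upto T j \<le> count_upto S j + of_bool (?t \<le> j) \<and> count_upto S j + of_bool (?t \<le> j) \<le> count_upto T j + 1" for j
        using cT[of j] T(2) beyond[of j] count_upto_beyond[OF T'(1), of j] rowrelD[OF rel, of j] T'(2)
        by (cases "N \<le> j") auto
      then have "rowrel (insert ?t S) T" unfolding rowrel_def cS by blast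
      moreover have "card T = card S" using finT' n T(1) T'(2) by simp
      moreover have "T \<subseteq> {1..?t}" using T T'(1) by auto
      ultimately show ?thesis using card_S by (simp add: next_rows_def)
    qed
  qed
qed

lemma mt_count_next_rows:
  assumes "S \<subseteq> {1..c}" "S \<noteq> {}"
  shows "mt_count S = (\<Sum>T\<in>next_rows c S. mt_count T)"
proof -
  have fin: "finite S" using assms finite_subset by blast
  then obtain n where n: "card S = Suc n" using assms(2) by (cases "card S") auto
  have "next_rows c S = {T. finite T \<and> card T = n \<and> rowrel S T}"
    using rowrel_subset[OF assms(1)] n finite_subset[OF _ finite_atLeastAtMost[of 1 c]]
    unfolding next_rows_def by (intro Collect_cong) auto
  then show ?thesis using mt_count_recursion(1)[OF fin n] by simp
qed

lemma mt_count_insert_step: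
  assumes S: "S \<subseteq> {1..N}"
  shows "mt_count (insert (N + 1 + m) S)
     = transfer 0 N mt_count S + (\<Sum>s\<le>m. transfer 1 N (\<lambda>T. mt_count (insert (N + 1 + s) T)) S)"
proof -
  let ?R = "\<lambda>d. {T. T \<subseteq> {1..N} \<and> card S = card T + d \<and> rowrel S T}"
  let ?ins = "\<lambda>(s, T). insert (N + 1 + s) T"
  have fin: "finite (?R d)" for d by (rule finite_subset[of _ "Pow {1..N}"]) auto
  have inj: "inj_on ?ins ({..m} \<times> ?R 1)"
  proof (rule inj_onI, clarify)
    fix s T s' T' assume sub: "T \<subseteq> {1..N}" "T' \<subseteq> {1..N}" and eq: "insert (N + 1 + s) T = insert (N + 1 + s') T'"
    have "N + 1 + s \<in> insert (N + 1 + s') T'" "N + 1 + s \<notin> T'" "N + 1 + s \<notin> T" "N + 1 + s' \<notin> T'"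
      using eq sub by auto
    then have "s = s'" "T = T'" using eq by (auto dest: insert_ident[THEN iffD1])
    then show "s = s' \<and> T = T'" by simp
  qed
  have disj: "?R 0 \<inter> ?ins ` ({..m} \<times> ?R 1) = {}" by auto
  have "mt_count (insert (N + 1 + m) S) = (\<Sum>T\<in>?R 0 \<union> ?ins ` ({..m} \<times> ?R 1). mt_count T)"
    unfolding next_rows_insert[OF S, symmetric] using S by (intro mt_count_next_rows) auto
  also have "\<dots> = (\<Sum>T\<in>?R 0. mt_count T) + (\<Sum>T\<in>?ins ` ({..m} \<times> ?R 1). mt_count T)"
    using fin disj by (intro sum.union_disjoint) auto
  also have "(\<Sum>T\<in>?ins ` ({..m} \<times> ?R 1). mt_count T) = (\<Sum>(s, T)\<in>{..m} \<times> ?R 1. mt_count (insert (N + 1 + s) T))"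
    unfolding sum.reindex[OF inj] by (rule sum.cong) auto
  also have "\<dots> = (\<Sum>s\<le>m. transfer 1 N (\<lambda>T. mt_count (insert (N + 1 + s) T)) S)"
    unfolding transfer_def by (rule sum.cartesian_product[symmetric])
  finally show ?thesis by (simp add: transfer_def)
qed

lemma sum_binomial_shift: "(\<Sum>s\<le>m. (s + i) choose i) = (m + Suc i) choose Suc i"
  by (induction m) simp_all

lemma transfer_cong:
  assumes "\<And>T. T \<subseteq> {1..N} \<Longrightarrow> card S = card T + d \<Longrightarrow> \<phi> T = \<psi> T"
  shows "transfer d N \<phi> S = transfer d N \<psi> S"
  unfolding transfer_def using assms by (intro sum.cong) auto

lemma transfer_sum: "transfer d N (\<lambda>T. \<Sum>i\<in>I. c i * \<phi> i T) S = (\<Sum>i\<in>I. c i * transfer d N (\<phi> i) S)"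
  unfolding transfer_def by (subst sum.swap) (simp add: sum_distrib_left)

text \<open>Iterating \<open>mt_count_insert_step\<close> sums over the position of the extra entry
  again and again; by the hockey-stick identity each round raises a binomial coefficient, which
  carries all dependence on \<open>m\<close>.\<close>

lemma mt_count_insert_expansion:
  assumes "S \<subseteq> {1..N}"
  shows "mt_count (insert (N + 1 + m) S)
     = (\<Sum>i\<le>card S. real ((m + i) choose i) * (transfer 1 N ^^ i) (transfer 0 N mt_count) S)"
  using assms
proof (induction "card S" arbitrary: S m)
  case 0
  then have "transfer 1 N \<phi> S = 0" for \<phi> by (simp add: transfer_def)
  then show ?case using mt_count_insert_step[OF 0(2)] 0(1) by simp
next
  case (Suc n)
  let ?Z = "\<lambda>i. (transfer 1 N ^^ i) (transfer 0 N mt_count)"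
  have "transfer 1 N (\<lambda>T. mt_count (insert (N + 1 + s) T)) S
      = (\<Sum>i\<le>n. real ((s + i) choose i) * ?Z (Suc i) S)" for s
  proof -
    have "transfer 1 N (\<lambda>T. mt_count (insert (N + 1 + s) T)) S
       = transfer 1 N (\<lambda>T. \<Sum>i\<le>n. real ((s + i) choose i) * ?Z i T) S"
      using Suc.hyps by (intro transfer_cong) auto
    then show ?thesis by (simp add: transfer_sum)
  qed
  then have "(\<Sum>s\<le>m. transfer 1 N (\<lambda>T. mt_count (insert (N + 1 + s) T)) S)
     = (\<Sum>s\<le>m. \<Sum>i\<le>n. real ((s + i) choose i) * ?Z (Suc i) S)"
    by (rule sum.cong[OF refl])
  also have "\<dots> = (\<Sum>i\<le>n. real (\<Sum>s\<le>m. (s + i) choose i) * ?Z (Suc i) S)"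
    by (subst sum.swap) (simp add: sum_distrib_right)
  also have "\<dots> = (\<Sum>i\<le>n. real ((m + Suc i) choose Suc i) * ?Z (Suc i) S)"
    unfolding sum_binomial_shift ..
  finally have "mt_count (insert (N + 1 + m) S)
     = real ((m + 0) choose 0) * ?Z 0 S + (\<Sum>i\<le>n. real ((m + Suc i) choose Suc i) * ?Z (Suc i) S)"
    unfolding mt_count_insert_step[OF Suc.prems] by simp
  also have "\<dots> = (\<Sum>i\<le>Suc n. real ((m + i) choose i) * ?Z i S)"
    by (rule sum.atMost_Suc_shift[symmetric])
  finally show ?case using Suc.hyps(2) by simp
qed

section \<open>Top-bottom reflection of the refined numbers\<close>

definition at_empty :: "nat set \<Rightarrow> real" where "at_empty S = of_bool (S = {})"

lemma mt_count_eq_transfer_power: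
  assumes "S \<subseteq> {1..N}"
  shows "mt_count S = (transfer 1 N ^^ card S) at_empty S"
  using assms
proof (induction "card S" arbitrary: S)
  case 0
  then have "S = {}" using finite_subset[OF 0(2)] by simp
  then show ?case by (simp add: mt_count_empty at_empty_def)
next
  case (Suc n)
  then have "S \<noteq> {}" by auto
  have "mt_count S = transfer 1 N mt_count S"
    unfolding mt_count_next_rows[OF Suc.prems \<open>S \<noteq> {}\<close>] transfer_def next_rows_def by simp
  also have "\<dots> = transfer 1 N ((transfer 1 N ^^ n) at_empty) S"
    using Suc.hyps by (intro transfer_cong) auto
  finally show ?case using Suc.hyps(2)[symmetric] by simp
qed

lemma transfer_power_cong:
  assumes "\<And>T. T \<subseteq> {1..N} \<Longrightarrow> card S = card T + i \<Longrightarrow> \<phi> T = \<psi> T" "S \<subseteq> {1..N}"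
  shows "(transfer 1 N ^^ i) \<phi> S = (transfer 1 N ^^ i) \<psi> S"
  using assms
proof (induction i arbitrary: S)
  case (Suc i)
  have "transfer 1 N ((transfer 1 N ^^ i) \<phi>) S = transfer 1 N ((transfer 1 N ^^ i) \<psi>) S"
    using Suc by (intro transfer_cong Suc.IH) auto
  then show ?case by simp
qed simp

text \<open>Complementation reverses interlacing, so every \<open>transfer d N\<close> is self-adjoint for this form. This is
  the top-bottom reflection of alternating sign matrices.\<close>

definition cform :: "nat \<Rightarrow> (nat set \<Rightarrow> real) \<Rightarrow> (nat set \<Rightarrow> real) \<Rightarrow> real" where
  "cform N \<phi> \<psi> = (\<Sum>S\<in>Pow {1..N}. \<phi> ({1..N} - S) * \<psi> S)"

lemma bij_compl: "bij_betw (\<lambda>S. U - S) (Pow U) (Pow U)"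
  by (rule bij_betw_byWitness[where f' = "\<lambda>S. U - S"]) auto

lemma cform_commute: "cform N \<phi> \<psi> = cform N \<psi> \<phi>"
proof -
  have "cform N \<phi> \<psi> = (\<Sum>S\<in>Pow {1..N}. \<phi> ({1..N} - ({1..N} - S)) * \<psi> ({1..N} - S))"
    unfolding cform_def by (rule sum.reindex_bij_betw[OF bij_compl, symmetric])
  also have "\<dots> = cform N \<psi> \<phi>"
    unfolding cform_def by (intro sum.cong refl) (auto simp: double_diff mult.commute)
  finally show ?thesis .
qed

lemma count_upto_compl:
  assumes "S \<subseteq> {1..N}"
  shows "count_upto ({1..N} - S) j + count_upto S j = min j N"
proof -
  have "{x \<in> {1..N} - S. x \<le> j} \<union> {x \<in> S. x \<le> j} = {1..min j N}" using assms by auto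
  moreover have "finite S" using assms finite_subset by blast
  then have "card ({x \<in> {1..N} - S. x \<le> j} \<union> {x \<in> S. x \<le> j}) = count_upto ({1..N} - S) j + count_upto S j"
    unfolding count_upto_def by (intro card_Un_disjoint) auto
  ultimately show ?thesis by simp
qed

lemma rowrel_compl:
  assumes "S \<subseteq> {1..N}" "T \<subseteq> {1..N}"
  shows "rowrel ({1..N} - T) ({1..N} - S) \<longleftrightarrow> rowrel S T"
  unfolding rowrel_def
proof (rule all_cong1)
  fix j
  show "(count_upto ({1..N} - S) j \<le> count_upto ({1..N} - T) j \<and> count_upto ({1..N} - T) j \<le> count_upto ({1..N} - S) j + 1)
      = (count_upto T j \<le> count_upto S j \<and> count_upto S j \<le> count_upto T j + 1)"
    using count_upto_compl[OF assms(1), of j] count_upto_compl[OF assms(2), of j] by linarith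
qed

lemma cform_transfer: "cform N \<phi> (transfer d N \<psi>) = cform N (transfer d N \<phi>) \<psi>"
proof -
  let ?U = "{1..N}"
  let ?R = "\<lambda>S T. card S = card T + d \<and> rowrel S T"
  have tr: "transfer d N \<chi> S = (\<Sum>T\<in>Pow ?U. of_bool (?R S T) * \<chi> T)" for \<chi> S
    unfolding transfer_def by (intro sum.mono_neutral_cong_left) auto
  have R: "?R (?U - T) (?U - S) \<longleftrightarrow> ?R S T" if "S \<in> Pow ?U" "T \<in> Pow ?U" for S T
  proof -
    have "card (?U - S) = N - card S" "card (?U - T) = N - card T" "card S \<le> N" "card T \<le> N"
      using that card_mono[of ?U S] card_mono[of ?U T] by (auto simp: card_Diff_subset finite_subset)
    then show ?thesis using rowrel_compl[of S N T] that by auto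
  qed
  have "cform N (transfer d N \<phi>) \<psi> = (\<Sum>T\<in>Pow ?U. \<Sum>S\<in>Pow ?U. of_bool (?R (?U - T) S) * \<phi> S * \<psi> T)"
    unfolding cform_def tr sum_distrib_right ..
  also have "\<dots> = (\<Sum>T\<in>Pow ?U. \<Sum>S\<in>Pow ?U. of_bool (?R (?U - T) (?U - S)) * \<phi> (?U - S) * \<psi> T)"
    by (intro sum.cong refl sum.reindex_bij_betw[OF bij_compl, symmetric])
  also have "\<dots> = (\<Sum>T\<in>Pow ?U. \<Sum>S\<in>Pow ?U. of_bool (?R S T) * \<phi> (?U - S) * \<psi> T)"
    by (intro sum.cong refl) (simp only: R)
  also have "\<dots> = (\<Sum>S\<in>Pow ?U. \<Sum>T\<in>Pow ?U. of_bool (?R S T) * \<phi> (?U - S) * \<psi> T)"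
    by (rule sum.swap)
  also have "\<dots> = cform N \<phi> (transfer d N \<psi>)"
    unfolding cform_def tr sum_distrib_left by (intro sum.cong refl) (simp only: mult_ac)
  finally show ?thesis ..
qed

lemma cform_transfer_power: "cform N \<phi> ((transfer d N ^^ i) \<psi>) = cform N ((transfer d N ^^ i) \<phi>) \<psi>"
proof (induction i arbitrary: \<phi>)
  case (Suc i)
  have "cform N \<phi> ((transfer d N ^^ Suc i) \<psi>) = cform N ((transfer d N ^^ i) (transfer d N \<phi>)) \<psi>"
    by (simp only: funpow.simps comp_apply cform_transfer Suc.IH)
  then show ?case by (simp only: funpow_Suc_right[of i _] comp_apply)
qed simp

text \<open>Complementing the full row gives the empty one, so pairing with \<open>at_empty\<close>
  is evaluation at the full row.\<close>

lemma cform_at_empty: "cform N at_empty \<psi> = \<psi> {1..N}"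
proof -
  have "cform N at_empty \<psi> = (\<Sum>S\<in>{{1..N}}. at_empty ({1..N} - S) * \<psi> S)"
    unfolding cform_def by (rule sum.mono_neutral_right) (auto simp: at_empty_def)
  then show ?thesis by (simp add: at_empty_def)
qed

text \<open>The number of monotone triangles with bottom row \<open>1, \<dots>, N + 1\<close> in which \<open>N + 1\<close> occurs
  in exactly \<open>i + 1\<close> rows.\<close>

definition refined :: "nat \<Rightarrow> nat \<Rightarrow> real" where
  "refined N i = (transfer 1 N ^^ i) (transfer 0 N mt_count) {1..N}"

text \<open>\<open>refined N i\<close> pairs \<open>at_empty\<close> with the image of
  \<open>at_empty\<close> under a word: \<open>i\<close> factors \<open>transfer 1 N\<close>, one
  \<open>transfer 0 N\<close>, then \<open>N - i\<close> factors \<open>transfer 1 N\<close>.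
  Self-adjointness reads the word backwards.\<close>

lemma refined_sym:
  assumes "i \<le> N"
  shows "refined N (N - i) = refined N i"
proof -
  have eq: "refined N i = cform N at_empty ((transfer 1 N ^^ i) (transfer 0 N ((transfer 1 N ^^ (N - i)) at_empty)))"
    if "i \<le> N" for i
  proof -
    have "transfer 0 N mt_count T = transfer 0 N ((transfer 1 N ^^ (N - i)) at_empty) T"
      if "T \<subseteq> {1..N}" "card {1..N} = card T + i" for T
    proof (rule transfer_cong)
      fix T' assume "T' \<subseteq> {1..N}" "card T = card T' + 0"
      then show "mt_count T' = (transfer 1 N ^^ (N - i)) at_empty T'"
        using mt_count_eq_transfer_power[of T' N] that by simp
    qed
    then show ?thesis
      unfolding refined_def cform_at_empty by (rule transfer_power_cong) auto
  qed
  have "refined N i = cform N ((transfer 1 N ^^ (N - i)) (transfer 0 N ((transfer 1 N ^^ i) at_empty))) at_empty"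
    unfolding eq[OF assms] cform_transfer_power cform_transfer by (simp only: cform_commute)
  then show ?thesis using eq[of "N - i"] assms by (simp add: cform_commute)
qed

lemma last_count_expansion: "last_count N (int (N + 1 + m)) = (\<Sum>i\<le>N. real ((m + i) choose i) * refined N i)"
  using mt_count_insert_expansion[of "{1..N}" N m] mt_count_eq_last_count[of 0 N m] by (simp add: refined_def)

text \<open>Within \<open>{1..Suc N}\<close> there is only one row of \<open>Suc N\<close> entries.
  This ties the entry at 0 to the total of the previous size, the link in the induction that fixes
  the scalar.\<close>

lemma refined_0: "refined (Suc N) 0 = last_count N (int (N + 1))"
proof -
  have "{T. T \<subseteq> {1..Suc N} \<and> card {1..Suc N} = card T + 0 \<and> rowrel {1..Suc N} T} = {{1..Suc N}}"
  proof (intro equalityI subsetI)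
    fix T assume "T \<in> {T. T \<subseteq> {1..Suc N} \<and> card {1..Suc N} = card T + 0 \<and> rowrel {1..Suc N} T}"
    then have "T \<subseteq> {1..Suc N}" "card T = card {1..Suc N}" by (blast, simp)
    then have "T = {1..Suc N}" by (rule card_subset_eq[OF finite_atLeastAtMost])
    then show "T \<in> {{1..Suc N}}" by simp
  qed (simp add: rowrel_def)
  then have "refined (Suc N) 0 = mt_count {1..Suc N}" by (simp add: refined_def transfer_def)
  moreover have "insert (0 + N + 1 + 0) {0 + 1..0 + N} = {1..Suc N}" by auto
  ultimately show ?thesis using mt_count_eq_last_count[of 0 N 0] by simp
qed

lemma refined_0_0: "refined 0 0 = 1"
proof -
  have "{T. T \<subseteq> {1..0} \<and> card {1..0 :: nat} = card T + 0 \<and> rowrel {1..0} T} = {{}}"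
    by (auto simp: rowrel_def)
  then show ?thesis by (simp add: refined_def transfer_def mt_count_empty)
qed

section \<open>The linear relation forced by parity\<close>

lemma fdiff_binc: "fdiff (\<lambda>t. binc (t + c) i) = (\<lambda>t. if i = 0 then 0 else binc (t + c) (i - 1))"
proof
  fix t
  show "fdiff (\<lambda>t. binc (t + c) i) t = (if i = 0 then 0 else binc (t + c) (i - 1))"
    using binc_Suc[of "t + c" "i - 1"] by (cases i) (simp_all add: fdiff_def algebra_simps)
qed

lemma fdiff_power_binc:
  "(fdiff ^^ k) (\<lambda>t. binc (t + c) i) = (\<lambda>t. if i < k then 0 else binc (t + c) (i - k))"
proof (induction k arbitrary: i)
  case (Suc k)
  have zero: "(fdiff ^^ k) (\<lambda>t. 0) = (\<lambda>t. 0)" for k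
    by (induction k) (simp_all add: fdiff_def[abs_def] del: fdiff_def)
  show ?case
  proof (cases i)
    case 0
    then show ?thesis
      by (simp only: funpow_Suc_right comp_apply fdiff_binc 0 simp_thms if_True zero) simp
  next
    case (Suc i')
    then have "fdiff (\<lambda>t. binc (t + c) i) = (\<lambda>t. binc (t + c) i')" by (simp add: fdiff_binc)
    then show ?thesis using Suc by (simp only: funpow_Suc_right comp_apply Suc.IH) (simp cong: if_cong)
  qed
qed simp

lemma fdiff_power_sum:
  "(fdiff ^^ k) (\<lambda>t. \<Sum>i\<in>I. c i * h i t) t = (\<Sum>i\<in>I. c i * (fdiff ^^ k) (h i) t)"
proof (induction k arbitrary: t)
  case (Suc k)
  have "(fdiff ^^ Suc k) F t = (fdiff ^^ k) F (t + 1) - (fdiff ^^ k) F t" for F t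
    by (simp only: funpow.simps comp_apply fdiff_def[of "(fdiff ^^ k) F"])
  then show ?case by (simp only: Suc.IH) (simp add: sum_subtractf right_diff_distrib)
qed simp

text \<open>Both sides are annihilated by \<open>Suc N\<close> differences and agree for
  \<open>t \<ge> N + 1\<close>. The extension to negative \<open>t\<close> is what parity
  needs.\<close>

lemma last_count_expansion_int: "last_count N t = (\<Sum>i\<le>N. refined N i * binc (t + (int i - int N - 1)) i)"
proof -
  let ?F = "\<lambda>t. \<Sum>i\<le>N. refined N i * binc (t + (int i - int N - 1)) i"
  \<comment> \<open>A sum over \<open>bool\<close> expresses the difference of the two sides, so
    that \<open>fdiff_power_sum\<close> covers it too.\<close>
  let ?h = "\<lambda>b :: bool. if b then last_count N else ?F"
  let ?c = "\<lambda>b :: bool. if b then 1 else -1 :: real"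
  define H where "H t = (\<Sum>b\<in>UNIV. ?c b * ?h b t)" for t
  have "H t = 0"
  proof (rule fdiff_power_unique)
    fix t
    have "(fdiff ^^ Suc N) H t = (\<Sum>b\<in>UNIV. ?c b * (fdiff ^^ Suc N) (?h b) t)"
      unfolding H_def[abs_def] by (rule fdiff_power_sum)
    also have "\<dots> = (fdiff ^^ Suc N) (last_count N) t - (fdiff ^^ Suc N) ?F t"
      by (simp add: UNIV_bool del: funpow.simps)
    also have "(fdiff ^^ Suc N) ?F t = 0"
      unfolding fdiff_power_sum fdiff_power_binc by simp
    finally show "(fdiff ^^ Suc N) H t = 0" using fdiff_last_count[of N t] by simp
  next
    fix t assume "int N + 1 \<le> t"
    then obtain m where m: "t = int (N + 1 + m)"
      by (metis add.commute nonneg_int_cases of_nat_1 of_nat_add zle_iff_zadd)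
    have "binc (t + (int i - int N - 1)) i = real ((m + i) choose i)" for i
      using binomial_gbinomial[of "m + i" i, where 'a = real] by (simp add: m binc_def)
    then show "H t = 0"
      using last_count_expansion[of N m, folded m] by (simp add: H_def UNIV_bool mult.commute)
  qed
  then show ?thesis by (simp add: H_def UNIV_bool)
qed

text \<open>Expand both sides of the parity in binomials, take \<open>N - k\<close> differences and
  set \<open>t = k\<close>. One side then reduces to the single number
  \<open>refined N (N - k)\<close>, which \<open>refined_sym\<close> turns into
  \<open>refined N k\<close>.\<close>

lemma refined_relation:
  assumes "k \<le> N"
  shows "refined N k = (\<Sum>j\<le>k. (-1) ^ j * refined N j * real ((N + k) choose (k - j)))"
proof -
  define k' where "k' = N - k"
  have neg: "binc (- t + (int i - int N - 1)) i = (-1) ^ i * binc (t + int N) i" for t i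
  proof -
    have "(- (of_int (t + int N + 1 - int i)) :: real) gchoose i
       = (-1) ^ i * ((of_int (t + int N + 1 - int i) + real i - 1) gchoose i)"
      by (rule gbinomial_minus)
    moreover have "(- (of_int (t + int N + 1 - int i)) :: real) = of_int (- t + (int i - int N - 1))"
      "(of_int (t + int N + 1 - int i) + real i - 1 :: real) = of_int (t + int N)" by simp_all
    ultimately show ?thesis by (simp only: binc_def)
  qed
  have sgn: "(-1) ^ N * ((-1) ^ N * x) = (x :: real)" for x by (simp flip: mult.assoc power_mult_distrib)
  have "(\<Sum>i\<le>N. refined N i * binc (t + (int i - int N - 1)) i) = (\<Sum>i\<le>N. ((-1) ^ (N + i) * refined N i) * binc (t + int N) i)" for t
  proof -
    have "last_count N t = (-1) ^ N * last_count N (- t)" unfolding last_count_parity sgn ..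
    also have "\<dots> = (\<Sum>i\<le>N. ((-1) ^ (N + i) * refined N i) * binc (t + int N) i)"
      unfolding last_count_expansion_int[of N "- t"] sum_distrib_left neg
      by (intro sum.cong refl) (simp only: power_add mult_ac)
    finally show ?thesis unfolding last_count_expansion_int .
  qed
  then have "(fdiff ^^ k') (\<lambda>t. \<Sum>i\<le>N. refined N i * binc (t + (int i - int N - 1)) i) (int k)
      = (fdiff ^^ k') (\<lambda>t. \<Sum>i\<le>N. ((-1) ^ (N + i) * refined N i) * binc (t + int N) i) (int k)"
    by simp
  then have main: "(\<Sum>i\<le>N. refined N i * (if i < k' then 0 else binc (int k + (int i - int N - 1)) (i - k')))
     = (\<Sum>i\<le>N. ((-1) ^ (N + i) * refined N i) * (if i < k' then 0 else binc (int k + int N) (i - k')))"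
    unfolding fdiff_power_sum fdiff_power_binc .
  \<comment> \<open>For \<open>k' < i\<close> the upper entry is \<open>i - k' - 1\<close>, one less
    than the lower entry, so the binomial vanishes.\<close>
  have bin: "(if i < k' then 0 else binc (int k + (int i - int N - 1)) (i - k')) = of_bool (i = k')" if "i \<le> N" for i
  proof -
    consider "i < k'" | "i = k'" | "k' < i" by linarith
    then show ?thesis
    proof cases
      case 3
      have "int k + (int i - int N - 1) = int (i - k' - 1)" using 3 assms by (simp add: k'_def)
      then have "binc (int k + (int i - int N - 1)) (i - k') = real ((i - k' - 1) choose (i - k'))"
        by (simp only: binc_def of_int_of_nat_eq binomial_gbinomial)
      then show ?thesis using 3 by (simp add: binomial_eq_0)
    qed auto
  qed
  have "(\<Sum>i\<le>N. refined N i * (if i < k' then 0 else binc (int k + (int i - int N - 1)) (i - k')))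
     = (\<Sum>i\<le>N. refined N i * of_bool (i = k'))"
    by (intro sum.cong refl arg_cong2[of _ _ _ _ "(*)"]) (rule bin, simp)
  also have "\<dots> = refined N k'" by (simp add: k'_def of_bool_def if_distrib[of "\<lambda>x. _ * x"] cong: if_cong)
  also have "\<dots> = refined N k" unfolding k'_def by (rule refined_sym[OF assms])
  finally have "refined N k = (\<Sum>i\<le>N. ((-1) ^ (N + i) * refined N i) * (if i < k' then 0 else binc (int k + int N) (i - k')))"
    using main by simp
  also have "\<dots> = (\<Sum>i\<in>{k'..N}. (-1) ^ (N + i) * refined N i * binc (int k + int N) (i - k'))"
    by (rule sum.mono_neutral_cong_right) auto
  also have "\<dots> = (\<Sum>j\<le>k. (-1) ^ j * refined N j * real ((N + k) choose (k - j)))"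
  proof (rule sum.reindex_bij_witness[of _ "\<lambda>j. N - j" "\<lambda>i. N - i"])
    fix i assume i: "i \<in> {k'..N}"
    have "N + i = (N - i) + 2 * i" using i by simp
    then have "(-1 :: real) ^ (N + i) = (-1) ^ (N - i) * (-1) ^ (2 * i)" by (simp only: power_add)
    then have "(-1 :: real) ^ (N + i) = (-1) ^ (N - i)" by simp
    moreover have "binc (int k + int N) (i - k') = real ((N + k) choose (i - k'))"
      by (simp add: binc_def binomial_gbinomial add.commute)
    moreover have "k - (N - i) = i - k'" using i assms by (auto simp: k'_def)
    moreover have "refined N (N - i) = refined N i" using i by (intro refined_sym) auto
    ultimately show "(-1) ^ (N - i) * refined N (N - i) * real ((N + k) choose (k - (N - i)))
       = (-1) ^ (N + i) * refined N i * binc (int k + int N) (i - k')" by simp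
  qed (use assms in \<open>auto simp: k'_def\<close>)
  finally show ?thesis .
qed

section \<open>Uniqueness of the refined numbers\<close>

text \<open>As in proofs of Descartes' rule, \<open>x * p' - e * p\<close> loses the term of degree
  \<open>e\<close> while the order of the zero at 1 drops by at most one.\<close>

lemma sparse_poly_eq_0:
  fixes p :: "real poly"
  assumes "[:-1, 1:] ^ s dvd p" "card {i. coeff p i \<noteq> 0} \<le> s"
  shows "p = 0"
  using assms
proof (induction s arbitrary: p)
  case 0
  have "finite {i. coeff p i \<noteq> 0}" by (rule finite_subset[of _ "{..degree p}"]) (auto simp: le_degree)
  then have "{i. coeff p i \<noteq> 0} = {}" using 0 by simp
  then show ?case by (intro poly_eqI) auto
next
  case (Suc s)
  let ?E = "\<lambda>p :: real poly. {i. coeff p i \<noteq> 0}"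
  have fin: "finite (?E p)" by (rule finite_subset[of _ "{..degree p}"]) (auto simp: le_degree)
  show ?case
  proof (cases "p = 0")
    case False
    then obtain e where e: "e \<in> ?E p" using leading_coeff_neq_0 by blast
    define q where "q = [:0, 1:] * pderiv p - Polynomial.smult (of_nat e) p"
    have q: "coeff q i = (of_nat i - of_nat e) * coeff p i" for i
      by (cases i) (simp_all add: q_def coeff_pderiv algebra_simps)
    obtain r where r: "p = [:-1, 1:] ^ Suc s * r" using Suc.prems(1) by (auto elim: dvdE)
    have "[:-1, 1:] ^ s dvd pderiv p"
      unfolding r pderiv_mult pderiv_power_Suc
      by (intro dvd_add dvd_mult2[OF le_imp_power_dvd] dvd_mult[OF dvd_mult2[OF dvd_smult]] dvd_refl) simp
    moreover have "[:-1, 1:] ^ s dvd p" using r by (metis dvd_triv_left dvd_mult_left power_Suc2)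
    ultimately have "[:-1, 1:] ^ s dvd q"
      unfolding q_def by (intro dvd_diff dvd_mult dvd_smult)
    moreover have "card (?E q) \<le> s"
    proof -
      have "?E q \<subseteq> ?E p - {e}" by (auto simp: q)
      then have "card (?E q) \<le> card (?E p - {e})" using fin by (intro card_mono) auto
      then show ?thesis using Suc.prems(2) e fin by simp
    qed
    ultimately have "q = 0" by (rule Suc.IH)
    then have "coeff p i = 0" if "i \<noteq> e" for i using q[of i] that by simp
    then have "p = monom (coeff p e) e" by (intro poly_eqI) auto
    then have "poly p 1 = coeff p e" by (metis poly_monom power_one mult.right_neutral)
    moreover have "poly p 1 = 0" by (simp add: r)
    ultimately show ?thesis using e by simp
  qed
qed

text \<open>The reversal \<open>x ^ d * p (1 / x)\<close>, with a prescribed weight \<open>d\<close>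
  in place of the degree of \<open>p\<close>.\<close>

definition reflect :: "nat \<Rightarrow> real poly \<Rightarrow> real poly" where
  "reflect d p = (\<Sum>i\<le>d. monom (coeff p i) (d - i))"

lemma coeff_reflect: "i \<le> d \<Longrightarrow> coeff (reflect d p) i = coeff p (d - i)"
proof -
  assume i: "i \<le> d"
  have "coeff (reflect d p) i = (\<Sum>j\<in>{d - i}. coeff (monom (coeff p j) (d - j)) i)"
    unfolding reflect_def coeff_sum using i by (intro sum.mono_neutral_right) auto
  then show ?thesis using i by simp
qed

lemma poly_reflect:
  assumes "degree p \<le> d" "w \<noteq> 0"
  shows "poly (reflect d p) w = w ^ d * poly p (1 / w)"
proof -
  have "poly p (1 / w) = (\<Sum>i\<le>d. coeff p i * (1 / w) ^ i)"
    unfolding poly_altdef using assms(1)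
    by (intro sum.mono_neutral_left) (auto simp: coeff_eq_0)
  then show ?thesis
    using assms(2) by (simp add: reflect_def poly_sum poly_monom sum_distrib_left power_diff field_simps)
qed

lemma poly_eqI_nonzero:
  fixes p q :: "real poly"
  assumes "\<And>w. w \<noteq> 0 \<Longrightarrow> poly p w = poly q w"
  shows "p = q"
proof (rule poly_eqI_degree[of "real ` {1..Suc (max (degree p) (degree q))}"])
  have "card (real ` {1..Suc (max (degree p) (degree q))}) = Suc (max (degree p) (degree q))"
    by (simp add: card_image)
  then show "degree p < card (real ` {1..Suc (max (degree p) (degree q))})"
    "degree q < card (real ` {1..Suc (max (degree p) (degree q))})" by simp_all
qed (use assms in auto)

lemma coeff_0_dvd: "(\<And>i. i < s \<Longrightarrow> coeff p i = 0) \<Longrightarrow> [:0, 1:] ^ s dvd p" for p :: "real poly"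
proof (induction s arbitrary: p)
  case (Suc s)
  then have "poly p 0 = 0" by (simp add: poly_0_coeff_0)
  then obtain q where q: "p = [:0, 1:] * q" by (auto simp: poly_eq_0_iff_dvd elim: dvdE)
  have "[:0, 1:] ^ s dvd q"
  proof (rule Suc.IH)
    fix i assume "i < s"
    then show "coeff q i = 0" using Suc.prems[of "Suc i"] by (simp add: q)
  qed
  then show ?case unfolding q power_Suc by (rule mult_dvd_mono[OF dvd_refl])
qed simp

lemma dvd_pcompose: "p dvd q \<Longrightarrow> pcompose p r dvd pcompose q r"
  by (auto elim!: dvdE simp: pcompose_mult)

lemma pcompose_power: "pcompose (p ^ k) r = pcompose p r ^ k" for p r :: "real poly"
  by (induction k) (simp_all add: pcompose_mult one_pCons pcompose_pCons)

text \<open>As generating functions, \<open>rel\<close> says that \<open>A\<close> agrees with the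
  sum of \<open>(-1) ^ j * a j * w ^ j / (1 - w) ^ (N + j + 1)\<close> modulo
  \<open>w ^ (N + 1)\<close>. Multiplying by \<open>(1 - w) ^ (2 * N + 1)\<close> turns this into a
  congruence between \<open>P\<close> and \<open>B\<close>.\<close>

lemma refined_unique:
  fixes a :: "nat \<Rightarrow> real"
  assumes sym: "\<And>i. i \<le> N \<Longrightarrow> a (N - i) = a i"
    and rel: "\<And>k. k \<le> N \<Longrightarrow> a k = (\<Sum>j\<le>k. (-1) ^ j * a j * real ((N + k) choose (k - j)))"
    and a0: "a 0 = 0"
    and "i \<le> N"
  shows "a i = 0"
proof -
  let ?l = "[:1, -1:] :: real poly"
  let ?x = "[:0, 1:] :: real poly"
  define A where "A = (\<Sum>i\<le>N. monom (a i) i)"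
  define B where "B = (\<Sum>j\<le>N. Polynomial.smult ((-1) ^ j * a j) (?x ^ j * ?l ^ (N - j)))"
  \<comment> \<open>\<open>C\<close> is the reversal \<open>w ^ N * B (1 / w)\<close> of
    \<open>B\<close>.\<close>
  define C where "C = (\<Sum>j\<le>N. Polynomial.smult ((-1) ^ j * a j) ([:-1, 1:] ^ (N - j)))"
  define P where "P = ?l ^ (2 * N + 1) * A"
  \<comment> \<open>\<open>m\<close> is the signed sum of \<open>P\<close> over the group of order 6 generated by \<open>w \<mapsto> 1 / w\<close> and \<open>w \<mapsto> 1 - w\<close>,
    which permutes \<open>0, 1, \<infinity>\<close>. The relation makes \<open>m\<close> vanish to order \<open>N + 1\<close> at \<open>0\<close>, hence also at
    \<open>1\<close> and \<open>\<infinity>\<close>; its weight is only \<open>3 * N + 1\<close>, so \<open>m = 0\<close>. Then \<open>P\<close> has at most \<open>2 * N + 1\<close> terms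
    but a zero of order \<open>2 * N + 1\<close> at \<open>1\<close>.\<close>
  define m where "m = P - B + ?x ^ (2 * N + 1) * C"
  have pA: "poly A w = (\<Sum>i\<le>N. a i * w ^ i)" for w
    by (simp add: A_def poly_sum poly_monom)
  have pB: "poly B w = (\<Sum>j\<le>N. (-1) ^ j * a j * (w ^ j * (1 - w) ^ (N - j)))" for w
    by (simp add: B_def poly_sum)
  have pC: "poly C w = (\<Sum>j\<le>N. (-1) ^ j * a j * (w - 1) ^ (N - j))" for w
    by (simp add: C_def poly_sum)
  have "poly ?l w = 1 - w" for w by simp
  then have pP: "poly P w = (1 - w) ^ (2 * N + 1) * poly A w" for w
    by (simp only: P_def poly_mult poly_power)
  have flip: "(\<Sum>j\<le>N. h j) = (\<Sum>j\<le>N. h (N - j))" for h :: "nat \<Rightarrow> real"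
    by (rule sum.reindex_bij_witness[of _ "\<lambda>j. N - j" "\<lambda>j. N - j"]) auto
  have coeffA: "coeff A i = a i" if "i \<le> N" for i
    using that by (simp add: A_def coeff_sum)
  have degA: "degree A \<le> N"
    unfolding A_def by (intro degree_sum_le) (auto intro: order.trans[OF degree_monom_le])
  have degB: "degree B \<le> N"
    unfolding B_def
  proof (intro degree_sum_le)
    fix j assume "j \<in> {..N}"
    have "degree (?x ^ j * ?l ^ (N - j)) \<le> 1 * j + 1 * (N - j)"
      by (intro order.trans[OF degree_mult_le] add_mono order.trans[OF degree_power_le]) auto
    then show "degree (Polynomial.smult ((-1) ^ j * a j) (?x ^ j * ?l ^ (N - j))) \<le> N"
      using \<open>j \<in> {..N}\<close> by (intro order.trans[OF degree_smult_le]) auto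
  qed simp
  have degC: "degree C \<le> N"
    unfolding C_def
  proof (intro degree_sum_le)
    fix j assume "j \<in> {..N}"
    have "degree ([:-1, 1:] ^ (N - j) :: real poly) \<le> 1 * (N - j)"
      by (intro order.trans[OF degree_power_le]) auto
    then show "degree (Polynomial.smult ((-1) ^ j * a j) ([:-1, 1:] ^ (N - j))) \<le> N"
      by (intro order.trans[OF degree_smult_le]) auto
  qed simp
  have degP: "degree P \<le> 3 * N + 1"
  proof -
    have "degree P \<le> 1 * (2 * N + 1) + N"
      unfolding P_def by (intro order.trans[OF degree_mult_le] add_mono degA order.trans[OF degree_power_le]) auto
    then show ?thesis by simp
  qed
  have low: "?x ^ (N + 1) dvd P - B"
  proof (rule coeff_0_dvd)
    fix k assume k: "k < N + 1"
    \<comment> \<open>\<open>G j\<close> is the power series of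
      \<open>1 / (1 - w) ^ (N + j + 1)\<close>.\<close>
    define G where "G j = Abs_fps (\<lambda>k. real ((N + j + k) choose k))" for j
    have G: "G j * (1 - fps_X) ^ (N + j + 1) = 1" for j
    proof -
      have "inverse ((1 - fps_const 1 * fps_X) ^ (N + j + 1)) = G j"
        by (subst one_minus_const_fps_X_neg_power') (simp_all add: G_def)
      then have "G j = inverse ((1 - fps_X) ^ (N + j + 1))" by simp
      moreover have "fps_nth ((1 - fps_X :: real fps) ^ (N + j + 1)) 0 \<noteq> 0" by (simp add: fps_power_zeroth)
      ultimately show ?thesis by (metis inverse_mult_eq_1)
    qed
    have fl: "fps_of_poly ?l = 1 - fps_X" and fx: "fps_of_poly ?x = fps_X"
      by (auto intro!: fps_ext simp: fps_of_poly_nth coeff_pCons fps_X_def split: nat.splits)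
    define D where "D = fps_of_poly A - (\<Sum>j\<le>N. fps_const ((-1) ^ j * a j) * (fps_X ^ j * G j))"
    have Dlow: "fps_nth D k = 0" if "k \<le> N" for k
    proof -
      have "(\<Sum>j\<le>N. (-1) ^ j * a j * fps_nth (fps_X ^ j * G j) k)
         = (\<Sum>j\<le>k. (-1) ^ j * a j * real ((N + k) choose (k - j)))"
        using that by (intro sum.mono_neutral_cong_right) (auto simp: fps_X_power_mult_nth G_def)
      then show ?thesis
        using rel[OF that] by (simp add: D_def fps_sum_nth coeffA[OF that] mult.assoc)
    qed
    have "(1 - fps_X) ^ (2 * N + 1) * (fps_X ^ j * G j) = fps_X ^ j * (1 - fps_X) ^ (N - j)" if "j \<le> N" for j
    proof -
      have "2 * N + 1 = (N - j) + (N + j + 1)" using that by simp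
      then have "(1 - fps_X :: real fps) ^ (2 * N + 1) = (1 - fps_X) ^ (N - j) * (1 - fps_X) ^ (N + j + 1)"
        by (simp only: power_add)
      then have "(1 - fps_X) ^ (2 * N + 1) * (fps_X ^ j * G j)
          = fps_X ^ j * (1 - fps_X) ^ (N - j) * (G j * (1 - fps_X) ^ (N + j + 1))"
        by (simp only: mult_ac)
      then show ?thesis by (simp only: G mult_1_right)
    qed
    then have "(1 - fps_X) ^ (2 * N + 1) * D
       = fps_of_poly P - (\<Sum>j\<le>N. fps_const ((-1) ^ j * a j) * (fps_X ^ j * (1 - fps_X) ^ (N - j)))"
      unfolding D_def right_diff_distrib sum_distrib_left
      by (intro arg_cong2[of _ _ _ _ "(-)"] sum.cong refl)
         (simp_all add: P_def fps_of_poly_mult fps_of_poly_power fl fx mult.left_commute)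
    also have "(\<Sum>j\<le>N. fps_const ((-1) ^ j * a j) * (fps_X ^ j * (1 - fps_X) ^ (N - j))) = fps_of_poly B"
      by (simp add: B_def fps_of_poly_sum fps_of_poly_smult fps_of_poly_mult fps_of_poly_power fl fx)
    finally have "fps_of_poly (P - B) = (1 - fps_X) ^ (2 * N + 1) * D" by (simp add: fps_of_poly_diff)
    then have "coeff (P - B) k = fps_nth ((1 - fps_X) ^ (2 * N + 1) * D) k"
      by (metis fps_of_poly_nth)
    also have "\<dots> = 0"
      unfolding fps_mult_nth using k by (intro sum.neutral) (auto simp: Dlow)
    finally show "coeff (P - B) k = 0" .
  qed
  have m_low: "?x ^ (N + 1) dvd m"
    unfolding m_def by (intro dvd_add[OF low] dvd_mult2 le_imp_power_dvd) simp
  have C_B: "w ^ N * poly B (1 / w) = poly C w" if "w \<noteq> 0" for w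
  proof -
    have K: "w ^ N * ((1 / w) ^ j * (1 - 1 / w) ^ (N - j)) = (w - 1) ^ (N - j)" if "j \<le> N" for j
    proof -
      have "w ^ N = w ^ j * w ^ (N - j)" using that by (simp flip: power_add)
      then have "w ^ N * ((1 / w) ^ j * (1 - 1 / w) ^ (N - j)) = (w * (1 / w)) ^ j * (w * (1 - 1 / w)) ^ (N - j)"
        by (simp only: power_mult_distrib mult_ac)
      also have "w * (1 - 1 / w) = w - 1" using \<open>w \<noteq> 0\<close> by (simp add: field_simps)
      finally show ?thesis using \<open>w \<noteq> 0\<close> by simp
    qed
    then have "w ^ N * ((-1) ^ j * a j * ((1 / w) ^ j * (1 - 1 / w) ^ (N - j))) = (-1) ^ j * a j * (w - 1) ^ (N - j)"
      if "j \<le> N" for j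
      using that by (simp only: mult.left_commute[of "w ^ N" "(-1) ^ j * a j"])
    then show ?thesis
      unfolding pB pC sum_distrib_left by (intro sum.cong refl) simp
  qed
  \<comment> \<open>Reversal in weight \<open>3 * N + 1\<close> exchanges \<open>B\<close> with
    \<open>?x ^ (2 * N + 1) * C\<close>. It negates \<open>P\<close>, because \<open>A\<close> is
    its own reversal and \<open>1 - w\<close> occurs to an odd power.\<close>
  have m_reflect: "reflect (3 * N + 1) m = - m"
  proof (rule poly_eqI_nonzero)
    fix w :: real assume w: "w \<noteq> 0"
    have "degree m \<le> 3 * N + 1"
    proof -
      have "degree (?x ^ (2 * N + 1) * C) \<le> 1 * (2 * N + 1) + N"
        by (intro order.trans[OF degree_mult_le] add_mono degC order.trans[OF degree_power_le]) auto
      then show ?thesis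
        unfolding m_def using degP degB by (intro degree_add_le degree_diff_le) auto
    qed
    then have "poly (reflect (3 * N + 1) m) w = w ^ (3 * N + 1) * poly m (1 / w)"
      using w by (rule poly_reflect)
    also have "w ^ (3 * N + 1) = w ^ (2 * N + 1) * w ^ N" by (simp flip: power_add)
    also have "w ^ (2 * N + 1) * w ^ N * poly m (1 / w)
       = w ^ (2 * N + 1) * (w ^ N * poly P (1 / w)) - w ^ (2 * N + 1) * (w ^ N * poly B (1 / w))
         + (w * (1 / w)) ^ (2 * N + 1) * (w ^ N * poly C (1 / w))"
      unfolding power_mult_distrib[of w "1 / w"] by (simp add: m_def algebra_simps)
    also have "w ^ N * poly B (1 / w) = poly C w" by (rule C_B[OF w])
    also have "w ^ N * poly C (1 / w) = poly B w"
      using C_B[of "1 / w"] w by (simp add: field_simps)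
    also have "w ^ (2 * N + 1) * (w ^ N * poly P (1 / w)) = - poly P w"
    proof -
      have "w ^ N * poly A (1 / w) = (\<Sum>i\<le>N. a i * (w ^ N * (1 / w) ^ i))"
        unfolding pA sum_distrib_left by (intro sum.cong refl) (simp only: mult_ac)
      also have "\<dots> = (\<Sum>i\<le>N. a (N - i) * w ^ (N - i))"
        using w by (intro sum.cong refl) (simp add: sym power_diff field_simps)
      also have "\<dots> = poly A w" unfolding pA by (rule flip[symmetric])
      finally have A: "w ^ N * poly A (1 / w) = poly A w" .
      have "w ^ (2 * N + 1) * (w ^ N * poly P (1 / w))
          = (w * (1 - 1 / w)) ^ (2 * N + 1) * (w ^ N * poly A (1 / w))"
      proof -
        show ?thesis unfolding pP power_mult_distrib[of w "1 - 1 / w"] by (simp only: mult_ac)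
      qed
      also have "w * (1 - 1 / w) = - (1 - w)" using w by (simp add: field_simps)
      also have "(- (1 - w)) ^ (2 * N + 1) = - ((1 - w) ^ (2 * N + 1))"
        by (rule power_minus_odd) simp
      finally show ?thesis unfolding A pP by simp
    qed
    finally show "poly (reflect (3 * N + 1) m) w = poly (- m) w"
      using w by (simp add: m_def)
  qed
  \<comment> \<open>By \<open>m_reflect\<close> the zero of order \<open>N + 1\<close> at 0 also
    removes the top \<open>N + 1\<close> coefficients.\<close>
  have deg_m: "degree m \<le> 2 * N"
  proof (rule degree_le, intro allI impI)
    fix i assume i: "2 * N < i"
    show "coeff m i = 0"
    proof (cases "i \<le> 3 * N + 1")
      case True
      have "coeff m (3 * N + 1 - i) = 0"
      proof -
        obtain r where "m = ?x ^ (N + 1) * r" using m_low by (auto elim: dvdE)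
        then have "m = monom 1 (N + 1) * r" by (simp only: monom_altdef) simp
        then show ?thesis using i by (simp add: coeff_monom_mult)
      qed
      then show ?thesis
        using arg_cong[OF m_reflect, of "\<lambda>p. coeff p i"] coeff_reflect[OF True, of m] by simp
    next
      case False
      have "degree m \<le> 3 * N + 1"
      proof -
        have "degree (?x ^ (2 * N + 1) * C) \<le> 1 * (2 * N + 1) + N"
          by (intro order.trans[OF degree_mult_le] add_mono degC order.trans[OF degree_power_le]) auto
        then show ?thesis
          unfolding m_def using degP degB by (intro degree_add_le degree_diff_le) auto
      qed
      then show ?thesis using False by (intro coeff_eq_0) simp
    qed
  qed
  have m_high: "?l ^ (N + 1) dvd m"
  proof -
    \<comment> \<open>Replacing \<open>w\<close> by \<open>1 - w\<close> fixes \<open>B\<close> and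
      sends \<open>C\<close> to \<open>A\<close>, both up to \<open>(-1) ^ N\<close>. So
      \<open>B - ?x ^ (2 * N + 1) * C\<close> becomes a multiple of \<open>P - B\<close>, and the
      zero at 0 moves to 1.\<close>
    have B1: "poly B (1 - w) = (-1) ^ N * poly B w" for w
    proof -
      have "poly B (1 - w) = (\<Sum>j\<le>N. (-1) ^ (N - j) * a (N - j) * ((1 - w) ^ (N - j) * w ^ (N - (N - j))))"
        unfolding pB by (subst flip) simp
      also have "\<dots> = (\<Sum>j\<le>N. (-1) ^ N * ((-1) ^ j * a j * (w ^ j * (1 - w) ^ (N - j))))"
      proof (intro sum.cong refl)
        fix j assume j: "j \<in> {..N}"
        have "N = (N - j) + j" using j by simp
        then have "(-1 :: real) ^ N = (-1) ^ (N - j) * (-1) ^ j" by (metis power_add)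
        then have "(-1 :: real) ^ (N - j) = (-1) ^ N * (-1) ^ j" by (simp flip: power_mult_distrib)
        then show "(-1) ^ (N - j) * a (N - j) * ((1 - w) ^ (N - j) * w ^ (N - (N - j)))
          = (-1) ^ N * ((-1) ^ j * a j * (w ^ j * (1 - w) ^ (N - j)))"
          using j by (simp add: sym)
      qed
      finally show ?thesis by (simp add: pB sum_distrib_left)
    qed
    have C1: "poly C (1 - w) = (-1) ^ N * poly A w" for w
    proof -
      have "poly C (1 - w) = (\<Sum>j\<le>N. (-1) ^ j * a j * (- w) ^ (N - j))" unfolding pC by simp
      also have "\<dots> = (\<Sum>j\<le>N. (-1) ^ N * (a (N - j) * w ^ (N - j)))"
      proof (intro sum.cong refl)
        fix j assume j: "j \<in> {..N}"
        have "N = j + (N - j)" using j by simp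
        then have "(-1 :: real) ^ N = (-1) ^ j * (-1) ^ (N - j)" by (metis power_add)
        then show "(-1) ^ j * a j * (- w) ^ (N - j) = (-1) ^ N * (a (N - j) * w ^ (N - j))"
          using j by (simp add: sym power_minus[of w])
      qed
      also have "\<dots> = (-1) ^ N * poly A w"
        unfolding pA flip[of "\<lambda>j. a j * w ^ j"] by (simp add: sum_distrib_left)
      finally show ?thesis .
    qed
    have comp: "pcompose (B - ?x ^ (2 * N + 1) * C) ?l = Polynomial.smult (- ((-1) ^ N)) (P - B)"
      by (rule poly_eqI_nonzero) (simp add: poly_pcompose B1 C1 pP algebra_simps)
    have "?x ^ (N + 1) dvd Polynomial.smult (- ((-1) ^ N)) (P - B)" by (rule dvd_smult[OF low])
    then have "?x ^ (N + 1) dvd pcompose (B - ?x ^ (2 * N + 1) * C) ?l" unfolding comp .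
    then have "pcompose (?x ^ (N + 1)) ?l dvd pcompose (pcompose (B - ?x ^ (2 * N + 1) * C) ?l) ?l"
      by (rule dvd_pcompose)
    moreover have "pcompose (pcompose p ?l) ?l = p" for p
      by (rule poly_eqI_nonzero) (simp add: poly_pcompose)
    moreover have "pcompose (?x ^ (N + 1)) ?l = ?l ^ (N + 1)"
      unfolding pcompose_power by (simp add: pcompose_pCons)
    ultimately have 1: "?l ^ (N + 1) dvd B - ?x ^ (2 * N + 1) * C" by simp
    have "?l ^ (N + 1) dvd P"
      unfolding P_def by (intro dvd_mult2 le_imp_power_dvd) simp
    from dvd_diff[OF this 1] show ?thesis by (simp add: m_def algebra_simps)
  qed
  have l_dvd: "[:- 1, 1:] ^ k dvd ?l ^ k" for k
  proof (rule dvd_power_same)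
    have "?l = [:- 1, 1:] * [:- 1:]" by simp
    then show "[:- 1, 1:] dvd ?l" by (rule dvdI)
  qed
  \<comment> \<open>Zeros of order \<open>N + 1\<close> at both 0 and 1 would need degree
    \<open>2 * N + 2\<close>.\<close>
  have "m = 0"
  proof (rule ccontr)
    assume "m \<noteq> 0"
    obtain r where r: "m = ?x ^ (N + 1) * r" using m_low by (rule dvdE)
    then have "r \<noteq> 0" "degree m = N + 1 + degree r"
      using \<open>m \<noteq> 0\<close> by (auto simp: degree_mult_eq degree_power_eq simp del: power_Suc)
    have "[:- 1, 1:] ^ (N + 1) dvd m" by (rule dvd_trans[OF l_dvd m_high])
    then have "N + 1 \<le> order 1 m" using \<open>m \<noteq> 0\<close> by (simp only: order_divides simp_thms)
    also have "order 1 m = order 1 (?x ^ (N + 1)) + order 1 r"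
      using \<open>m \<noteq> 0\<close> unfolding r by (rule order_mult)
    also have "order 1 (?x ^ (N + 1)) = 0" by (rule order_0I) simp
    also have "order 1 r \<le> degree r" by (rule order_degree[OF \<open>r \<noteq> 0\<close>])
    finally show False using deg_m \<open>degree m = N + 1 + degree r\<close> by simp
  qed
  then have P: "P = B - ?x ^ (2 * N + 1) * C" by (simp add: m_def)
  have "P = 0"
  proof (rule sparse_poly_eq_0)
    show "[:- 1, 1:] ^ (2 * N + 1) dvd P"
      unfolding P_def by (rule dvd_mult2[OF l_dvd])
    have coeffP: "coeff P k = coeff B k - (if k < 2 * N + 1 then 0 else coeff C (k - (2 * N + 1)))" for k
    proof -
      have "?x ^ (2 * N + 1) = monom 1 (2 * N + 1)" by (simp add: monom_altdef)
      then show ?thesis unfolding P by (simp add: coeff_monom_mult)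
    qed
    \<comment> \<open>Here \<open>a 0 = 0\<close> enters: it lowers the possible number of terms of
      \<open>P\<close> from \<open>2 * N + 2\<close> to \<open>2 * N + 1\<close>, the order of its
      zero at 1.\<close>
    have B0: "coeff B 0 = 0"
      using pB[of 0] a0 by (simp add: poly_0_coeff_0[symmetric] sum.neutral power_0_left)
    have "{k. coeff P k \<noteq> 0} \<subseteq> {1..N} \<union> {2 * N + 1..3 * N + 1}"
    proof
      fix k assume "k \<in> {k. coeff P k \<noteq> 0}"
      then have "coeff B k \<noteq> 0 \<or> (2 * N + 1 \<le> k \<and> coeff C (k - (2 * N + 1)) \<noteq> 0)"
        by (auto simp: coeffP split: if_splits)
      then show "k \<in> {1..N} \<union> {2 * N + 1..3 * N + 1}"
      proof
        assume "coeff B k \<noteq> 0"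
        then have "k \<le> N" "k \<noteq> 0" using degB B0 le_degree[of B k] by (linarith, metis)
        then show ?thesis by simp
      next
        assume k: "2 * N + 1 \<le> k \<and> coeff C (k - (2 * N + 1)) \<noteq> 0"
        then have "k - (2 * N + 1) \<le> N" using degC le_degree[of C "k - (2 * N + 1)"] by simp
        then show ?thesis using k by auto
      qed
    qed
    then have "card {k. coeff P k \<noteq> 0} \<le> card ({1..N} \<union> {2 * N + 1..3 * N + 1})"
      by (intro card_mono) auto
    also have "\<dots> \<le> card {1..N} + card {2 * N + 1..3 * N + 1}" by (rule card_Un_le)
    finally show "card {k. coeff P k \<noteq> 0} \<le> 2 * N + 1" by simp
  qed
  moreover have "?l ^ (2 * N + 1) \<noteq> 0" by (rule power_not_zero) simp
  ultimately have "A = 0" unfolding P_def by (simp only: mult_eq_0_iff simp_thms)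
  then show ?thesis using coeffA[OF \<open>i \<le> N\<close>] by simp
qed

section \<open>Evaluation\<close>

text \<open>Counts the subsets of size \<open>p + q + 1\<close> by the position of their element
  number \<open>p + 1\<close>.\<close>

lemma sum_choose_convolution:
  "(\<Sum>i\<le>L. (i choose p) * ((L - i) choose q)) = (L + 1) choose (p + q + 1)"
proof (induction L arbitrary: q)
  case 0
  then show ?case by (cases p; cases q) auto
next
  case (Suc L)
  show ?case
  proof (cases q)
    case 0
    then show ?thesis using sum_choose_upper[of p "Suc L"] by simp
  next
    case (Suc q')
    have "(\<Sum>i\<le>Suc L. (i choose p) * ((Suc L - i) choose q)) = (\<Sum>i\<le>L. (i choose p) * ((Suc L - i) choose q))"
      by (simp add: Suc)
    also have "\<dots> = (\<Sum>i\<le>L. (i choose p) * ((L - i) choose q') + (i choose p) * ((L - i) choose q))"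
      by (intro sum.cong refl) (simp add: Suc Suc_diff_le algebra_simps)
    also have "\<dots> = (Suc L + 1) choose (p + q + 1)"
      by (simp add: sum.distrib Suc.IH) (simp add: Suc)
    finally show ?thesis .
  qed
qed

text \<open>Take \<open>L = 3 * N\<close> with lower entries \<open>N + k\<close> and
  \<open>N\<close>; one factor vanishes unless the index lies between \<open>N\<close> and
  \<open>2 * N\<close>.\<close>

lemma shifted_convolution:
  "(\<Sum>i\<le>N. ((N + i) choose (N + k)) * ((2 * N - i) choose N)) = (3 * N + 1) choose (2 * N + k + 1)"
proof -
  have "(3 * N + 1) choose (2 * N + k + 1) = (\<Sum>i\<le>3 * N. (i choose (N + k)) * ((3 * N - i) choose N))"
  proof -
    have "2 * N + k + 1 = N + k + N + 1" by simp
    then show ?thesis by (simp only: sum_choose_convolution)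
  qed
  also have "\<dots> = (\<Sum>i\<in>{N..2 * N}. (i choose (N + k)) * ((3 * N - i) choose N))"
    by (rule sum.mono_neutral_right) (auto simp: not_le)
  also have "\<dots> = (\<Sum>i\<le>N. ((N + i) choose (N + k)) * ((2 * N - i) choose N))"
    by (rule sum.reindex_bij_witness[of _ "\<lambda>i. N + i" "\<lambda>i. i - N"]) auto
  finally show ?thesis ..
qed

text \<open>A \<open>p\<close>-fold difference in the upper entry, each difference lowering the
  lower entry by one.\<close>

lemma alternating_choose_sum:
  "(\<Sum>s\<le>p. (-1) ^ s * real (p choose s) * real ((m + p - s) choose (k + p))) = real (m choose k)"
proof (induction p)
  case (Suc p)
  let ?c = "\<lambda>s. (-1) ^ s * real (p choose s)"
  have "(\<Sum>s\<le>Suc p. (-1) ^ s * real (Suc p choose s) * real ((m + Suc p - s) choose (k + Suc p)))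
      = real ((m + Suc p) choose (k + Suc p))
        + (\<Sum>s\<le>p. (-1) ^ Suc s * (real (p choose s) + real (p choose Suc s)) * real ((m + p - s) choose (k + Suc p)))"
    by (subst sum.atMost_Suc_shift) simp
  also have "\<dots> = (real ((m + Suc p) choose (k + Suc p))
        + (\<Sum>s\<le>p. (-1) ^ Suc s * real (p choose Suc s) * real ((m + Suc p - Suc s) choose (k + Suc p))))
        - (\<Sum>s\<le>p. ?c s * real ((m + p - s) choose (k + Suc p)))"
    by (simp add: algebra_simps sum.distrib sum_negf sum_subtractf)
  also have "real ((m + Suc p) choose (k + Suc p))
        + (\<Sum>s\<le>p. (-1) ^ Suc s * real (p choose Suc s) * real ((m + Suc p - Suc s) choose (k + Suc p)))
      = (\<Sum>s\<le>Suc p. ?c s * real ((m + Suc p - s) choose (k + Suc p)))"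
    by (subst sum.atMost_Suc_shift) simp
  also have "\<dots> = (\<Sum>s\<le>p. ?c s * real ((m + Suc p - s) choose (k + Suc p)))" by simp
  also have "\<dots> - (\<Sum>s\<le>p. ?c s * real ((m + p - s) choose (k + Suc p)))
      = (\<Sum>s\<le>p. ?c s * real ((m + p - s) choose (k + p)))"
    unfolding sum_subtractf[symmetric] by (intro sum.cong refl) (simp add: Suc_diff_le algebra_simps)
  finally show ?case unfolding Suc .
qed simp

text \<open>Up to a scalar, the product formula of the refined alternating sign matrix
  theorem.\<close>

definition refined_weight :: "nat \<Rightarrow> nat \<Rightarrow> real" where
  "refined_weight N i = real ((N + i) choose N) * real ((2 * N - i) choose N)"

lemma refined_weight_sym: "i \<le> N \<Longrightarrow> refined_weight N (N - i) = refined_weight N i"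
proof -
  assume "i \<le> N"
  then have "N + (N - i) = 2 * N - i" "2 * N - (N - i) = N + i" by simp_all
  then show ?thesis by (simp only: refined_weight_def mult.commute)
qed

text \<open>Trinomial revision pulls out \<open>(N + k) choose N\<close> and leaves coefficients
  \<open>k choose j\<close>; the rest is \<open>alternating_choose_sum\<close> with
  \<open>p = k\<close>, whence the padding \<open>- k + k\<close> in the proof.\<close>

lemma refined_weight_relation:
  assumes "k \<le> N"
  shows "refined_weight N k = (\<Sum>j\<le>k. (-1) ^ j * refined_weight N j * real ((N + k) choose (k - j)))"
proof -
  have prod: "real ((N + j) choose N) * real ((N + k) choose (k - j)) = real ((N + k) choose N) * real (k choose j)"
    if "j \<le> k" for j
  proof -
    have "((N + k) choose (N + j)) * ((N + j) choose N) = ((N + k) choose N) * ((N + k - N) choose (N + j - N))"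
      using that by (intro choose_mult) auto
    moreover have "(N + k) choose (N + j) = (N + k) choose (k - j)"
      using that binomial_symmetric[of "N + j" "N + k"] by simp
    ultimately have "((N + j) choose N) * ((N + k) choose (k - j)) = ((N + k) choose N) * (k choose j)"
      by (simp add: mult.commute)
    then show ?thesis by (simp flip: of_nat_mult)
  qed
  have "(\<Sum>j\<le>k. (-1) ^ j * refined_weight N j * real ((N + k) choose (k - j)))
      = (\<Sum>j\<le>k. (-1) ^ j * (real ((N + j) choose N) * real ((N + k) choose (k - j))) * real ((2 * N - j) choose N))"
    by (intro sum.cong refl) (simp add: refined_weight_def)
  also have "\<dots> = (\<Sum>j\<le>k. real ((N + k) choose N) * ((-1) ^ j * real (k choose j) * real ((2 * N - k + k - j) choose (N - k + k))))"
    using assms by (intro sum.cong refl) (simp add: prod)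
  also have "\<dots> = real ((N + k) choose N) * real ((2 * N - k) choose (N - k))"
    unfolding sum_distrib_left[symmetric] alternating_choose_sum ..
  also have "(2 * N - k) choose (N - k) = (2 * N - k) choose N"
    using assms binomial_symmetric[of N "2 * N - k"] by simp
  finally show ?thesis by (simp add: refined_weight_def)
qed

lemma refined_eq_weight:
  assumes "i \<le> N"
  shows "refined N i = refined N 0 / real ((2 * N) choose N) * refined_weight N i"
proof -
  let ?c = "refined N 0 / real ((2 * N) choose N)"
  have "refined N i - ?c * refined_weight N i = 0"
  proof (rule refined_unique[where N = N and a = "\<lambda>i. refined N i - ?c * refined_weight N i"])
    fix i assume "i \<le> N"
    then show "refined N (N - i) - ?c * refined_weight N (N - i) = refined N i - ?c * refined_weight N i"
      by (simp add: refined_sym refined_weight_sym)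
  next
    fix k assume "k \<le> N"
    have "refined N k - ?c * refined_weight N k
       = (\<Sum>j\<le>k. (-1) ^ j * refined N j * real ((N + k) choose (k - j)))
         - ?c * (\<Sum>j\<le>k. (-1) ^ j * refined_weight N j * real ((N + k) choose (k - j)))"
      using refined_relation[OF \<open>k \<le> N\<close>] refined_weight_relation[OF \<open>k \<le> N\<close>] by simp
    then show "refined N k - ?c * refined_weight N k
       = (\<Sum>j\<le>k. (-1) ^ j * (refined N j - ?c * refined_weight N j) * real ((N + k) choose (k - j)))"
      by (simp add: sum_distrib_left sum_subtractf[symmetric] algebra_simps)
  next
    show "refined N 0 - ?c * refined_weight N 0 = 0" by (simp add: refined_weight_def)
  qed (rule assms)
  then show ?thesis by simp
qed

lemma sum_refined_weight: "(\<Sum>i\<le>N. refined_weight N i) = real ((3 * N + 1) choose N)"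
proof -
  have "(\<Sum>i\<le>N. refined_weight N i) = real (\<Sum>i\<le>N. ((N + i) choose (N + 0)) * ((2 * N - i) choose N))"
    by (simp add: refined_weight_def)
  also have "\<dots> = real ((3 * N + 1) choose N)"
    unfolding shifted_convolution using binomial_symmetric[of N "3 * N + 1"] by simp
  finally show ?thesis .
qed

section \<open>The normalizing constant\<close>

lemma A_asm_Suc: "A_asm (Suc n) = A_asm n * (fact (3 * n + 1) * fact n / (fact (2 * n) * fact (2 * n + 1)))"
proof -
  \<comment> \<open>The product over \<open>j < n + 2\<close> is split once at the bottom and once
    at the top.\<close>
  have "(\<Prod>j<Suc (Suc n). fact (n + j) :: real) = fact n * (\<Prod>j<Suc n. fact (Suc n + j))"
    by (simp only: prod.lessThan_Suc_shift[of _ "Suc n"] add_Suc_shift add_0_right)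
  moreover have "(\<Prod>j<Suc (Suc n). fact (n + j) :: real) = (\<Prod>j<n. fact (n + j)) * fact (n + n) * fact (n + Suc n)"
    by (simp only: prod.lessThan_Suc)
  moreover have "n + n = 2 * n" "n + Suc n = 2 * n + 1" by simp_all
  ultimately have "(\<Prod>j<Suc n. fact (Suc n + j) :: real) * fact n = (\<Prod>j<n. fact (n + j)) * (fact (2 * n) * fact (2 * n + 1))"
    by (simp only: mult_ac)
  then have den: "(\<Prod>j<Suc n. fact (Suc n + j) :: real) = (\<Prod>j<n. fact (n + j)) * (fact (2 * n) * fact (2 * n + 1)) / fact n"
    by (subst eq_divide_eq) simp_all
  show ?thesis
    unfolding A_asm_def prod_dividef den prod.lessThan_Suc[of _ n] by (simp del: fact_Suc)
qed

lemma last_count_at_Suc: "last_count N (int (N + 1)) = refined N 0 / real ((2 * N) choose N) * real ((3 * N + 1) choose N)"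
proof -
  have "last_count N (int (N + 1)) = (\<Sum>i\<le>N. refined N i)"
    using last_count_expansion[of N 0] by simp
  also have "\<dots> = (\<Sum>i\<le>N. refined N 0 / real ((2 * N) choose N) * refined_weight N i)"
    by (intro sum.cong refl refined_eq_weight) simp
  also have "\<dots> = refined N 0 / real ((2 * N) choose N) * real ((3 * N + 1) choose N)"
    unfolding sum_distrib_left[symmetric] sum_refined_weight ..
  finally show ?thesis .
qed

text \<open>By \<open>refined_0\<close> each total is the entry at 0 of the next size, so
  consecutive totals differ by a quotient of two binomials, the ratio in
  \<open>A_asm_Suc\<close>.\<close>

lemma last_count_eq_A_asm: "last_count N (int (N + 1)) = A_asm (Suc N)"
proof (induction N)
  case 0
  then show ?case using last_count_at_Suc[of 0] by (simp add: refined_0_0 A_asm_def)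
next
  case (Suc N)
  let ?n = "Suc N"
  have c1: "real ((2 * ?n) choose ?n) = fact (2 * ?n) / (fact ?n * fact ?n)"
  proof -
    have "2 * ?n - ?n = ?n" "?n \<le> 2 * ?n" by simp_all
    then show ?thesis by (simp only: binomial_fact)
  qed
  have c2: "real ((3 * ?n + 1) choose ?n) = fact (3 * ?n + 1) / (fact ?n * fact (2 * ?n + 1))"
  proof -
    have "3 * ?n + 1 - ?n = 2 * ?n + 1" "?n \<le> 3 * ?n + 1" by simp_all
    then show ?thesis by (simp only: binomial_fact)
  qed
  have cancel: "(a / (b * c)) / (e / (b * b)) = a * b / (e * c)" if "b \<noteq> 0" for a b c e :: real
    using that by (simp add: field_simps)
  have "last_count ?n (int (?n + 1)) = A_asm ?n * (real ((3 * ?n + 1) choose ?n) / real ((2 * ?n) choose ?n))"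
    unfolding last_count_at_Suc[of ?n] refined_0 Suc.IH by (simp only: times_divide_eq_left times_divide_eq_right)
  also have "real ((3 * ?n + 1) choose ?n) / real ((2 * ?n) choose ?n)
      = fact (3 * ?n + 1) * fact ?n / (fact (2 * ?n) * fact (2 * ?n + 1))"
    unfolding c1 c2 by (rule cancel) (rule fact_nonzero)
  finally show ?case unfolding A_asm_Suc[of ?n] .
qed

lemma refined_0_eq: "refined N 0 / real ((2 * N) choose N) = A_asm (Suc N) / real ((3 * N + 1) choose N)"
  using last_count_at_Suc[of N] unfolding last_count_eq_A_asm by (simp add: field_simps)

lemma last_count_eq_sum:
  "last_count N (int (N + 1 + m)) = A_asm (Suc N) / real ((3 * N + 1) choose N) *
     (\<Sum>i\<le>N. real ((m + i) choose i) * refined_weight N i)"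
proof -
  have "last_count N (int (N + 1 + m))
     = (\<Sum>i\<le>N. real ((m + i) choose i) * (refined N 0 / real ((2 * N) choose N) * refined_weight N i))"
    unfolding last_count_expansion by (intro sum.cong refl arg_cong2[of _ _ _ _ "(*)"] refined_eq_weight) simp
  then show ?thesis
    unfolding refined_0_eq sum_distrib_left by (simp add: mult_ac)
qed

section \<open>The second sum\<close>

lemma choose_sum_expand: "(m + i) choose i = (\<Sum>k\<le>m. (m choose k) * (i choose k))"
proof -
  have "(m + i) choose i = (\<Sum>k\<le>i. (m choose k) * (i choose (i - k)))"
    by (rule vandermonde[symmetric])
  also have "\<dots> = (\<Sum>k\<le>i. (m choose k) * (i choose k))"
    by (intro sum.cong refl) (simp add: binomial_symmetric[symmetric])
  also have "\<dots> = (\<Sum>k\<le>max m i. (m choose k) * (i choose k))"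
    by (rule sum.mono_neutral_left) auto
  also have "\<dots> = (\<Sum>k\<le>m. (m choose k) * (i choose k))"
    by (rule sum.mono_neutral_right) auto
  finally show ?thesis .
qed

text \<open>Trinomial revision moves \<open>k\<close> into the lower entry of the next factor, and
  \<open>shifted_convolution\<close> sums the result.\<close>

lemma weighted_choose_sum:
  "(\<Sum>i\<le>N. (i choose k) * (((N + i) choose N) * ((2 * N - i) choose N)))
     = ((N + k) choose N) * ((3 * N + 1) choose (2 * N + k + 1))"
proof -
  have "(i choose k) * ((N + i) choose N) = ((N + k) choose N) * ((N + i) choose (N + k))" for i
  proof (cases "k \<le> i")
    case True
    then have "((N + i) choose (N + k)) * ((N + k) choose N) = ((N + i) choose N) * ((N + i - N) choose (N + k - N))"
      by (intro choose_mult) auto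
    then show ?thesis by (simp add: mult.commute)
  qed (simp add: binomial_eq_0)
  then have "(i choose k) * (((N + i) choose N) * ((2 * N - i) choose N))
      = ((N + k) choose N) * (((N + i) choose (N + k)) * ((2 * N - i) choose N))" for i
    by (metis mult.assoc)
  then show ?thesis by (simp only: sum_distrib_left[symmetric] shifted_convolution)
qed

lemma second_term_eq:
  "real (m choose k) * (real ((N + k) choose N) * real ((3 * N + 1) choose (2 * N + k + 1))) / real ((3 * N + 1) choose N)
     = second_term (Suc N) m k"
proof (cases "k \<le> N")
  case True
  have c1: "real ((N + k) choose N) = fact (N + k) / (fact N * fact k)"
    by (subst binomial_fact) simp_all
  have c2: "real ((3 * N + 1) choose (2 * N + k + 1)) = fact (3 * N + 1) / (fact (2 * N + k + 1) * fact (N - k))"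
  proof -
    have "3 * N + 1 - (2 * N + k + 1) = N - k" "2 * N + k + 1 \<le> 3 * N + 1" using True by simp_all
    then show ?thesis by (simp only: binomial_fact)
  qed
  have c3: "real ((3 * N + 1) choose N) = fact (3 * N + 1) / (fact N * fact (2 * N + 1))"
  proof -
    have "3 * N + 1 - N = 2 * N + 1" "N \<le> 3 * N + 1" by simp_all
    then show ?thesis by (simp only: binomial_fact)
  qed
  have st: "second_term (Suc N) m k = real (m choose k) * (fact (N + k) * fact (2 * N + 1))
        / (fact k * fact (N - k) * fact (2 * N + k + 1))"
    using True by (simp add: second_term_def del: fact_Suc)
  show ?thesis
    unfolding c1 c2 c3 st by (simp del: fact_Suc add: field_simps)
next
  case False
  then show ?thesis by (simp add: second_term_def binomial_eq_0)
qed

lemma last_count_eq_second_sum: "last_count N (int (N + 1 + m)) = A_asm (Suc N) * (\<Sum>k\<le>m. second_term (Suc N) m k)"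
proof -
  let ?w = "\<lambda>i. ((N + i) choose N) * ((2 * N - i) choose N)"
  have "(\<Sum>i\<le>N. ((m + i) choose i) * ?w i) = (\<Sum>i\<le>N. \<Sum>k\<le>m. (m choose k) * ((i choose k) * ?w i))"
    by (intro sum.cong refl) (simp only: choose_sum_expand[of m] sum_distrib_right mult.assoc)
  also have "\<dots> = (\<Sum>k\<le>m. (m choose k) * (\<Sum>i\<le>N. (i choose k) * ?w i))"
    by (subst sum.swap) (simp only: sum_distrib_left)
  also have "\<dots> = (\<Sum>k\<le>m. (m choose k) * (((N + k) choose N) * ((3 * N + 1) choose (2 * N + k + 1))))"
    unfolding weighted_choose_sum ..
  finally have "real (\<Sum>i\<le>N. ((m + i) choose i) * ?w i)
     = real (\<Sum>k\<le>m. (m choose k) * (((N + k) choose N) * ((3 * N + 1) choose (2 * N + k + 1))))"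
    by (rule arg_cong)
  then have "(\<Sum>i\<le>N. real ((m + i) choose i) * refined_weight N i)
     = (\<Sum>k\<le>m. real (m choose k) * (real ((N + k) choose N) * real ((3 * N + 1) choose (2 * N + k + 1))))"
    by (simp only: of_nat_sum of_nat_mult refined_weight_def)
  then have "last_count N (int (N + 1 + m)) = A_asm (Suc N) *
     (\<Sum>k\<le>m. real (m choose k) * (real ((N + k) choose N) * real ((3 * N + 1) choose (2 * N + k + 1))) / real ((3 * N + 1) choose N))"
    unfolding last_count_eq_sum by (simp only: sum_divide_distrib[symmetric]) simp
  then show ?thesis unfolding second_term_eq .
qed

section \<open>The quotient of polynomials in \<open>n\<close>\<close>

definition odd_factors :: "nat \<Rightarrow> nat \<Rightarrow> real poly" where
  "odd_factors k m = (\<Prod>j\<in>{k div 2..<m div 2}. [:of_nat (2 * j + 1), 2:])"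

text \<open>The numerator of the \<open>k\<close>-th summand over the common denominator
  \<open>odd_factors 0 m\<close>. The middle product is what remains of
  \<open>n, ..., n + k - 1\<close> after cancellation; \<open>odd_factors k m\<close> completes the
  denominator.\<close>

definition term_poly :: "nat \<Rightarrow> nat \<Rightarrow> real poly" where
  "term_poly m k = Polynomial.smult (real (m choose k) / (fact k * 2 ^ ((k + 1) div 2)))
     ((\<Prod>i\<in>{1..k}. [:- of_nat i, 1:]) * (\<Prod>j\<in>{(k + 1) div 2..<k}. [:of_nat j, 1:]) * odd_factors k m)"

lemma degree_prod_linear:
  fixes p :: "'i \<Rightarrow> real poly"
  assumes "finite I" "\<And>i. i \<in> I \<Longrightarrow> degree (p i) = 1"
  shows "(\<Prod>i\<in>I. p i) \<noteq> 0 \<and> degree (\<Prod>i\<in>I. p i) = card I"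
proof -
  have nz: "p i \<noteq> 0" if "i \<in> I" for i using assms(2)[OF that] by auto
  then have "degree (\<Prod>i\<in>I. p i) = (\<Sum>i\<in>I. degree (p i))"
    by (intro degree_prod_eq_sum_degree) auto
  then show ?thesis using nz assms by simp
qed

lemma degree_odd_factors: "odd_factors k m \<noteq> 0 \<and> degree (odd_factors k m) = m div 2 - k div 2"
  unfolding odd_factors_def using degree_prod_linear[of "{k div 2..<m div 2}" "\<lambda>j. [:of_nat (2 * j + 1), 2:]"]
  by simp

lemma degree_term_poly:
  assumes "k \<le> m"
  shows "degree (term_poly m k) = k + m div 2"
proof -
  have "(\<Prod>i\<in>{1..k}. [:- of_nat i, 1:] :: real poly) \<noteq> 0 \<and> degree (\<Prod>i\<in>{1..k}. [:- of_nat i, 1:] :: real poly) = card {1..k}"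
    by (rule degree_prod_linear) auto
  moreover have "(\<Prod>j\<in>{(k + 1) div 2..<k}. [:of_nat j, 1:] :: real poly) \<noteq> 0
      \<and> degree (\<Prod>j\<in>{(k + 1) div 2..<k}. [:of_nat j, 1:] :: real poly) = card {(k + 1) div 2..<k}"
    by (rule degree_prod_linear) auto
  moreover have "k + (k - (k + 1) div 2) + (m div 2 - k div 2) = k + m div 2"
    using assms div_le_mono[OF assms, of 2] by linarith
  moreover have "degree (term_poly m k) = k + (k - (k + 1) div 2) + (m div 2 - k div 2)"
    unfolding term_poly_def using calculation(1,2) degree_odd_factors[of k m] assms
    by (simp add: degree_mult_eq)
  ultimately show ?thesis by (simp only:)
qed

text \<open>The degrees \<open>k + m div 2\<close> increase strictly with \<open>k\<close>, so the
  leading term of the last summand cannot cancel.\<close>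

lemma degree_sum_term_poly: "degree (\<Sum>k\<le>m. term_poly m k) = m + m div 2"
proof (cases m)
  case (Suc m')
  have "degree (\<Sum>k\<le>m'. term_poly m k) \<le> m' + m div 2"
    using Suc by (intro degree_sum_le) (auto simp: degree_term_poly)
  then have "degree (\<Sum>k\<le>m'. term_poly m k) < degree (term_poly m m)"
    using Suc by (simp add: degree_term_poly)
  then show ?thesis
    using Suc by (simp add: degree_add_eq_right degree_term_poly)
qed (simp add: degree_term_poly)

text \<open>Even \<open>i\<close> give \<open>2 * (x + j)\<close>, odd \<open>i\<close> give
  \<open>2 * j + 1 + 2 * x\<close>. The former cancel against the numerator, which is why the
  denominator has only degree \<open>m div 2\<close>.\<close>

lemma prod_double_split:
  "(\<Prod>i<k. 2 * x + of_nat i) = 2 ^ ((k + 1) div 2) * (\<Prod>j<(k + 1) div 2. x + of_nat j) * (\<Prod>j<k div 2. of_nat (2 * j + 1) + 2 * x)"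
  for x :: real
proof (induction k)
  case (Suc k)
  show ?case
  proof (cases "even k")
    case True
    then obtain l where "k = 2 * l" by (elim evenE)
    then show ?thesis using Suc by (simp add: algebra_simps)
  next
    case False
    then obtain l where "k = 2 * l + 1" by (elim oddE)
    then show ?thesis using Suc by (simp add: algebra_simps)
  qed
qed simp

text \<open>The quotient has \<open>2 * k\<close> consecutive factors, from \<open>n - k\<close> to
  \<open>n + k - 1\<close>, split at \<open>n\<close>.\<close>

lemma fact_quotient_numerator:
  "k < n \<Longrightarrow> fact (n + k - 1) = (fact (n - k - 1) * (\<Prod>i\<in>{1..k}. real n - real i) * (\<Prod>j<k. real n + real j) :: real)"
proof (induction k)
  case (Suc k)
  then have "n + Suc k - 1 = Suc (n + k - 1)" "n - k - 1 = Suc (n - Suc k - 1)" by simp_all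
  moreover have "real (Suc (n + k - 1)) = real n + real k" using Suc.prems by simp
  moreover have "real (Suc (n - Suc k - 1)) = real n - real (Suc k)" using Suc.prems by simp
  ultimately show ?case
    using Suc by (simp only: fact_Suc) (simp add: algebra_simps)
qed simp

lemma fact_quotient_denominator:
  "1 \<le> n \<Longrightarrow> fact (2 * n + k - 1) = (fact (2 * n - 1) * (\<Prod>i<k. 2 * real n + real i) :: real)"
proof (induction k)
  case (Suc k)
  then have "2 * n + Suc k - 1 = Suc (2 * n + k - 1)" by simp
  moreover have "real (Suc (2 * n + k - 1)) = 2 * real n + real k" using Suc.prems by simp
  ultimately show ?case using Suc by (simp only: fact_Suc) (simp add: algebra_simps)
qed simp

lemma poly_odd_factors_pos: "poly (odd_factors k m) (real n) > 0"
  unfolding odd_factors_def poly_prod by (rule prod_pos) (simp add: add_pos_nonneg)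

lemma second_term_eq_poly:
  assumes "1 \<le> n" "k \<le> m"
  shows "second_term n m k = poly (term_poly m k) (real n) / poly (odd_factors 0 m) (real n)"
proof -
  let ?x = "real n"
  let ?h = "(k + 1) div 2"
  let ?a = "\<Prod>i\<in>{1..k}. ?x - real i" and ?b = "\<Prod>j\<in>{?h..<k}. ?x + real j"
  let ?o = "\<Prod>j<k div 2. real (2 * j + 1) + 2 * ?x"
  have o: "?o = poly (odd_factors 0 k) ?x"
    by (simp add: odd_factors_def poly_prod atLeast0LessThan mult.commute)
  have opos: "?o > 0" unfolding o by (rule poly_odd_factors_pos)
  have osplit: "poly (odd_factors 0 m) ?x = ?o * poly (odd_factors k m) ?x"
  proof -
    have "odd_factors 0 m = odd_factors 0 k * odd_factors k m"
      unfolding odd_factors_def using div_le_mono[OF assms(2), of 2]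
      by (simp add: prod.atLeastLessThan_concat)
    then show ?thesis by (simp only: poly_mult o)
  qed
  have tp: "poly (term_poly m k) ?x = real (m choose k) / (fact k * 2 ^ ?h) * (?a * ?b * poly (odd_factors k m) ?x)"
    by (simp add: term_poly_def poly_prod add.commute)
  have rhs: "poly (term_poly m k) ?x / poly (odd_factors 0 m) ?x
      = real (m choose k) * (?a * ?b) / (fact k * 2 ^ ?h * ?o)"
    unfolding tp osplit using poly_odd_factors_pos[of k m n] by simp
  show ?thesis
  proof (cases "k < n")
    case True
    let ?c = "\<Prod>j<?h. ?x + real j"
    have "0 < ?c" using assms(1) by (intro prod_pos) (simp add: add_pos_nonneg)
    have num: "(\<Prod>j<k. ?x + real j) = ?c * ?b"
      using prod.atLeastLessThan_concat[of 0 ?h k "\<lambda>j. ?x + real j"] by (simp add: atLeast0LessThan)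
    have "second_term n m k = real (m choose k) * (fact (n - k - 1) * ?a * (?c * ?b) * fact (2 * n - 1))
        / (fact k * fact (n - k - 1) * (fact (2 * n - 1) * (2 ^ ?h * ?c * ?o)))"
      using True unfolding second_term_def fact_quotient_numerator[OF True] fact_quotient_denominator[OF assms(1)]
        num prod_double_split by simp
    also have "\<dots> = real (m choose k) * (?a * ?b) / (fact k * 2 ^ ?h * ?o)"
    proof -
      have "r * (u * a * (c * b) * v) / (w * u * (v * (p * c * q))) = r * (a * b) / (w * p * q)"
        if "u \<noteq> 0" "v \<noteq> 0" "c \<noteq> 0" for r u a c b v w p q :: real
        using that by (simp add: field_simps)
      then show ?thesis using \<open>0 < ?c\<close> by (metis fact_nonzero less_irrefl)
    qed
    finally show ?thesis unfolding rhs .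
  next
    case False
    \<comment> \<open>For \<open>k \<ge> n\<close> the factor \<open>n - n\<close> occurs, in
      accordance with the zero convention in \<open>second_term\<close>.\<close>
    then have "?a = 0" using assms(1) by (intro prod_zero) (auto intro!: bexI[of _ n])
    then show ?thesis using False unfolding rhs by (simp add: second_term_def)
  qed
qed

theorem theorem4:
  fixes n m d :: nat
  assumes "n \<ge> 1"
  shows "(real (A_lambda (hook_partition m d) n)
           = A_asm n / real ((3*n-2) choose (n-1)) *
             (\<Sum>j=1..n. real ((m+j-1) choose m) * real ((n+j-2) choose (n-1))
                         * real ((2*n-1-j) choose (n-1))))
         \<and> real (A_lambda (hook_partition m d) n)
           = A_asm n * (\<Sum>k=0..m. second_term n m k)
         \<and> (\<exists>P Q :: real poly.
           degree P = 2*m - (m+1) div 2 \<and> degree Q = m - (m+1) div 2 \<and>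
           (\<forall>n' d'. n' \<ge> 1 \<longrightarrow> poly Q (real n') \<noteq> 0 \<and>
              real (A_lambda (hook_partition m d') n')
                = A_asm n' * (poly P (real n') / poly Q (real n'))))"
proof -
  have second: "real (A_lambda (hook_partition m d) n) = A_asm n * (\<Sum>k\<le>m. second_term n m k)"
    if n: "n \<ge> 1" for n d
  proof -
    obtain N where "n = Suc N" using n by (cases n) auto
    then show ?thesis by (simp only: A_lambda_eq_last_count last_count_eq_second_sum)
  qed
  obtain N where N: "n = Suc N" using assms by (cases n) auto
  have "(\<Sum>i\<le>N. real ((m + i) choose i) * refined_weight N i)
      = (\<Sum>j=1..n. real ((m+j-1) choose m) * real ((n+j-2) choose (n-1)) * real ((2*n-1-j) choose (n-1)))"
  proof (rule sum.reindex_bij_witness[of _ "\<lambda>j. j - 1" Suc])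
    fix i assume "i \<in> {..N}"
    have "(m + i) choose m = (m + i) choose i"
      using binomial_symmetric[of m "m + i"] by simp
    then show "real ((m + Suc i - 1) choose m) * real ((n + Suc i - 2) choose (n - 1)) * real ((2 * n - 1 - Suc i) choose (n - 1))
        = real ((m + i) choose i) * refined_weight N i"
      by (simp add: N refined_weight_def)
  qed (auto simp: N)
  moreover have "3 * n - 2 = 3 * N + 1" "n - 1 = N" by (simp_all add: N)
  ultimately have first: "real (A_lambda (hook_partition m d) n)
           = A_asm n / real ((3*n-2) choose (n-1)) *
             (\<Sum>j=1..n. real ((m+j-1) choose m) * real ((n+j-2) choose (n-1))
                         * real ((2*n-1-j) choose (n-1)))"
    unfolding N A_lambda_eq_last_count last_count_eq_sum by simp
  have "degree (\<Sum>k\<le>m. term_poly m k) = 2 * m - (m + 1) div 2"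
    unfolding degree_sum_term_poly by linarith
  moreover have "degree (odd_factors 0 m) = m - (m + 1) div 2"
    using degree_odd_factors[of 0 m] by simp
  moreover have "poly (odd_factors 0 m) (real n') \<noteq> 0 \<and>
      real (A_lambda (hook_partition m d') n')
        = A_asm n' * (poly (\<Sum>k\<le>m. term_poly m k) (real n') / poly (odd_factors 0 m) (real n'))"
    if "n' \<ge> 1" for n' d'
  proof -
    have "(\<Sum>k\<le>m. second_term n' m k) = poly (\<Sum>k\<le>m. term_poly m k) (real n') / poly (odd_factors 0 m) (real n')"
      unfolding poly_sum sum_divide_distrib using that by (intro sum.cong refl) (simp add: second_term_eq_poly)
    then show ?thesis using second[OF that] poly_odd_factors_pos[of 0 m n'] by simp
  qed
  ultimately show ?thesis
    using first second[OF assms] unfolding atLeast0AtMost by blast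
qed

end
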